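(* Under the standing assumptions below, for every $\gamma\in\mathbb R^I_+$, $x_0\in\mathcal X$, $s_0\in\mathcal S$, the maximum value of the ex-post lottery problem for $(\gamma,x_0,s_0)$ equals $\tilde D(\gamma,x_0,s_0)$. Moreover, $\tilde D$ is the largest solution in $\mathcal N$ of the functional equation $F(\gamma,x,s)=\sup_{a\in\tilde{\mathcal A}(x,s)}\inf_{\lambda\in\mathbb R^I_+}\big[r(x,a,s)+\sum_i(\gamma^ig^i(x,a,s)+\lambda^i(g^i(x,a,s)-\bar g^i))+\beta\mathbb E_sF(\gamma+\lambda,\zeta(x,a,s),s')\big]$.
   Context: Setup. Let $\mathcal S$ be a finite set and $(s_t)_{t\ge0}$ a Markov chain on $\mathcal S$ with transition probabilities $\pi(s'|s)>0$ for all $s,s'$; for $s^t=(s_0,\dots,s_t)$ write $\pi^t(s^t|s_0)$ for its probability and $\mathbb E_{s^t}$ (or $\mathbb E_{s_t}$) for expectation over future shocks given $s^t$; $\mathbb E_s$ denotes expectation over $s'\sim\pi(\cdot|s)$. Let $\mathcal A\subset\mathbb R^n$ be finite, $\mathcal X\subseteq\mathbb R^m$ countable, $\zeta:\mathcal X\times\mathcal A\times\mathcal S\to\mathcal X$, $p:\mathcal X\times\mathcal A\times\mathcal S\to\mathbb R$, $r,g^1,\dots,g^I$ bounded real functions on $\mathcal X\times\mathcal A\times\mathcal S$, $\bar g^i\in\mathbb R$, $\beta\in(0,1)$. A plan is $a=(a(s^t))_{t,s^t}$, $a(s^t)\in\mathcal A$, inducing $x(s^0)=x_0$, $x(s^{t+1})=\zeta(x(s^t),a(s^t),s_t)$.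 $\tilde{\mathcal A}(x,s)=\{a:p(x,a,s)\ge0\}$; $\tilde{\mathcal A}^\infty(x_0)$ is the set of plans with $a(s^t)\in\tilde{\mathcal A}(x(s^t),s_t)$ for all $t,s^t$. A plan is feasible for $(x_0,s_0)$ if it lies in $\tilde{\mathcal A}^\infty(x_0)$ and $\mathbb E_{s_t}\sum_{n\ge0}\beta^ng^i(x(s^{t+n}),a(s^{t+n}),s_{t+n})\ge\bar g^i$ for all $t,s^t,i$. Standing assumption: for every $(x_0,s_0)$ a feasible plan exists. $\tilde D$: post-action histories $\tilde h^t=(s_0,a_0,\dots,s_t,a_t)\in\tilde{\mathcal H}^t=\mathcal S^{t+1}\times\mathcal A^{t+1}$; a plan generates $\tilde h^t=(s_0,a(s^0),\dots,s_t,a(s^t))$. $\tilde\Lambda$: families $\lambda^i(\tilde h^t)\ge0$ with $\sum_t\sum_{\tilde h^t}\sum_i\beta^t\lambda^i(\tilde h^t)\pi^t(s^t|s_0)<\infty$. $\tilde L(a,\lambda;\gamma,x_0,s_0)=\mathbb E_{s_0}\sum_t\beta^t\big[r(x(s^t),a(s^t),s_t)+\sum_i\gamma^ig^i(x(s^t),a(s^t),s_t)+\sum_i\lambda^i(\tilde h^t)(\sum_{n\ge0}\beta^ng^i(x(s^{t+n}),a(s^{t+n}),s_{t+n})-\bar g^i)\big]$ and $\tilde D(\gamma,x_0,s_0)=\inf_{\lambda\in\tilde\Lambda}\sup_{a\in\tilde{\mathcal A}^\infty(x_0)}\tilde L$. Ex-post lottery problem. Give $\tilde{\mathcal A}^\infty(x_0)$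 the product topology, let $\mathcal P(\tilde{\mathcal A}^\infty(x_0))$ be its Borel probability measures, random plans $a\sim P$ independent of shocks. Maximize $\mathbb E^{a\sim P}_{s_0}\sum_t\beta^t\big(r(x(s^t),a(s^t),s_t)+\sum_i\gamma^ig^i(x(s^t),a(s^t),s_t)\big)$ over $P$ subject to: for all $t$, all $\tilde h^t=(s_0,\tilde a_0,\dots,s_t,\tilde a_t)\in\tilde{\mathcal H}^t$ and all $i$, $\mathbb E^{a\sim P}_{s^t}\big[\mathbf 1\{(a(s^0),\dots,a(s^t))=(\tilde a_0,\dots,\tilde a_t)\}(\sum_{n\ge0}\beta^ng^i(x(s^{t+n}),a(s^{t+n}),s_{t+n})-\bar g^i)\big]\ge0$, with $s^t$ the shock history in $\tilde h^t$. Function spaces. $L=(\|r\|_\infty+\sum_i\|g^i\|_\infty)/(1-\beta)$, $B(k)=\{\gamma\in\mathbb R^I_+:\|\gamma\|_\infty\le k\}$, $\mathcal S=\{s_1,\dots,s_{|\mathcal S|}\}$, $\mathcal X=\{x_1,x_2,\dots\}$. $\mathcal M$: functions $F:\mathbb R^I_+\times\mathcal X\times\mathcal S\to\mathbb R$ with $F(\cdot,x,s)\in L^\infty(B(k))$ for all $k$ and $\|F\|_{\mathcal M}=\sum_i2^{-i}\sum_j2^{-j}\sum_{k\ge1}2^{-k}\|F(\cdot,x_j,s_i)\|_{L^\infty(B(k))}<\infty$. $\mathcal N$: those $F\in\mathcal M$ with, for all $x,s$, (i) $F(\cdot,x,s)$ convex; (ii) $|F(\gamma_1,x,s)-F(\gamma_2,x,s)|\le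 L\|\gamma_1-\gamma_2\|_1$; (iii) $F(\gamma,x,s)\ge v^0+\sum_i\gamma^iv^i$ for every feasible plan for $(x,s)$, $v^0=\mathbb E_s\sum_t\beta^tr(\cdot)$, $v^i=\mathbb E_s\sum_t\beta^tg^i(\cdot)$; (iv) $F(\gamma,x,s)\le(1+\sum_i\gamma^i)L$. *)

theory Defs
  imports "HOL-Probability.Probability"
begin

text \<open>Shock histories s^t = (s_0,...,s_t) are nonempty lists.  pi s s' is the
transition probability pi(s'|s).\<close>

definition pathprob :: "('s \<Rightarrow> 's \<Rightarrow> real) \<Rightarrow> 's list \<Rightarrow> real" where
  "pathprob \<pi> h = (\<Prod>k<length h - 1. \<pi> (h ! k) (h ! Suc k))"

definition condE :: "('s::finite \<Rightarrow> 's \<Rightarrow> real) \<Rightarrow> 's list \<Rightarrow> nat \<Rightarrow> ('s list \<Rightarrow> real) \<Rightarrow> real" where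
  "condE \<pi> h n f = (\<Sum>e\<in>{e::'s list. length e = n}. (pathprob \<pi> (h @ e) / pathprob \<pi> h) * f (h @ e))"

primrec xit :: "('x \<Rightarrow> 'a \<Rightarrow> 's \<Rightarrow> 'x) \<Rightarrow> 'x \<Rightarrow> ('s list \<Rightarrow> 'a) \<Rightarrow> 's list \<Rightarrow> nat \<Rightarrow> 'x" where
  "xit \<zeta> x0 a h 0 = x0"
| "xit \<zeta> x0 a h (Suc n) = \<zeta> (xit \<zeta> x0 a h n) (a (take (Suc n) h)) (h ! n)"

definition xpath :: "('x \<Rightarrow> 'a \<Rightarrow> 's \<Rightarrow> 'x) \<Rightarrow> 'x \<Rightarrow> ('s list \<Rightarrow> 'a) \<Rightarrow> 's list \<Rightarrow> 'x" where
  "xpath \<zeta> x0 a h = xit \<zeta> x0 a h (length h - 1)"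

definition flow :: "('x \<Rightarrow> 'a \<Rightarrow> 's \<Rightarrow> real) \<Rightarrow> ('x \<Rightarrow> 'a \<Rightarrow> 's \<Rightarrow> 'x) \<Rightarrow> 'x \<Rightarrow> ('s list \<Rightarrow> 'a) \<Rightarrow> 's list \<Rightarrow> real" where
  "flow f \<zeta> x0 a h = f (xpath \<zeta> x0 a h) (a h) (last h)"

text \<open>E_{s^t} sum_{n>=0} beta^n f(x(s^{t+n}),a(s^{t+n}),s_{t+n}) (expectation of the
bounded discounted sum, written as the series of expectations).\<close>
definition cont :: "real \<Rightarrow> ('s::finite \<Rightarrow> 's \<Rightarrow> real) \<Rightarrow> ('x \<Rightarrow> 'a \<Rightarrow> 's \<Rightarrow> 'x) \<Rightarrow> 'x
     \<Rightarrow> ('s list \<Rightarrow> 'a) \<Rightarrow> ('x \<Rightarrow> 'a \<Rightarrow> 's \<Rightarrow> real) \<Rightarrow> 's list \<Rightarrow> real" where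
  "cont \<beta> \<pi> \<zeta> x0 a f h = (\<Sum>n. \<beta> ^ n * condE \<pi> h n (flow f \<zeta> x0 a))"

definition Atil :: "'a set \<Rightarrow> ('x \<Rightarrow> 'a \<Rightarrow> 's \<Rightarrow> real) \<Rightarrow> 'x \<Rightarrow> 's \<Rightarrow> 'a set" where
  "Atil A p x s = {a \<in> A. p x a s \<ge> 0}"

definition Hist :: "'s list set" where
  "Hist = {h. h \<noteq> []}"

definition Ainf :: "'a set \<Rightarrow> ('x \<Rightarrow> 'a \<Rightarrow> 's \<Rightarrow> real) \<Rightarrow> ('x \<Rightarrow> 'a \<Rightarrow> 's \<Rightarrow> 'x) \<Rightarrow> 'x
     \<Rightarrow> ('s list \<Rightarrow> 'a) set" where
  "Ainf A p \<zeta> x0 = {a \<in> PiE Hist (\<lambda>_. A).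
      \<forall>h\<in>Hist. a h \<in> Atil A p (xpath \<zeta> x0 a h) (last h)}"

definition feasible :: "'a set \<Rightarrow> ('x \<Rightarrow> 'a \<Rightarrow> 's \<Rightarrow> real) \<Rightarrow> ('x \<Rightarrow> 'a \<Rightarrow> 's \<Rightarrow> 'x)
     \<Rightarrow> ('s::finite \<Rightarrow> 's \<Rightarrow> real) \<Rightarrow> real \<Rightarrow> ('i \<Rightarrow> 'x \<Rightarrow> 'a \<Rightarrow> 's \<Rightarrow> real) \<Rightarrow> ('i \<Rightarrow> real)
     \<Rightarrow> 'x \<Rightarrow> 's \<Rightarrow> ('s list \<Rightarrow> 'a) \<Rightarrow> bool" where
  "feasible A p \<zeta> \<pi> \<beta> g gbar x0 s0 a \<longleftrightarrow>
     a \<in> Ainf A p \<zeta> x0 \<and>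
     (\<forall>h\<in>Hist. \<forall>i. hd h = s0 \<longrightarrow> cont \<beta> \<pi> \<zeta> x0 a (g i) h \<ge> gbar i)"

definition htil :: "('s list \<Rightarrow> 'a) \<Rightarrow> 's list \<Rightarrow> ('s \<times> 'a) list" where
  "htil a h = map (\<lambda>k. (h ! k, a (take (Suc k) h))) [0..<length h]"

definition Htil :: "'a set \<Rightarrow> nat \<Rightarrow> ('s \<times> 'a) list set" where
  "Htil A t = {ht. length ht = Suc t \<and> set (map snd ht) \<subseteq> A}"

definition Lam :: "real \<Rightarrow> ('s::finite \<Rightarrow> 's \<Rightarrow> real) \<Rightarrow> 'a set
     \<Rightarrow> (('s \<times> 'a) list \<Rightarrow> real ^ 'i::finite) set" where
  "Lam \<beta> \<pi> A = {lam. (\<forall>t. \<forall>ht\<in>Htil A t. \<forall>i. 0 \<le> lam ht $ i) \<and>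
      summable (\<lambda>t. \<beta> ^ t * (\<Sum>ht\<in>Htil A t. \<Sum>i\<in>UNIV. lam ht $ i * pathprob \<pi> (map fst ht)))}"

definition Ltil :: "real \<Rightarrow> ('s::finite \<Rightarrow> 's \<Rightarrow> real) \<Rightarrow> ('x \<Rightarrow> 'a \<Rightarrow> 's \<Rightarrow> 'x)
     \<Rightarrow> ('x \<Rightarrow> 'a \<Rightarrow> 's \<Rightarrow> real) \<Rightarrow> ('i::finite \<Rightarrow> 'x \<Rightarrow> 'a \<Rightarrow> 's \<Rightarrow> real) \<Rightarrow> ('i \<Rightarrow> real)
     \<Rightarrow> ('s list \<Rightarrow> 'a) \<Rightarrow> (('s \<times> 'a) list \<Rightarrow> real ^ 'i) \<Rightarrow> real ^ 'i \<Rightarrow> 'x \<Rightarrow> 's \<Rightarrow> real" where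
  "Ltil \<beta> \<pi> \<zeta> r g gbar a lam \<gamma> x0 s0 =
     (\<Sum>t. \<beta> ^ t * condE \<pi> [s0] t (\<lambda>h.
        flow r \<zeta> x0 a h + (\<Sum>i\<in>UNIV. \<gamma> $ i * flow (g i) \<zeta> x0 a h)
        + (\<Sum>i\<in>UNIV. lam (htil a h) $ i * (cont \<beta> \<pi> \<zeta> x0 a (g i) h - gbar i))))"

definition Dtil :: "'a set \<Rightarrow> ('x \<Rightarrow> 'a \<Rightarrow> 's \<Rightarrow> real) \<Rightarrow> real \<Rightarrow> ('s::finite \<Rightarrow> 's \<Rightarrow> real)
     \<Rightarrow> ('x \<Rightarrow> 'a \<Rightarrow> 's \<Rightarrow> 'x) \<Rightarrow> ('x \<Rightarrow> 'a \<Rightarrow> 's \<Rightarrow> real) \<Rightarrow> ('i::finite \<Rightarrow> 'x \<Rightarrow> 'a \<Rightarrow> 's \<Rightarrow> real)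
     \<Rightarrow> ('i \<Rightarrow> real) \<Rightarrow> real ^ 'i \<Rightarrow> 'x \<Rightarrow> 's \<Rightarrow> ereal" where
  "Dtil A p \<beta> \<pi> \<zeta> r g gbar \<gamma> x0 s0 =
     (INF lam\<in>Lam \<beta> \<pi> A. SUP a\<in>Ainf A p \<zeta> x0. ereal (Ltil \<beta> \<pi> \<zeta> r g gbar a lam \<gamma> x0 s0))"

text \<open>Plan space with the product topology of the discrete finite set A over the
countably many histories; its Borel sigma-algebra is the product sigma-algebra.\<close>
definition PlanM :: "'a set \<Rightarrow> ('s list \<Rightarrow> 'a) measure" where
  "PlanM A = PiM Hist (\<lambda>_. count_space A)"

definition LotObj :: "real \<Rightarrow> ('s::finite \<Rightarrow> 's \<Rightarrow> real) \<Rightarrow> ('x \<Rightarrow> 'a \<Rightarrow> 's \<Rightarrow> 'x)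
     \<Rightarrow> ('x \<Rightarrow> 'a \<Rightarrow> 's \<Rightarrow> real) \<Rightarrow> ('i::finite \<Rightarrow> 'x \<Rightarrow> 'a \<Rightarrow> 's \<Rightarrow> real)
     \<Rightarrow> real ^ 'i \<Rightarrow> 'x \<Rightarrow> 's \<Rightarrow> ('s list \<Rightarrow> 'a) measure \<Rightarrow> real" where
  "LotObj \<beta> \<pi> \<zeta> r g \<gamma> x0 s0 P =
     (\<integral>a. cont \<beta> \<pi> \<zeta> x0 a (\<lambda>x b s. r x b s + (\<Sum>i\<in>UNIV. \<gamma> $ i * g i x b s)) [s0] \<partial>P)"

definition LotFeas :: "'a set \<Rightarrow> ('x \<Rightarrow> 'a \<Rightarrow> 's \<Rightarrow> real) \<Rightarrow> real \<Rightarrow> ('s::finite \<Rightarrow> 's \<Rightarrow> real)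
     \<Rightarrow> ('x \<Rightarrow> 'a \<Rightarrow> 's \<Rightarrow> 'x) \<Rightarrow> ('i \<Rightarrow> 'x \<Rightarrow> 'a \<Rightarrow> 's \<Rightarrow> real) \<Rightarrow> ('i \<Rightarrow> real)
     \<Rightarrow> 'x \<Rightarrow> ('s list \<Rightarrow> 'a) measure \<Rightarrow> bool" where
  "LotFeas A p \<beta> \<pi> \<zeta> g gbar x0 P \<longleftrightarrow>
     prob_space P \<and> sets P = sets (restrict_space (PlanM A) (Ainf A p \<zeta> x0)) \<and>
     (\<forall>t. \<forall>ht\<in>Htil A t. \<forall>i.
        0 \<le> (\<integral>a. (if map (\<lambda>k. a (take (Suc k) (map fst ht))) [0..<Suc t] = map snd ht
                    then cont \<beta> \<pi> \<zeta> x0 a (g i) (map fst ht) - gbar i else 0) \<partial>P))"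

definition Bk :: "real \<Rightarrow> (real ^ 'i::finite) set" where
  "Bk k = {\<gamma>. \<forall>i. 0 \<le> \<gamma> $ i \<and> \<gamma> $ i \<le> k}"

definition nonneg :: "(real ^ 'i::finite) set" where
  "nonneg = {\<gamma>. \<forall>i. 0 \<le> \<gamma> $ i}"

text \<open>L-infinity norm on B(k) (esssup is top for non-measurable functions).\<close>
definition Linf :: "real \<Rightarrow> (real ^ 'i::finite \<Rightarrow> real) \<Rightarrow> ereal" where
  "Linf k f = esssup (lebesgue_on (Bk k)) (\<lambda>\<gamma>. ereal \<bar>f \<gamma>\<bar>)"

text \<open>X = {x_1, x_2, ...} enumerated by from_nat_into (index j+1 for j = 0,1,...).\<close>
definition inM :: "'x set \<Rightarrow> (real ^ 'i::finite \<Rightarrow> 'x \<Rightarrow> 's::finite \<Rightarrow> real) \<Rightarrow> bool" where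
  "inM X F \<longleftrightarrow>
     (\<forall>x\<in>X. \<forall>s. \<forall>k::nat. k \<ge> 1 \<longrightarrow> Linf (real k) (\<lambda>\<gamma>. F \<gamma> x s) < \<infinity>) \<and>
     (\<Sum>s\<in>(UNIV::'s set). \<Sum>j. \<Sum>k. ennreal ((1/2) ^ Suc j * (1/2) ^ Suc k)
         * e2ennreal (Linf (real (Suc k)) (\<lambda>\<gamma>. F \<gamma> (from_nat_into X j) s))) < \<top>"

definition supnorm :: "'x set \<Rightarrow> 'a set \<Rightarrow> ('x \<Rightarrow> 'a \<Rightarrow> 's \<Rightarrow> real) \<Rightarrow> real" where
  "supnorm X A f = (SUP (x, a, s)\<in>X \<times> A \<times> UNIV. \<bar>f x a s\<bar>)"

definition Lconst :: "'x set \<Rightarrow> 'a set \<Rightarrow> real \<Rightarrow> ('x \<Rightarrow> 'a \<Rightarrow> 's \<Rightarrow> real)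
     \<Rightarrow> ('i::finite \<Rightarrow> 'x \<Rightarrow> 'a \<Rightarrow> 's \<Rightarrow> real) \<Rightarrow> real" where
  "Lconst X A \<beta> r g = (supnorm X A r + (\<Sum>i\<in>UNIV. supnorm X A (g i))) / (1 - \<beta>)"

definition inN :: "'x set \<Rightarrow> 'a set \<Rightarrow> ('x \<Rightarrow> 'a \<Rightarrow> 's \<Rightarrow> real) \<Rightarrow> real \<Rightarrow> ('s::finite \<Rightarrow> 's \<Rightarrow> real)
     \<Rightarrow> ('x \<Rightarrow> 'a \<Rightarrow> 's \<Rightarrow> 'x) \<Rightarrow> ('x \<Rightarrow> 'a \<Rightarrow> 's \<Rightarrow> real) \<Rightarrow> ('i::finite \<Rightarrow> 'x \<Rightarrow> 'a \<Rightarrow> 's \<Rightarrow> real)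
     \<Rightarrow> ('i \<Rightarrow> real) \<Rightarrow> (real ^ 'i \<Rightarrow> 'x \<Rightarrow> 's \<Rightarrow> real) \<Rightarrow> bool" where
  "inN X A p \<beta> \<pi> \<zeta> r g gbar F \<longleftrightarrow> inM X F \<and>
     (\<forall>x\<in>X. \<forall>s.
        convex_on nonneg (\<lambda>\<gamma>. F \<gamma> x s) \<and>
        (\<forall>\<gamma>1\<in>nonneg. \<forall>\<gamma>2\<in>nonneg. \<bar>F \<gamma>1 x s - F \<gamma>2 x s\<bar>
             \<le> Lconst X A \<beta> r g * (\<Sum>i\<in>UNIV. \<bar>\<gamma>1 $ i - \<gamma>2 $ i\<bar>)) \<and>
        (\<forall>a. feasible A p \<zeta> \<pi> \<beta> g gbar x s a \<longrightarrow>
           (\<forall>\<gamma>\<in>nonneg. F \<gamma> x s \<ge> cont \<beta> \<pi> \<zeta> x a r [s]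
                + (\<Sum>i\<in>UNIV. \<gamma> $ i * cont \<beta> \<pi> \<zeta> x a (g i) [s]))) \<and>
        (\<forall>\<gamma>\<in>nonneg. F \<gamma> x s \<le> (1 + (\<Sum>i\<in>UNIV. \<gamma> $ i)) * Lconst X A \<beta> r g))"

definition Bellman :: "'x set \<Rightarrow> 'a set \<Rightarrow> ('x \<Rightarrow> 'a \<Rightarrow> 's \<Rightarrow> real) \<Rightarrow> real \<Rightarrow> ('s::finite \<Rightarrow> 's \<Rightarrow> real)
     \<Rightarrow> ('x \<Rightarrow> 'a \<Rightarrow> 's \<Rightarrow> 'x) \<Rightarrow> ('x \<Rightarrow> 'a \<Rightarrow> 's \<Rightarrow> real) \<Rightarrow> ('i::finite \<Rightarrow> 'x \<Rightarrow> 'a \<Rightarrow> 's \<Rightarrow> real)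
     \<Rightarrow> ('i \<Rightarrow> real) \<Rightarrow> (real ^ 'i \<Rightarrow> 'x \<Rightarrow> 's \<Rightarrow> real) \<Rightarrow> bool" where
  "Bellman X A p \<beta> \<pi> \<zeta> r g gbar F \<longleftrightarrow>
     (\<forall>\<gamma>\<in>nonneg. \<forall>x\<in>X. \<forall>s.
        ereal (F \<gamma> x s) =
          (SUP a\<in>Atil A p x s. INF lam\<in>nonneg.
             ereal (r x a s + (\<Sum>i\<in>UNIV. \<gamma> $ i * g i x a s + lam $ i * (g i x a s - gbar i))
                    + \<beta> * (\<Sum>s'\<in>UNIV. \<pi> s s' * F (\<gamma> + lam) (\<zeta> x a s) s'))))"

end

theory Submission
  imports Defs
begin

text \<open>
  The Lagrangian satisfies a one-period recursion in which the multiplier chosen after the action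
  \<open>a\<^sub>0\<close> is added to the weight \<open>\<gamma>\<close> of the continuation problem. As multipliers may depend on the current
  action and continuation plans and multipliers can be chosen separately for every successor
  shock, infimum and supremum can be interchanged within a period, which is the functional
  equation. Any other solution \<open>G\<close> is dominated: playing greedily for \<open>G\<close> against a fixed multiplier
  gives a plan whose Lagrangian is at least \<open>G\<close> up to a discounted remainder that vanishes because
  multipliers are summable.

  For the lottery problem, only the probabilities \<open>m k\<close> with which the lottery plays along the
  post-action history \<open>k\<close> matter. The consistent families \<open>m\<close> form a compact convex set on which
  objective and constraints are affine and continuous; by compactness, finitely many constraints
  decide solvability, and finitely many constraints admit Lagrange multipliers. Every consistent
  family comes from a lottery by Kuhn's theorem. The infimum over multipliers need not be attained.
\<close>

section \<open>Histories, plans and conditional expectations\<close>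

text \<open>Nothing grants a Slater point: the constraints may hold only with equality, and
  multipliers for the exact optimal value need not exist. Separation is therefore done at a level
  strictly above what finitely many constraints permit: the compact set of pairs (objective,
  constraint) is then disjoint from a closed quadrant, and a feasible point is enough. Levels and
  constraints are exhausted together by one compactness argument.

  A plan also prescribes actions after shocks that do not occur. Payoffs and constraints look along
  single shock histories, so they see a plan \<open>a\<close> only through the 0-1 family
  \<open>follows a\<close>, and linearly; averaging over a lottery replaces \<open>follows a\<close>
  by its mean \<open>induced P\<close> in the same formula.

  Lottery constraints range over histories from every initial shock, while the Lagrangian at
  \<open>s0\<close> meets only those that start in \<open>s0\<close>. Plans act independently after
  different initial shocks, so a plan for \<open>s0\<close> is spliced with feasible plans for the
  others; this leaves the Lagrangian at \<open>s0\<close> unchanged and satisfies the remaining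
  constraints.\<close>

lemma pathprob_single [simp]: "pathprob \<pi> [s] = 1"
  by (simp add: pathprob_def)

lemma pathprob_Cons:
  assumes "h \<noteq> []"
  shows "pathprob \<pi> (s # h) = \<pi> s (hd h) * pathprob \<pi> h"
proof -
  obtain s' h' where h: "h = s' # h'"
    using assms by (cases h) auto
  show ?thesis
    unfolding pathprob_def h by (simp add: prod.lessThan_Suc_shift del: prod.lessThan_Suc)
qed

lemma pathprob_pos:
  assumes "\<And>s s'. \<pi> s s' > 0"
  shows "pathprob \<pi> h > 0"
  unfolding pathprob_def using assms by (intro prod_pos) auto

section \<open>Sums over shock sequences and over post-action histories\<close>

lemma sum_lists_Suc:
  fixes f :: "'s::finite list \<Rightarrow> 'b::comm_monoid_add"
  shows "(\<Sum>e | length e = Suc n. f e) = (\<Sum>s\<in>UNIV. \<Sum>e | length e = n. f (s # e))"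
proof -
  have fin: "finite {e::'s list. length e = n}"
    using finite_lists_length_eq[of "UNIV::'s set" n] by simp
  have eq: "{e::'s list. length e = Suc n} = (\<lambda>(s,e). s # e) ` (UNIV \<times> {e. length e = n})"
    by (auto simp: image_def length_Suc_conv)
  show ?thesis
    unfolding eq
    by (subst sum.reindex) (auto simp: inj_on_def sum.cartesian_product fin case_prod_beta intro!: sum.cong)
qed

text \<open>Indexed by the number of entries rather than by the date, so that inductions can start
  from the empty history; date \<open>t\<close> corresponds to length \<open>Suc t\<close>.\<close>

definition alists :: "'a set \<Rightarrow> nat \<Rightarrow> ('s \<times> 'a) list set" where
  "alists A n = {k. length k = n \<and> set (map snd k) \<subseteq> A}"

lemma alists_0 [simp]: "alists A 0 = {[]}"
  by (auto simp: alists_def)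

lemma Htil_alists: "Htil A t = alists A (Suc t)"
  by (simp add: alists_def Htil_def)

lemma alists_append: "h \<in> alists A m \<Longrightarrow> k \<in> alists A n \<Longrightarrow> h @ k \<in> alists A (m + n)"
  by (auto simp: alists_def)

lemma finite_alists [simp]:
  assumes "finite A"
  shows "finite (alists A n :: ('s::finite \<times> 'a) list set)"
proof -
  have "alists A n = {k :: ('s \<times> 'a) list. set k \<subseteq> UNIV \<times> A \<and> length k = n}"
    by (auto simp: alists_def)
  then show ?thesis
    using finite_lists_length_eq[of "(UNIV::'s set) \<times> A" n] assms by simp
qed

lemma sum_alists_Suc:
  fixes f :: "('s::finite \<times> 'a) list \<Rightarrow> 'b::comm_monoid_add"
  assumes "finite A"
  shows "(\<Sum>k\<in>alists A (Suc n). f k) = (\<Sum>s\<in>UNIV. \<Sum>b\<in>A. \<Sum>k\<in>alists A n. f ((s, b) # k))"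
proof -
  have eq: "(alists A (Suc n) :: ('s \<times> 'a) list set)
      = (\<lambda>(s,b,e). (s,b) # e) ` (UNIV \<times> A \<times> alists A n)"
    by (force simp: image_def length_Suc_conv alists_def)
  show ?thesis
    unfolding eq
    by (subst sum.reindex)
      (auto simp: inj_on_def sum.cartesian_product assms case_prod_beta intro!: sum.cong)
qed

text \<open>The plan as seen from the next period, after first shock \<open>s\<close>. The value
  \<open>undefined\<close> at \<open>[]\<close> keeps the result extensional on \<open>Hist\<close>,
  as membership in \<open>Ainf\<close> demands.\<close>

definition shift_plan :: "('s list \<Rightarrow> 'a) \<Rightarrow> 's \<Rightarrow> 's list \<Rightarrow> 'a" where
  "shift_plan a s = (\<lambda>h. if h = [] then undefined else a (s # h))"

text \<open>Inverse to shifting: \<open>b\<close> gives the first action for each initial shock, and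
  \<open>c s\<close> is the plan from then on.\<close>

definition cons_plan :: "('s \<Rightarrow> 'a) \<Rightarrow> ('s \<Rightarrow> 's list \<Rightarrow> 'a) \<Rightarrow> 's list \<Rightarrow> 'a" where
  "cons_plan b c = (\<lambda>h. if h = [] then undefined else if tl h = [] then b (hd h) else c (hd h) (tl h))"

text \<open>Histories with different first shocks share no nonempty prefix, so a separate plan may
  be used for each initial shock.\<close>

definition splice_plan :: "('s \<Rightarrow> 's list \<Rightarrow> 'a) \<Rightarrow> 's list \<Rightarrow> 'a" where
  "splice_plan c = (\<lambda>h. if h = [] then undefined else c (hd h) h)"

lemma xpath_single [simp]: "xpath \<zeta> x a [s] = x"
  by (simp add: xpath_def)

lemma xpath_Cons:
  assumes "h \<noteq> []"
  shows "xpath \<zeta> x a (s # h) = xpath \<zeta> (\<zeta> x (a [s]) s) (shift_plan a s) h"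
proof -
  have *: "xit \<zeta> x a (s # h) (Suc n) = xit \<zeta> (\<zeta> x (a [s]) s) (shift_plan a s) h n" for n
  proof (induction n)
    case (Suc n)
    show ?case
      by (subst xit.simps, subst Suc.IH) (simp add: shift_plan_def assms)
  qed simp
  have "length (s # h) - 1 = Suc (length h - 1)"
    using assms by (cases h) auto
  then show ?thesis
    unfolding xpath_def * by (simp only: *)
qed

lemma flow_single [simp]: "flow f \<zeta> x a [s] = f x (a [s]) s"
  by (simp add: flow_def)

lemma flow_Cons: "h \<noteq> [] \<Longrightarrow> flow f \<zeta> x a (s # h) = flow f \<zeta> (\<zeta> x (a [s]) s) (shift_plan a s) h"
  by (simp add: flow_def xpath_Cons shift_plan_def)

lemma htil_Nil [simp]: "htil a [] = []"
  by (simp add: htil_def)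

lemma htil_Cons: "htil a (s # h) = (s, a [s]) # htil (shift_plan a s) h"
proof -
  have "[0..<length (s # h)] = 0 # map Suc [0..<length h]"
    by (simp add: map_Suc_upt upt_conv_Cons del: upt_Suc)
  then show ?thesis
    by (auto simp: htil_def shift_plan_def o_def)
qed

lemma htil_snoc: "htil a (h @ [s]) = htil a h @ [(s, a (h @ [s]))]"
  by (simp add: htil_def nth_append)

lemma length_htil [simp]: "length (htil a h) = length h"
  by (simp add: htil_def)

lemma map_fst_htil [simp]: "map fst (htil a h) = h"
  by (simp add: htil_def o_def map_nth)

lemma htil_eq_Nil [simp]: "htil a h = [] \<longleftrightarrow> h = []"
  by (metis length_0_conv length_htil)

lemma htil_alists:
  assumes "\<And>h. h \<noteq> [] \<Longrightarrow> a h \<in> A"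
  shows "htil a h \<in> alists A (length h)"
  unfolding htil_def alists_def by (auto intro!: assms)

text \<open>Read as a function of \<open>ht\<close>, this is the family of play probabilities of the
  deterministic plan \<open>a\<close>.\<close>

definition follows :: "('s list \<Rightarrow> 'a) \<Rightarrow> ('s \<times> 'a) list \<Rightarrow> real" where
  "follows a ht = of_bool (htil a (map fst ht) = ht)"

lemma follows_Nil [simp]: "follows a [] = 1"
  by (simp add: follows_def)

lemma follows_Cons: "follows a ((s, b) # k) = of_bool (a [s] = b) * follows (shift_plan a s) k"
  by (simp add: follows_def htil_Cons)

lemma follows_snoc: "follows a (k @ [(s, b)]) = of_bool (a (map fst k @ [s]) = b) * follows a k"
  by (auto simp: follows_def htil_snoc)

lemma follows_nonneg: "0 \<le> follows a ht"
  by (simp add: follows_def)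

lemma follows_le_1: "follows a ht \<le> 1"
  by (simp add: follows_def)

lemma follows_plan_eq:
  "htil a (map fst ht) = ht \<longleftrightarrow>
     map (\<lambda>k. a (take (Suc k) (map fst ht))) [0..<length ht] = map snd ht"
proof
  assume "htil a (map fst ht) = ht"
  then have "map snd (htil a (map fst ht)) = map snd ht"
    by simp
  then show "map (\<lambda>k. a (take (Suc k) (map fst ht))) [0..<length ht] = map snd ht"
    by (simp add: htil_def o_def)
next
  assume *: "map (\<lambda>k. a (take (Suc k) (map fst ht))) [0..<length ht] = map snd ht"
  have "snd (ht ! k) = a (take (Suc k) (map fst ht))" if "k < length ht" for k
    using arg_cong[OF *, of "\<lambda>l. l ! k"] that by simp
  then show "htil a (map fst ht) = ht"
    by (auto intro!: nth_equalityI simp: htil_def prod_eq_iff)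
qed

text \<open>Along given shocks a plan follows exactly one post-action history, so a sum over
  post-action histories reduces to one over shocks.\<close>

lemma sum_follows:
  fixes \<psi> :: "('s::finite \<times> 'a) list \<Rightarrow> real"
  assumes "finite A" "\<And>h. h \<noteq> [] \<Longrightarrow> a h \<in> A"
  shows "(\<Sum>k\<in>alists A n. follows a k * \<psi> k) = (\<Sum>e | length e = n. \<psi> (htil a e))"
  using assms(2)
proof (induction n arbitrary: a \<psi>)
  case (Suc n)
  have "(\<Sum>b\<in>A. \<Sum>k\<in>alists A n. follows a ((s, b) # k) * \<psi> ((s, b) # k))
      = (\<Sum>e | length e = n. \<psi> (htil a (s # e)))" for s
  proof -
    have "(\<Sum>b\<in>A. \<Sum>k\<in>alists A n. follows a ((s, b) # k) * \<psi> ((s, b) # k))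
        = (\<Sum>b\<in>A. if a [s] = b then (\<Sum>k\<in>alists A n. follows (shift_plan a s) k * \<psi> ((s, b) # k)) else 0)"
      by (intro sum.cong refl) (simp add: follows_Cons)
    also have "\<dots> = (\<Sum>k\<in>alists A n. follows (shift_plan a s) k * \<psi> ((s, a [s]) # k))"
      using assms(1) Suc.prems by (simp add: sum.delta')
    also have "\<dots> = (\<Sum>e | length e = n. \<psi> ((s, a [s]) # htil (shift_plan a s) e))"
      by (rule Suc.IH) (simp add: shift_plan_def Suc.prems)
    finally show ?thesis
      by (simp add: htil_Cons)
  qed
  then show ?case
    by (simp add: sum_alists_Suc[OF assms(1)] sum_lists_Suc)
qed simp

text \<open>If the plan deviates from \<open>ht\<close> it follows no extension of
  \<open>ht\<close>, and both sides vanish; otherwise the actions after \<open>ht\<close> collapse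
  as in \<open>sum_follows\<close>.\<close>

lemma sum_follows_append:
  fixes \<psi> :: "('s::finite \<times> 'a) list \<Rightarrow> real"
  assumes "finite A" "\<And>h. h \<noteq> [] \<Longrightarrow> a h \<in> A"
  shows "(\<Sum>k\<in>alists A n. follows a (ht @ k) * \<psi> (ht @ k))
       = follows a ht * (\<Sum>e | length e = n. \<psi> (htil a (map fst ht @ e)))"
  using assms(2)
proof (induction ht arbitrary: a \<psi>)
  case Nil
  then show ?case
    using sum_follows[OF assms(1), of a \<psi> n] by simp
next
  case (Cons sb ht)
  obtain s b where sb: "sb = (s, b)"
    by (cases sb)
  have IH: "(\<Sum>k\<in>alists A n. follows (shift_plan a s) (ht @ k) * \<psi> ((s, b) # ht @ k))
      = follows (shift_plan a s) ht *
        (\<Sum>e | length e = n. \<psi> ((s, b) # htil (shift_plan a s) (map fst ht @ e)))"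
    using Cons.IH[of "shift_plan a s" "\<lambda>l. \<psi> ((s, b) # l)"] Cons.prems by (simp add: shift_plan_def)
  show ?case
    using IH by (cases "a [s] = b") (simp_all add: sb follows_Cons htil_Cons)
qed

text \<open>The flow payoff at the last entry. The recorded actions determine the state, so no plan
  enters; the value at \<open>[]\<close> is a placeholder.\<close>

fun gval :: "('x \<Rightarrow> 'a \<Rightarrow> 's \<Rightarrow> 'x) \<Rightarrow> ('x \<Rightarrow> 'a \<Rightarrow> 's \<Rightarrow> real) \<Rightarrow> 'x \<Rightarrow> ('s \<times> 'a) list \<Rightarrow> real" where
  "gval \<zeta> f x [] = 0"
| "gval \<zeta> f x ((s, b) # k) = (if k = [] then f x b s else gval \<zeta> f (\<zeta> x b s) k)"

lemma flow_eq_gval: "h \<noteq> [] \<Longrightarrow> flow f \<zeta> x a h = gval \<zeta> f x (htil a h)"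
proof (induction h arbitrary: a x)
  case (Cons s h)
  then show ?case
    by (cases "h = []") (auto simp: htil_Cons flow_Cons)
qed simp

definition xafter :: "('x \<Rightarrow> 'a \<Rightarrow> 's \<Rightarrow> 'x) \<Rightarrow> 'x \<Rightarrow> ('s \<times> 'a) list \<Rightarrow> 'x" where
  "xafter \<zeta> = foldl (\<lambda>x (s, b). \<zeta> x b s)"

lemma xafter_Nil [simp]: "xafter \<zeta> x [] = x"
  by (simp add: xafter_def)

lemma xafter_Cons [simp]: "xafter \<zeta> x ((s, b) # k) = xafter \<zeta> (\<zeta> x b s) k"
  by (simp add: xafter_def)

lemma xafter_snoc [simp]: "xafter \<zeta> x (k @ [(s, b)]) = \<zeta> (xafter \<zeta> x k) b s"
  by (simp add: xafter_def)

lemma xpath_snoc: "xpath \<zeta> x a (h @ [s]) = xafter \<zeta> x (htil a h)"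
  by (induction h arbitrary: a x) (simp_all add: xpath_Cons htil_Cons)

fun admh :: "'a set \<Rightarrow> ('x \<Rightarrow> 'a \<Rightarrow> 's \<Rightarrow> real) \<Rightarrow> ('x \<Rightarrow> 'a \<Rightarrow> 's \<Rightarrow> 'x) \<Rightarrow> 'x \<Rightarrow> ('s \<times> 'a) list \<Rightarrow> bool" where
  "admh A p \<zeta> x [] = True"
| "admh A p \<zeta> x ((s, b) # k) = (b \<in> Atil A p x s \<and> admh A p \<zeta> (\<zeta> x b s) k)"

lemma admh_snoc:
  "admh A p \<zeta> x (k @ [(s, b)]) \<longleftrightarrow> admh A p \<zeta> x k \<and> b \<in> Atil A p (xafter \<zeta> x k) s"
  by (induction k arbitrary: x) auto

text \<open>Only the actions at prefixes of \<open>h\<close> enter, and these share its first shock.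
  The following lemmas carry this up to the Lagrangian, which is what makes splicing
  harmless.\<close>

lemma xit_agree:
  assumes "\<And>h. h \<noteq> [] \<Longrightarrow> hd h = s \<Longrightarrow> a h = a' h" and "h \<noteq> []" "hd h = s"
  shows "xit \<zeta> x a h n = xit \<zeta> x a' h n"
proof (induction n)
  case (Suc n)
  have "a (take (Suc n) h) = a' (take (Suc n) h)"
    using assms by (cases h) auto
  then show ?case
    using Suc by simp
qed simp

lemma xpath_agree:
  assumes "\<And>h. h \<noteq> [] \<Longrightarrow> hd h = s \<Longrightarrow> a h = a' h" and "h \<noteq> []" "hd h = s"
  shows "xpath \<zeta> x a h = xpath \<zeta> x a' h"
  unfolding xpath_def by (rule xit_agree) (use assms in auto)

lemma flow_agree:
  assumes "\<And>h. h \<noteq> [] \<Longrightarrow> hd h = s \<Longrightarrow> a h = a' h" and "h \<noteq> []" "hd h = s"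
  shows "flow f \<zeta> x a h = flow f \<zeta> x a' h"
proof -
  have "xpath \<zeta> x a h = xpath \<zeta> x a' h"
    by (rule xpath_agree) (use assms in auto)
  then show ?thesis
    using assms by (simp add: flow_def)
qed

lemma condE_cong:
  assumes "\<And>e. length e = n \<Longrightarrow> f (h @ e) = f' (h @ e)"
  shows "condE \<pi> h n f = condE \<pi> h n f'"
  unfolding condE_def using assms by (intro sum.cong) auto

lemma cont_agree:
  assumes "\<And>h. h \<noteq> [] \<Longrightarrow> hd h = s \<Longrightarrow> a h = a' h" and "h \<noteq> []" "hd h = s"
  shows "cont \<beta> \<pi> \<zeta> x a f h = cont \<beta> \<pi> \<zeta> x a' f h"
proof -
  have "condE \<pi> h n (flow f \<zeta> x a) = condE \<pi> h n (flow f \<zeta> x a')" for n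
    using assms by (intro condE_cong flow_agree[where s = s]) auto
  then show ?thesis
    unfolding cont_def by simp
qed

lemma htil_agree:
  assumes "\<And>h. h \<noteq> [] \<Longrightarrow> hd h = s \<Longrightarrow> a h = a' h" and "h \<noteq> []" "hd h = s"
  shows "htil a h = htil a' h"
proof -
  have "a (take (Suc k) h) = a' (take (Suc k) h)" for k
    using assms by (cases h) auto
  then show ?thesis
    unfolding htil_def by simp
qed

lemma Ltil_agree:
  assumes "\<And>h. h \<noteq> [] \<Longrightarrow> hd h = s \<Longrightarrow> a h = a' h"
  shows "Ltil \<beta> \<pi> \<zeta> r g gbar a lam \<gamma> x s = Ltil \<beta> \<pi> \<zeta> r g gbar a' lam \<gamma> x s"
proof -
  have *: "flow f \<zeta> x a ([s] @ e) = flow f \<zeta> x a' ([s] @ e)"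
    "cont \<beta> \<pi> \<zeta> x a f ([s] @ e) = cont \<beta> \<pi> \<zeta> x a' f ([s] @ e)"
    "htil a ([s] @ e) = htil a' ([s] @ e)" for e f
    using assms
    by (intro flow_agree[where s = s] cont_agree[where s = s] htil_agree[where s = s]; simp)+
  show ?thesis
    unfolding Ltil_def
    by (intro suminf_cong arg_cong2[where f = "(*)"] refl condE_cong) (simp only: *)
qed

section \<open>Admissible plans: shifting, prefixing and splicing\<close>

lemma plan_in_A: "a \<in> Ainf A p \<zeta> x \<Longrightarrow> h \<noteq> [] \<Longrightarrow> a h \<in> A"
  by (auto simp: Ainf_def Hist_def PiE_def Pi_def)

lemma Ainf_iff:
  "a \<in> Ainf A p \<zeta> x \<longleftrightarrow> a [] = undefined \<and> (\<forall>h. h \<noteq> [] \<longrightarrow> a h \<in> Atil A p (xpath \<zeta> x a h) (last h))"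
  by (auto simp: Ainf_def Hist_def PiE_def Pi_def extensional_def Atil_def)

lemma plan_head: "a \<in> Ainf A p \<zeta> x \<Longrightarrow> a [s] \<in> Atil A p x s"
  unfolding Ainf_iff by (metis last.simps list.distinct(1) xpath_single)

lemma shift_plan_Ainf:
  fixes a :: "'s list \<Rightarrow> 'a"
  assumes "a \<in> Ainf A p \<zeta> x"
  shows "shift_plan a s \<in> Ainf A p \<zeta> (\<zeta> x (a [s]) s)"
  unfolding Ainf_iff
proof (intro conjI allI impI)
  fix h :: "'s list" assume h: "h \<noteq> []"
  have "a (s # h) \<in> Atil A p (xpath \<zeta> x a (s # h)) (last (s # h))"
    using assms unfolding Ainf_iff by blast
  then show "shift_plan a s h \<in> Atil A p (xpath \<zeta> (\<zeta> x (a [s]) s) (shift_plan a s) h) (last h)"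
    using h by (simp add: xpath_Cons shift_plan_def)
qed (simp add: shift_plan_def)

lemma cons_plan_single [simp]: "cons_plan b c [s] = b s"
  by (simp add: cons_plan_def)

lemma shift_cons_plan:
  "c s [] = undefined \<Longrightarrow> shift_plan (cons_plan b c) s = c s"
  by (auto simp: shift_plan_def cons_plan_def)

lemma cons_plan_Ainf:
  fixes c :: "'s \<Rightarrow> 's list \<Rightarrow> 'a"
  assumes "\<And>s. b s \<in> Atil A p x s" "\<And>s. c s \<in> Ainf A p \<zeta> (\<zeta> x (b s) s)"
  shows "cons_plan b c \<in> Ainf A p \<zeta> x"
  unfolding Ainf_iff
proof (intro conjI allI impI)
  have c: "c s [] = undefined" for s
    using assms(2) unfolding Ainf_iff by auto
  fix h :: "'s list" assume "h \<noteq> []"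
  then obtain s k where h: "h = s # k"
    by (cases h) auto
  show "cons_plan b c h \<in> Atil A p (xpath \<zeta> x (cons_plan b c) h) (last h)"
  proof (cases "k = []")
    case True
    then show ?thesis
      using assms(1) by (simp add: h)
  next
    case False
    have "c s k \<in> Atil A p (xpath \<zeta> (\<zeta> x (b s) s) (c s) k) (last k)"
      using assms(2) False unfolding Ainf_iff by blast
    then show ?thesis
      using False shift_cons_plan[of c s b, OF c] by (simp add: h xpath_Cons) (simp add: cons_plan_def)
  qed
qed (simp add: cons_plan_def)

lemma splice_plan_Ainf:
  fixes c :: "'s \<Rightarrow> 's list \<Rightarrow> 'a"
  assumes "\<And>s. c s \<in> Ainf A p \<zeta> x"
  shows "splice_plan c \<in> Ainf A p \<zeta> x"
  unfolding Ainf_iff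
proof (intro conjI allI impI)
  fix h :: "'s list" assume h: "h \<noteq> []"
  have "xpath \<zeta> x (splice_plan c) h = xpath \<zeta> x (c (hd h)) h"
    by (rule xpath_agree[where s = "hd h"]) (auto simp: splice_plan_def h)
  moreover have "c (hd h) h \<in> Atil A p (xpath \<zeta> x (c (hd h)) h) (last h)"
    using assms h unfolding Ainf_iff by blast
  ultimately show "splice_plan c h \<in> Atil A p (xpath \<zeta> x (splice_plan c) h) (last h)"
    by (simp add: h splice_plan_def)
qed (simp add: splice_plan_def)

section \<open>Conditional expectations along shock histories\<close>

lemma condE_Cons:
  assumes "\<And>s s'. \<pi> s s' > 0" "h \<noteq> []"
  shows "condE \<pi> (s # h) n f = condE \<pi> h n (\<lambda>e. f (s # e))"
  unfolding condE_def
proof (intro sum.cong refl)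
  fix e
  have "\<pi> s (hd h) \<noteq> 0"
    using assms(1)[of s "hd h"] by simp
  then show "pathprob \<pi> ((s # h) @ e) / pathprob \<pi> (s # h) * f ((s # h) @ e)
      = pathprob \<pi> (h @ e) / pathprob \<pi> h * f (s # h @ e)"
    using assms(2) by (simp add: pathprob_Cons)
qed

lemma condE_0 [simp]:
  assumes "\<And>s s'. \<pi> s s' > 0"
  shows "condE \<pi> h 0 f = f h"
  using pathprob_pos[of \<pi> h, OF assms] by (simp add: condE_def)

lemma condE_Suc: "condE \<pi> [s] (Suc n) f = (\<Sum>s'\<in>UNIV. \<pi> s s' * condE \<pi> [s'] n (\<lambda>e. f (s # e)))"
  by (simp add: condE_def sum_lists_Suc pathprob_Cons sum_distrib_left mult.assoc)

lemma condE_add: "condE \<pi> h n (\<lambda>e. f e + f' e) = condE \<pi> h n f + condE \<pi> h n f'"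
  by (simp add: condE_def distrib_left sum.distrib)

lemma condE_cmult: "condE \<pi> h n (\<lambda>e. c * f e) = c * condE \<pi> h n f"
  by (simp add: condE_def algebra_simps sum_distrib_left)

lemma condE_sum: "condE \<pi> h n (\<lambda>e. \<Sum>i\<in>I. f i e) = (\<Sum>i\<in>I. condE \<pi> h n (f i))"
  unfolding condE_def sum_distrib_left by (rule sum.swap)

lemma condE_mono:
  assumes "\<And>s s'. \<pi> s s' > 0" "\<And>e. length e = n \<Longrightarrow> f (h @ e) \<le> f' (h @ e)"
  shows "condE \<pi> h n f \<le> condE \<pi> h n f'"
  unfolding condE_def using assms(2) pathprob_pos[of \<pi>, OF assms(1)]
  by (intro sum_mono mult_left_mono) (auto simp: less_imp_le)

lemma condE_const:
  assumes pos: "\<And>s s'. \<pi> s s' > 0" and "\<And>s. (\<Sum>s'\<in>UNIV. \<pi> s s') = 1" and "h \<noteq> []"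
  shows "condE \<pi> h n (\<lambda>_. c) = c"
  using assms(3)
proof (induction h rule: list_nonempty_induct)
  case (single s)
  show ?case
  proof (induction n arbitrary: s)
    case (Suc n)
    then show ?case
      using assms(2)[of s] by (simp add: condE_Suc flip: sum_distrib_right)
  qed (simp add: pos)
next
  case (cons s h)
  then show ?case
    by (simp add: condE_Cons[OF pos])
qed

lemma condE_abs_le:
  assumes pos: "\<And>s s'. \<pi> s s' > 0" and "\<And>s. (\<Sum>s'\<in>UNIV. \<pi> s s') = 1" and "h \<noteq> []"
    and "\<And>e. length e = n \<Longrightarrow> \<bar>f (h @ e)\<bar> \<le> B"
  shows "\<bar>condE \<pi> h n f\<bar> \<le> B"
proof -
  have "condE \<pi> h n f \<le> condE \<pi> h n (\<lambda>_. B)" "condE \<pi> h n (\<lambda>_. - B) \<le> condE \<pi> h n f"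
    using assms(4) by (intro condE_mono[OF pos]; force simp: abs_le_iff)+
  then show ?thesis
    by (simp add: condE_const[OF assms(1-3)] abs_le_iff)
qed

lemma pathprob_snoc: "h \<noteq> [] \<Longrightarrow> pathprob \<pi> (h @ [s]) = pathprob \<pi> h * \<pi> (last h) s"
  by (induction h rule: list_nonempty_induct) (simp_all add: pathprob_Cons)

lemma single_alists: "b \<in> A \<Longrightarrow> [(s, b)] \<in> alists A 1"
  by (simp add: alists_def)

lemma snoc_alists: "k \<in> alists A n \<Longrightarrow> b \<in> A \<Longrightarrow> k @ [(s, b)] \<in> alists A (Suc n)"
  by (simp add: alists_def)

lemma sum_follows_Cons:
  fixes \<psi> :: "('s::finite \<times> 'a) list \<Rightarrow> real"
  assumes "finite A" "\<And>h. h \<noteq> [] \<Longrightarrow> a h \<in> A"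
  shows "(\<Sum>b\<in>A. \<Sum>k\<in>alists A n. follows a ((s, b) # k) * \<psi> ((s, b) # k))
      = (\<Sum>e | length e = n. \<psi> (htil a (s # e)))"
proof -
  have "(\<Sum>k\<in>alists A n. follows a ((s, b) # k) * \<psi> ((s, b) # k))
      = (if a [s] = b then \<Sum>e | length e = n. \<psi> (htil a (s # e)) else 0)" for b
    using sum_follows_append[where A = A and a = a and n = n and ht = "[(s, b)]" and \<psi> = \<psi>] assms by (simp add: follows_Cons)
  then show ?thesis
    using assms by (simp add: sum.delta')
qed

section \<open>Recursion for the Lagrangian\<close>

definition bounded_by :: "'x set \<Rightarrow> 'a set \<Rightarrow> ('x \<Rightarrow> 'a \<Rightarrow> 's \<Rightarrow> real) \<Rightarrow> real \<Rightarrow> bool" where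
  "bounded_by X A f B \<longleftrightarrow> (\<forall>x\<in>X. \<forall>a\<in>A. \<forall>s. \<bar>f x a s\<bar> \<le> B)"

text \<open>On the reals \<open>SUP\<close> is a bound only for sets that are bounded above, so some
  bound must be known before the sup norm can serve as one.\<close>

lemma bounded_by_supnorm:
  assumes "bounded_by X A f B"
  shows "bounded_by X A f (supnorm X A f)"
  unfolding bounded_by_def
proof (intro ballI allI)
  fix x a s assume "x \<in> X" "a \<in> A"
  have "bdd_above ((\<lambda>(x, a, s). \<bar>f x a s\<bar>) ` (X \<times> A \<times> UNIV))"
    using assms by (intro bdd_aboveI[of _ B]) (auto simp: bounded_by_def)
  then show "\<bar>f x a s\<bar> \<le> supnorm X A f"
    unfolding supnorm_def using \<open>x \<in> X\<close> \<open>a \<in> A\<close>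
    by (intro cSUP_upper2[where x = "(x, a, s)"]) auto
qed

text \<open>The undiscounted share of the sum in \<open>Lam\<close> at date \<open>t\<close> due to
  initial shock \<open>s\<close>. It adds over all actions, so for nonnegative multipliers it
  dominates the expected multiplier met by any single plan.\<close>

definition lam_mass :: "('s::finite \<Rightarrow> 's \<Rightarrow> real) \<Rightarrow> 'a set \<Rightarrow> (('s \<times> 'a) list \<Rightarrow> real ^ 'i::finite) \<Rightarrow> nat \<Rightarrow> 's \<Rightarrow> real" where
  "lam_mass \<pi> A lam t s =
     (\<Sum>b\<in>A. \<Sum>k\<in>alists A t. \<Sum>i\<in>UNIV. lam ((s, b) # k) $ i * pathprob \<pi> (s # map fst k))"

definition nonneg_mult :: "'a set \<Rightarrow> (('s \<times> 'a) list \<Rightarrow> real ^ 'i::finite) \<Rightarrow> bool" where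
  "nonneg_mult A lam \<longleftrightarrow> (\<forall>k i. k \<noteq> [] \<longrightarrow> snd ` set k \<subseteq> A \<longrightarrow> 0 \<le> lam k $ i)"

lemma nonneg_mult_Cons: "nonneg_mult A lam \<Longrightarrow> b \<in> A \<Longrightarrow> nonneg_mult A (\<lambda>k. lam ((s, b) # k))"
  by (simp add: nonneg_mult_def)

text \<open>The multiplier part of the date-\<open>t\<close> term of \<open>Ltil\<close>, split off
  because payoffs are summable by discounting alone, whereas this part is summable only through the
  mass of \<open>lam\<close>.\<close>

definition penalty :: "real \<Rightarrow> ('s::finite \<Rightarrow> 's \<Rightarrow> real) \<Rightarrow> ('x \<Rightarrow> 'a \<Rightarrow> 's \<Rightarrow> 'x)
     \<Rightarrow> ('i::finite \<Rightarrow> 'x \<Rightarrow> 'a \<Rightarrow> 's \<Rightarrow> real) \<Rightarrow> ('i \<Rightarrow> real)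
     \<Rightarrow> ('s list \<Rightarrow> 'a) \<Rightarrow> (('s \<times> 'a) list \<Rightarrow> real ^ 'i) \<Rightarrow> 'x \<Rightarrow> 's \<Rightarrow> nat \<Rightarrow> real" where
  "penalty \<beta> \<pi> \<zeta> g gbar a lam x s t =
     condE \<pi> [s] t (\<lambda>h. \<Sum>i\<in>UNIV. lam (htil a h) $ i * (cont \<beta> \<pi> \<zeta> x a (g i) h - gbar i))"

lemma suminf_Suc_head:
  fixes f :: "nat \<Rightarrow> real"
  shows "summable f \<Longrightarrow> suminf f = f 0 + (\<Sum>n. f (Suc n))"
  using suminf_split_head[of f] by simp

locale lottery_model =
  fixes \<pi> :: "'s::finite \<Rightarrow> 's \<Rightarrow> real"
    and A :: "'a set"
    and X :: "'x set"
    and \<zeta> :: "'x \<Rightarrow> 'a \<Rightarrow> 's \<Rightarrow> 'x"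
    and p r :: "'x \<Rightarrow> 'a \<Rightarrow> 's \<Rightarrow> real"
    and g :: "'i::finite \<Rightarrow> 'x \<Rightarrow> 'a \<Rightarrow> 's \<Rightarrow> real"
    and gbar :: "'i \<Rightarrow> real"
    and \<beta> :: real
  assumes pi_pos: "\<And>s s'. \<pi> s s' > 0"
    and pi_sum: "\<And>s. (\<Sum>s'\<in>UNIV. \<pi> s s') = 1"
    and A_fin: "finite A"
    and zeta_X: "\<And>x a s. x \<in> X \<Longrightarrow> a \<in> A \<Longrightarrow> \<zeta> x a s \<in> X"
    and r_bdd: "\<exists>B. \<forall>x\<in>X. \<forall>a\<in>A. \<forall>s. \<bar>r x a s\<bar> \<le> B"
    and g_bdd: "\<And>i. \<exists>B. \<forall>x\<in>X. \<forall>a\<in>A. \<forall>s. \<bar>g i x a s\<bar> \<le> B"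
    and beta: "0 < \<beta>" "\<beta> < 1"
    and feas_ex: "\<And>x0 s0. x0 \<in> X \<Longrightarrow> \<exists>a. feasible A p \<zeta> \<pi> \<beta> g gbar x0 s0 a"
begin

abbreviation "plans x \<equiv> Ainf A p \<zeta> x"
abbreviation "cnt x a f h \<equiv> cont \<beta> \<pi> \<zeta> x a f h"
abbreviation "pen a lam x s t \<equiv> penalty \<beta> \<pi> \<zeta> g gbar a lam x s t"
abbreviation "Lag a lam \<gamma> x s \<equiv> Ltil \<beta> \<pi> \<zeta> r g gbar a lam \<gamma> x s"
abbreviation "mass lam t s \<equiv> lam_mass \<pi> A lam t s"
abbreviation "Mult \<equiv> Lam \<beta> \<pi> A :: (('s \<times> 'a) list \<Rightarrow> real ^ 'i) set"
abbreviation "Lc \<equiv> Lconst X A \<beta> r g"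
abbreviation "D \<gamma> x s \<equiv> Dtil A p \<beta> \<pi> \<zeta> r g gbar \<gamma> x s"

lemmas path_pos = pathprob_pos[of \<pi>, OF pi_pos]
lemmas cE_0 = condE_0[of \<pi>, OF pi_pos]
lemmas cE_Cons = condE_Cons[of \<pi>, OF pi_pos]
lemmas cE_mono = condE_mono[of \<pi>, OF pi_pos]
lemmas cE_abs_le = condE_abs_le[of \<pi>, OF pi_pos pi_sum]
lemmas cE_const = condE_const[of \<pi>, OF pi_pos pi_sum]

section \<open>Bounds and recursion for continuation values\<close>

lemma gval_bound:
  assumes "bounded_by X A f B" "x \<in> X" "k \<in> alists A n" "k \<noteq> []"
  shows "\<bar>gval \<zeta> f x k\<bar> \<le> B"
  using assms(2-)
proof (induction k arbitrary: x n)
  case (Cons sb k)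
  obtain s b where sb: "sb = (s, b)"
    by (cases sb)
  have b: "b \<in> A" "k \<in> alists A (length k)"
    using Cons.prems by (auto simp: alists_def sb)
  show ?case
    using Cons.IH[OF zeta_X[OF Cons.prems(1) b(1)] b(2)] b Cons.prems(1) assms(1)
    by (auto simp: sb bounded_by_def)
qed simp

lemma flow_bound:
  assumes "bounded_by X A f B" "x \<in> X" "a \<in> plans x" "h \<noteq> []"
  shows "\<bar>flow f \<zeta> x a h\<bar> \<le> B"
  using gval_bound[OF assms(1,2) htil_alists[of a A h]] plan_in_A[OF assms(3)] assms(4)
  by (simp add: flow_eq_gval)

lemma condE_flow_bound:
  assumes "bounded_by X A f B" "x \<in> X" "a \<in> plans x" "h \<noteq> []"
  shows "\<bar>condE \<pi> h n (flow f \<zeta> x a)\<bar> \<le> B"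
  using assms by (intro cE_abs_le flow_bound) auto

lemma geometric_bound:
  fixes c :: "nat \<Rightarrow> real"
  assumes "\<And>n. \<bar>c n\<bar> \<le> B"
  shows "summable (\<lambda>n. \<beta> ^ n * c n)" "\<bar>\<Sum>n. \<beta> ^ n * c n\<bar> \<le> B / (1 - \<beta>)"
proof -
  have geo: "(\<lambda>n. \<beta> ^ n * B) sums (B / (1 - \<beta>))"
    using sums_mult2[OF geometric_sums[of \<beta>], of B] beta by simp
  have le: "norm (\<beta> ^ n * c n) \<le> \<beta> ^ n * B" for n
    using assms beta by (simp add: abs_mult mult_left_mono)
  have s: "summable (\<lambda>n. norm (\<beta> ^ n * c n))"
    by (rule summable_comparison_test'[OF sums_summable[OF geo], of 0]) (use le in auto)
  then show "summable (\<lambda>n. \<beta> ^ n * c n)"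
    by (rule summable_norm_cancel)
  have "\<bar>\<Sum>n. \<beta> ^ n * c n\<bar> \<le> (\<Sum>n. norm (\<beta> ^ n * c n))"
    using summable_norm[OF s] by simp
  also have "\<dots> \<le> (\<Sum>n. \<beta> ^ n * B)"
    by (intro suminf_le le s sums_summable[OF geo])
  finally show "\<bar>\<Sum>n. \<beta> ^ n * c n\<bar> \<le> B / (1 - \<beta>)"
    using sums_unique[OF geo] by simp
qed

lemma cont_summable:
  assumes "bounded_by X A f B" "x \<in> X" "a \<in> plans x" "h \<noteq> []"
  shows "summable (\<lambda>n. \<beta> ^ n * condE \<pi> h n (flow f \<zeta> x a))"
  by (rule geometric_bound(1)[OF condE_flow_bound[OF assms]])

lemma cont_bound:
  assumes "bounded_by X A f B" "x \<in> X" "a \<in> plans x" "h \<noteq> []"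
  shows "\<bar>cnt x a f h\<bar> \<le> B / (1 - \<beta>)"
  unfolding cont_def by (rule geometric_bound(2)[OF condE_flow_bound[OF assms]])

lemma cont_Cons:
  assumes "h \<noteq> []"
  shows "cnt x a f (s # h) = cnt (\<zeta> x (a [s]) s) (shift_plan a s) f h"
proof -
  have "condE \<pi> (s # h) n (flow f \<zeta> x a) = condE \<pi> h n (flow f \<zeta> (\<zeta> x (a [s]) s) (shift_plan a s))" for n
    unfolding cE_Cons[OF assms] using assms by (intro condE_cong flow_Cons) simp
  then show ?thesis
    unfolding cont_def by simp
qed

lemma plan_step:
  assumes "x \<in> X" "a \<in> plans x"
  shows "a [s] \<in> A" "\<zeta> x (a [s]) s \<in> X" "shift_plan a s \<in> plans (\<zeta> x (a [s]) s)"
  using assms plan_in_A[OF assms(2), of "[s]"] by (auto intro: zeta_X shift_plan_Ainf)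

lemma cont_single:
  assumes "bounded_by X A f B" "x \<in> X" "a \<in> plans x"
  shows "cnt x a f [s] = f x (a [s]) s
    + \<beta> * (\<Sum>s'\<in>UNIV. \<pi> s s' * cnt (\<zeta> x (a [s]) s) (shift_plan a s) f [s'])"
proof -
  let ?x = "\<zeta> x (a [s]) s" and ?a = "shift_plan a s"
  have st: "condE \<pi> [s] (Suc n) (flow f \<zeta> x a) = (\<Sum>s'\<in>UNIV. \<pi> s s' * condE \<pi> [s'] n (flow f \<zeta> ?x ?a))" for n
    unfolding condE_Suc by (intro sum.cong refl arg_cong2[where f = "(*)"] condE_cong flow_Cons) simp
  have sm: "summable (\<lambda>n. \<beta> ^ n * condE \<pi> [s'] n (flow f \<zeta> ?x ?a))" for s'
    using assms plan_step by (intro cont_summable) auto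
  have "cnt x a f [s] = f x (a [s]) s + (\<Sum>n. \<beta> ^ Suc n * condE \<pi> [s] (Suc n) (flow f \<zeta> x a))"
    unfolding cont_def
    by (subst suminf_Suc_head) (use assms in \<open>auto intro!: cont_summable simp: cE_0 simp del: power_Suc\<close>)
  also have "(\<Sum>n. \<beta> ^ Suc n * condE \<pi> [s] (Suc n) (flow f \<zeta> x a))
      = (\<Sum>n. \<Sum>s'\<in>UNIV. \<beta> * \<pi> s s' * (\<beta> ^ n * condE \<pi> [s'] n (flow f \<zeta> ?x ?a)))"
    unfolding st sum_distrib_left by (simp add: ac_simps)
  also have "\<dots> = (\<Sum>s'\<in>UNIV. \<Sum>n. \<beta> * \<pi> s s' * (\<beta> ^ n * condE \<pi> [s'] n (flow f \<zeta> ?x ?a)))"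
    by (rule suminf_sum) (intro summable_mult sm)
  also have "\<dots> = (\<Sum>s'\<in>UNIV. \<beta> * \<pi> s s' * cnt ?x ?a f [s'])"
    unfolding cont_def by (intro sum.cong refl suminf_mult sm)
  finally show ?thesis
    by (simp add: sum_distrib_left mult.assoc)
qed

lemma bounded_r: "bounded_by X A r (supnorm X A r)"
  using r_bdd bounded_by_supnorm[of X A r] unfolding bounded_by_def by blast

lemma bounded_g: "bounded_by X A (g i) (supnorm X A (g i))"
  using g_bdd[of i] bounded_by_supnorm[of X A "g i"] unfolding bounded_by_def by blast

lemma plan_ex: "x \<in> X \<Longrightarrow> \<exists>a. a \<in> plans x"
  using feas_ex[of x] unfolding feasible_def by blast

lemma adm_ex: "x \<in> X \<Longrightarrow> \<exists>b. b \<in> Atil A p x s"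
  using plan_ex[of x] plan_head[of _ A p \<zeta> x s] by blast

lemma supnorm_nonneg:
  assumes "x \<in> X"
  shows "0 \<le> supnorm X A r" "0 \<le> supnorm X A (g i)"
proof -
  obtain b where "b \<in> A"
    using adm_ex[OF assms] by (auto simp: Atil_def)
  then have "\<bar>r x b s\<bar> \<le> supnorm X A r" "\<bar>g i x b s\<bar> \<le> supnorm X A (g i)" for s
    using bounded_r bounded_g assms by (auto simp: bounded_by_def)
  then show "0 \<le> supnorm X A r" "0 \<le> supnorm X A (g i)"
    by (meson abs_ge_zero order_trans)+
qed

lemma supnorm_le_Lc:
  assumes "x \<in> X"
  shows "supnorm X A r / (1 - \<beta>) \<le> Lc" "supnorm X A (g i) / (1 - \<beta>) \<le> Lc" "0 \<le> Lc"
proof -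
  have "supnorm X A (g i) \<le> (\<Sum>i\<in>UNIV. supnorm X A (g i))"
    by (rule member_le_sum) (use supnorm_nonneg[OF assms] in auto)
  moreover have "0 \<le> (\<Sum>i\<in>UNIV. supnorm X A (g i))"
    by (intro sum_nonneg supnorm_nonneg[OF assms])
  ultimately show "supnorm X A r / (1 - \<beta>) \<le> Lc" "supnorm X A (g i) / (1 - \<beta>) \<le> Lc" "0 \<le> Lc"
    unfolding Lconst_def using supnorm_nonneg[OF assms] beta
    by (auto intro!: divide_right_mono)
qed

lemma cont_r_le:
  assumes "x \<in> X" "a \<in> plans x" "h \<noteq> []"
  shows "\<bar>cnt x a r h\<bar> \<le> Lc"
  using cont_bound[OF bounded_r assms] supnorm_le_Lc(1)[OF assms(1)] by simp

lemma cont_g_le: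
  assumes "x \<in> X" "a \<in> plans x" "h \<noteq> []"
  shows "\<bar>cnt x a (g i) h\<bar> \<le> Lc"
  using cont_bound[OF bounded_g[of i] assms] supnorm_le_Lc(2)[OF assms(1), of i] by linarith

lemma condE_flow_weighted:
  "condE \<pi> h n (flow (\<lambda>x b s. r x b s + (\<Sum>i\<in>UNIV. \<gamma> $ i * g i x b s)) \<zeta> x a)
     = condE \<pi> h n (flow r \<zeta> x a) + (\<Sum>i\<in>UNIV. \<gamma> $ i * condE \<pi> h n (flow (g i) \<zeta> x a))"
  unfolding flow_def condE_add condE_sum condE_cmult by simp

lemma cont_weighted:
  assumes "x \<in> X" "a \<in> plans x" "h \<noteq> []"
  shows "cnt x a (\<lambda>x b s. r x b s + (\<Sum>i\<in>UNIV. \<gamma> $ i * g i x b s)) h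
       = cnt x a r h + (\<Sum>i\<in>UNIV. \<gamma> $ i * cnt x a (g i) h)"
proof -
  have r: "(\<lambda>n. \<beta> ^ n * condE \<pi> h n (flow r \<zeta> x a)) sums cnt x a r h"
    unfolding cont_def by (rule summable_sums[OF cont_summable[OF bounded_r assms]])
  have g: "(\<lambda>n. \<beta> ^ n * condE \<pi> h n (flow (g i) \<zeta> x a)) sums cnt x a (g i) h" for i
    unfolding cont_def by (rule summable_sums[OF cont_summable[OF bounded_g assms]])
  have "(\<lambda>n. \<beta> ^ n * condE \<pi> h n (flow r \<zeta> x a)
        + (\<Sum>i\<in>UNIV. \<gamma> $ i * (\<beta> ^ n * condE \<pi> h n (flow (g i) \<zeta> x a))))
      sums (cnt x a r h + (\<Sum>i\<in>UNIV. \<gamma> $ i * cnt x a (g i) h))"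
    by (intro sums_add sums_sum sums_mult r g)
  then show ?thesis
    unfolding cont_def[of _ _ _ _ _ "\<lambda>x b s. r x b s + (\<Sum>i\<in>UNIV. \<gamma> $ i * g i x b s)"] condE_flow_weighted
    by (simp add: sums_iff distrib_left sum_distrib_left mult.left_commute)
qed

text \<open>Bounds every slack \<open>cnt x a (g i) h - gbar i\<close>: \<open>Lc\<close> covers the
  continuation value, and the sum over \<open>i\<close> stands in for a maximum of the
  \<open>\<bar>gbar i\<bar>\<close>.\<close>

definition "Cpen = Lc + (\<Sum>i\<in>UNIV. \<bar>gbar i\<bar>)"

lemma cont_gbar_le:
  assumes "x \<in> X" "a \<in> plans x" "h \<noteq> []"
  shows "\<bar>cnt x a (g i) h - gbar i\<bar> \<le> Cpen"
proof -
  have "\<bar>gbar i\<bar> \<le> (\<Sum>i\<in>UNIV. \<bar>gbar i\<bar>)"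
    by (rule member_le_sum) auto
  then show ?thesis
    unfolding Cpen_def using cont_g_le[OF assms, of i] by linarith
qed

lemma Cpen_nonneg: "x \<in> X \<Longrightarrow> 0 \<le> Cpen"
  unfolding Cpen_def using supnorm_le_Lc(3) by (intro add_nonneg_nonneg sum_nonneg) auto

section \<open>Multiplier mass\<close>

lemma mass_nonneg:
  assumes "nonneg_mult A lam"
  shows "0 \<le> mass lam t s"
  unfolding lam_mass_def using assms path_pos
  by (intro sum_nonneg mult_nonneg_nonneg) (auto simp: nonneg_mult_def alists_def less_imp_le)

lemma mass_0: "mass lam 0 s = (\<Sum>b\<in>A. \<Sum>i\<in>UNIV. lam [(s, b)] $ i)"
  by (simp add: lam_mass_def)

lemma mass_Suc:
  "mass lam (Suc t) s = (\<Sum>b\<in>A. \<Sum>s'\<in>UNIV. \<pi> s s' * mass (\<lambda>k. lam ((s, b) # k)) t s')"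
proof -
  have "(\<Sum>k\<in>alists A (Suc t). \<Sum>i\<in>UNIV. lam ((s, b) # k) $ i * pathprob \<pi> (s # map fst k))
     = (\<Sum>s'\<in>UNIV. \<pi> s s' * mass (\<lambda>k. lam ((s, b) # k)) t s')" for b
    unfolding sum_alists_Suc[OF A_fin] lam_mass_def sum_distrib_left
    by (simp add: pathprob_Cons ac_simps)
  then show ?thesis
    unfolding lam_mass_def[of _ _ _ "Suc t"] by simp
qed

lemma sum_Htil_mass:
  "(\<Sum>ht\<in>Htil A t. \<Sum>i\<in>UNIV. lam ht $ i * pathprob \<pi> (map fst ht)) = (\<Sum>s\<in>UNIV. mass lam t s)"
  unfolding Htil_alists sum_alists_Suc[OF A_fin] lam_mass_def by simp

text \<open>\<open>Lam\<close> adds over histories from all initial shocks. With nonnegative terms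
  and finitely many shocks this is summability for each initial shock, the form that the recursion
  needs.\<close>

lemma Mult_iff:
  "lam \<in> Mult \<longleftrightarrow> nonneg_mult A lam \<and> (\<forall>s. summable (\<lambda>t. \<beta> ^ t * mass lam t s))"
proof -
  have nn: "(\<forall>t. \<forall>ht\<in>Htil A t. \<forall>i. 0 \<le> lam ht $ i) \<longleftrightarrow> nonneg_mult A lam"
  proof safe
    assume *: "\<forall>t. \<forall>ht\<in>Htil A t. \<forall>i. 0 \<le> lam ht $ i"
    have "0 \<le> lam k $ i" if "k \<noteq> []" "snd ` set k \<subseteq> A" for k i
      using *[rule_format, of k "length k - 1" i] that by (simp add: Htil_def)
    then show "nonneg_mult A lam"
      by (simp add: nonneg_mult_def)
  next
    fix t i and ht :: "('s \<times> 'a) list" assume "nonneg_mult A lam" "ht \<in> Htil A t"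
    then show "0 \<le> lam ht $ i"
      by (cases ht) (auto simp: nonneg_mult_def Htil_def)
  qed
  have "summable (\<lambda>t. \<beta> ^ t * (\<Sum>s\<in>UNIV. mass lam t s)) \<longleftrightarrow> (\<forall>s. summable (\<lambda>t. \<beta> ^ t * mass lam t s))"
    if "nonneg_mult A lam"
  proof safe
    fix s assume s: "summable (\<lambda>t. \<beta> ^ t * (\<Sum>s\<in>UNIV. mass lam t s))"
    have "mass lam t s \<le> (\<Sum>s\<in>UNIV. mass lam t s)" for t
      by (rule member_le_sum) (use mass_nonneg[OF that] in auto)
    then show "summable (\<lambda>t. \<beta> ^ t * mass lam t s)"
      using beta mass_nonneg[OF that]
      by (intro summable_comparison_test'[OF s, of 0]) (auto simp: abs_mult intro!: mult_left_mono)
  next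
    assume "\<forall>s. summable (\<lambda>t. \<beta> ^ t * mass lam t s)"
    then show "summable (\<lambda>t. \<beta> ^ t * (\<Sum>s\<in>UNIV. mass lam t s))"
      unfolding sum_distrib_left by (intro summable_sum) auto
  qed
  then show ?thesis
    unfolding Lam_def mem_Collect_eq nn sum_Htil_mass by blast
qed

lemma mass_shift_le:
  assumes "nonneg_mult A lam" "b \<in> A"
  shows "(\<Sum>s'\<in>UNIV. \<pi> s s' * mass (\<lambda>k. lam ((s, b) # k)) t s') \<le> mass lam (Suc t) s"
  unfolding mass_Suc
  by (rule member_le_sum[where f = "\<lambda>b. \<Sum>s'\<in>UNIV. \<pi> s s' * mass (\<lambda>k. lam ((s, b) # k)) t s'"])
    (use assms(2) A_fin mass_nonneg[OF nonneg_mult_Cons[OF assms(1)]] pi_pos in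
      \<open>auto intro!: sum_nonneg mult_nonneg_nonneg simp: less_imp_le\<close>)

text \<open>The continuation mass after next shock \<open>s'\<close> is at most next period's mass
  divided by the positive number \<open>\<pi> s s'\<close>, so summability survives the
  shift.\<close>

lemma Mult_shift:
  assumes "lam \<in> Mult" "b \<in> A"
  shows "(\<lambda>k. lam ((s, b) # k)) \<in> Mult"
  unfolding Mult_iff
proof (intro conjI allI)
  have nn: "nonneg_mult A lam" and sm: "summable (\<lambda>t. \<beta> ^ Suc t * mass lam (Suc t) s)"
    using assms(1) unfolding Mult_iff by (auto simp: summable_Suc_iff[of "\<lambda>t. \<beta> ^ t * mass lam t s"] simp del: power_Suc)
  show nn': "nonneg_mult A (\<lambda>k. lam ((s, b) # k))"
    using nonneg_mult_Cons[OF nn assms(2)] .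
  fix s'
  have le: "\<pi> s s' * mass (\<lambda>k. lam ((s, b) # k)) t s' \<le> mass lam (Suc t) s" for t
  proof -
    have "\<pi> s s' * mass (\<lambda>k. lam ((s, b) # k)) t s'
        \<le> (\<Sum>s'\<in>UNIV. \<pi> s s' * mass (\<lambda>k. lam ((s, b) # k)) t s')"
      by (rule member_le_sum) (use mass_nonneg[OF nn'] pi_pos in \<open>auto simp: less_imp_le\<close>)
    also have "\<dots> \<le> mass lam (Suc t) s"
      by (rule mass_shift_le[OF nn assms(2)])
    finally show ?thesis .
  qed
  show "summable (\<lambda>t. \<beta> ^ t * mass (\<lambda>k. lam ((s, b) # k)) t s')"
  proof (rule summable_comparison_test'[OF summable_mult[OF sm, of "1 / (\<beta> * \<pi> s s')"], of 0])
    fix t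
    have "\<beta> * \<pi> s s' * (\<beta> ^ t * mass (\<lambda>k. lam ((s, b) # k)) t s') \<le> \<beta> ^ Suc t * mass lam (Suc t) s"
      using mult_left_mono[OF le[of t], of "\<beta> ^ Suc t"] beta by (simp add: ac_simps)
    then show "norm (\<beta> ^ t * mass (\<lambda>k. lam ((s, b) # k)) t s')
        \<le> 1 / (\<beta> * \<pi> s s') * (\<beta> ^ Suc t * mass lam (Suc t) s)"
      using beta pi_pos[of s s'] mass_nonneg[OF nn'] by (simp add: field_simps abs_mult)
  qed
qed

text \<open>At each node a plan meets the multiplier of one action, while the mass adds those of all
  actions.\<close>

lemma condE_mult_le_mass:
  assumes "nonneg_mult A lam" "\<And>h. h \<noteq> [] \<Longrightarrow> a h \<in> A"
  shows "condE \<pi> [s] t (\<lambda>h. \<Sum>i\<in>UNIV. lam (htil a h) $ i) \<le> mass lam t s"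
  using assms
proof (induction t arbitrary: s a lam)
  case 0
  have "(\<Sum>i\<in>UNIV. lam [(s, a [s])] $ i) \<le> (\<Sum>b\<in>A. \<Sum>i\<in>UNIV. lam [(s, b)] $ i)"
    by (rule member_le_sum[where f = "\<lambda>b. \<Sum>i\<in>UNIV. lam [(s, b)] $ i"])
      (use 0 A_fin in \<open>auto intro!: sum_nonneg simp: nonneg_mult_def\<close>)
  then show ?case
    by (simp add: cE_0 mass_0 htil_Cons)
next
  case (Suc t)
  have a: "a [s] \<in> A"
    using Suc.prems by simp
  have "condE \<pi> [s] (Suc t) (\<lambda>h. \<Sum>i\<in>UNIV. lam (htil a h) $ i)
     = (\<Sum>s'\<in>UNIV. \<pi> s s' * condE \<pi> [s'] t (\<lambda>h. \<Sum>i\<in>UNIV. lam ((s, a [s]) # htil (shift_plan a s) h) $ i))"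
    unfolding condE_Suc htil_Cons ..
  also have "\<dots> \<le> (\<Sum>s'\<in>UNIV. \<pi> s s' * mass (\<lambda>k. lam ((s, a [s]) # k)) t s')"
    using Suc.prems nonneg_mult_Cons[OF Suc.prems(1) a] pi_pos
    by (intro sum_mono mult_left_mono Suc.IH) (auto simp: shift_plan_def less_imp_le)
  also have "\<dots> \<le> mass lam (Suc t) s"
    by (rule mass_shift_le[OF Suc.prems(1) a])
  finally show ?case .
qed

lemma pen_bound:
  assumes "nonneg_mult A lam" "x \<in> X" "a \<in> plans x"
  shows "\<bar>pen a lam x s t\<bar> \<le> Cpen * mass lam t s"
proof -
  let ?f = "\<lambda>h. \<Sum>i\<in>UNIV. lam (htil a h) $ i * (cnt x a (g i) h - gbar i)"
  let ?l = "\<lambda>h. \<Sum>i\<in>UNIV. lam (htil a h) $ i"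
  have nn: "0 \<le> lam (htil a ([s] @ e)) $ i" for e i
  proof -
    have "htil a ([s] @ e) \<in> alists A (length ([s] @ e))"
      by (rule htil_alists) (rule plan_in_A[OF assms(3)])
    then show ?thesis
      using assms(1) unfolding nonneg_mult_def alists_def
      by (metis (no_types, lifting) append_Cons htil_eq_Nil list.distinct(1) list.set_map mem_Collect_eq)
  qed
  have b: "\<bar>?f ([s] @ e)\<bar> \<le> Cpen * ?l ([s] @ e)" for e
  proof -
    have "\<bar>?f ([s] @ e)\<bar> \<le> (\<Sum>i\<in>UNIV. \<bar>lam (htil a ([s] @ e)) $ i * (cnt x a (g i) ([s] @ e) - gbar i)\<bar>)"
      by (rule sum_abs)
    also have "\<dots> \<le> (\<Sum>i\<in>UNIV. Cpen * lam (htil a ([s] @ e)) $ i)"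
    proof (rule sum_mono)
      fix i
      have "\<bar>cnt x a (g i) ([s] @ e) - gbar i\<bar> \<le> Cpen"
        by (rule cont_gbar_le) (use assms in auto)
      then show "\<bar>lam (htil a ([s] @ e)) $ i * (cnt x a (g i) ([s] @ e) - gbar i)\<bar>
          \<le> Cpen * lam (htil a ([s] @ e)) $ i"
        using nn[of e i] by (simp add: abs_mult mult_left_mono mult.commute[of Cpen])
    qed
    finally show ?thesis
      by (simp add: sum_distrib_left)
  qed
  have "condE \<pi> [s] t ?f \<le> condE \<pi> [s] t (\<lambda>h. Cpen * ?l h)"
    using b by (intro cE_mono) (simp add: abs_le_iff)
  moreover have "condE \<pi> [s] t (\<lambda>h. (- Cpen) * ?l h) \<le> condE \<pi> [s] t ?f"
    by (intro cE_mono) (use b in \<open>simp add: abs_le_iff, smt (verit)\<close>)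
  moreover have "Cpen * condE \<pi> [s] t ?l \<le> Cpen * mass lam t s"
    using assms plan_in_A[OF assms(3)] by (intro mult_left_mono condE_mult_le_mass Cpen_nonneg) auto
  ultimately show ?thesis
    unfolding penalty_def condE_cmult by simp
qed

lemma pen_summable:
  assumes "lam \<in> Mult" "x \<in> X" "a \<in> plans x"
  shows "summable (\<lambda>t. \<beta> ^ t * pen a lam x s t)"
proof -
  have "nonneg_mult A lam" and s: "summable (\<lambda>t. \<beta> ^ t * mass lam t s)"
    using assms(1) unfolding Mult_iff by auto
  then have "\<bar>\<beta> ^ t * pen a lam x s t\<bar> \<le> Cpen * (\<beta> ^ t * mass lam t s)" for t
    using mult_left_mono[OF pen_bound[of lam x a s t], of "\<beta> ^ t"] assms beta
    by (simp add: abs_mult ac_simps)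
  then show ?thesis
    by (intro summable_comparison_test'[OF summable_mult[OF s, of Cpen], of 0]) auto
qed

lemma pen_0: "pen a lam x s 0 = (\<Sum>i\<in>UNIV. lam [(s, a [s])] $ i * (cnt x a (g i) [s] - gbar i))"
  by (simp add: penalty_def cE_0 htil_Cons)

lemma pen_Suc:
  "pen a lam x s (Suc t) = (\<Sum>s'\<in>UNIV. \<pi> s s' *
     pen (shift_plan a s) (\<lambda>k. lam ((s, a [s]) # k)) (\<zeta> x (a [s]) s) s' t)"
  unfolding penalty_def condE_Suc
  by (intro sum.cong refl arg_cong2[where f = "(*)"] condE_cong) (simp_all add: htil_Cons cont_Cons)

lemma Lag_eq:
  assumes "lam \<in> Mult" "x \<in> X" "a \<in> plans x"
  shows "Lag a lam \<gamma> x s = cnt x a r [s] + (\<Sum>i\<in>UNIV. \<gamma> $ i * cnt x a (g i) [s])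
    + (\<Sum>t. \<beta> ^ t * pen a lam x s t)"
proof -
  let ?f = "\<lambda>x b s. r x b s + (\<Sum>i\<in>UNIV. \<gamma> $ i * g i x b s)"
  have "condE \<pi> [s] t (\<lambda>h. flow r \<zeta> x a h + (\<Sum>i\<in>UNIV. \<gamma> $ i * flow (g i) \<zeta> x a h)
        + (\<Sum>i\<in>UNIV. lam (htil a h) $ i * (cnt x a (g i) h - gbar i)))
      = condE \<pi> [s] t (flow ?f \<zeta> x a) + pen a lam x s t" for t
    unfolding penalty_def condE_add condE_flow_weighted condE_sum condE_cmult by simp
  then have "Lag a lam \<gamma> x s = (\<Sum>t. \<beta> ^ t * condE \<pi> [s] t (flow ?f \<zeta> x a) + \<beta> ^ t * pen a lam x s t)"
    unfolding Ltil_def by (simp add: distrib_left)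
  also have "\<dots> = cnt x a ?f [s] + (\<Sum>t. \<beta> ^ t * pen a lam x s t)"
  proof -
    have "summable (\<lambda>t. \<beta> ^ t * condE \<pi> [s] t (flow ?f \<zeta> x a))"
      unfolding condE_flow_weighted distrib_left sum_distrib_left mult.left_commute[of _ "\<gamma> $ _"]
      by (intro summable_add summable_sum summable_mult
            cont_summable[OF bounded_r] cont_summable[OF bounded_g]) (use assms in auto)
    then show ?thesis
      unfolding cont_def using pen_summable[OF assms] by (simp add: suminf_add)
  qed
  finally show ?thesis
    using assms by (simp add: cont_weighted)
qed

lemma pen_rec:
  assumes "lam \<in> Mult" "x \<in> X" "a \<in> plans x"
  shows "(\<Sum>t. \<beta> ^ t * pen a lam x s t) = (\<Sum>i\<in>UNIV. lam [(s, a [s])] $ i * (cnt x a (g i) [s] - gbar i))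
    + \<beta> * (\<Sum>s'\<in>UNIV. \<pi> s s' * (\<Sum>t. \<beta> ^ t *
        pen (shift_plan a s) (\<lambda>k. lam ((s, a [s]) # k)) (\<zeta> x (a [s]) s) s' t))"
proof -
  let ?p = "pen (shift_plan a s) (\<lambda>k. lam ((s, a [s]) # k)) (\<zeta> x (a [s]) s)"
  have sm: "summable (\<lambda>t. \<beta> ^ t * ?p s' t)" for s'
    using assms plan_step by (intro pen_summable Mult_shift) auto
  have "(\<Sum>t. \<beta> ^ t * pen a lam x s t) = pen a lam x s 0 + (\<Sum>t. \<beta> ^ Suc t * pen a lam x s (Suc t))"
    by (subst suminf_Suc_head[OF pen_summable[OF assms]]) simp
  also have "(\<Sum>t. \<beta> ^ Suc t * pen a lam x s (Suc t)) = (\<Sum>t. \<Sum>s'\<in>UNIV. \<beta> * \<pi> s s' * (\<beta> ^ t * ?p s' t))"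
    unfolding pen_Suc sum_distrib_left by (simp add: ac_simps)
  also have "\<dots> = (\<Sum>s'\<in>UNIV. \<Sum>t. \<beta> * \<pi> s s' * (\<beta> ^ t * ?p s' t))"
    by (rule suminf_sum) (intro summable_mult sm)
  also have "\<dots> = (\<Sum>s'\<in>UNIV. \<beta> * \<pi> s s' * (\<Sum>t. \<beta> ^ t * ?p s' t))"
    by (intro sum.cong refl suminf_mult sm)
  finally show ?thesis
    by (simp add: sum_distrib_left mult.assoc pen_0)
qed

text \<open>Today's multiplier weighs a whole continuation value of \<open>g i\<close>, and so does
  \<open>\<gamma> $ i\<close>. Splitting off the current payoff leaves the future value of
  \<open>g i\<close> with coefficient \<open>\<gamma> $ i + lam [(s, a [s])] $ i\<close>, which
  becomes the weight of the continuation problem.\<close>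

lemma Lag_rec:
  assumes "lam \<in> Mult" "x \<in> X" "a \<in> plans x"
  shows "Lag a lam \<gamma> x s = r x (a [s]) s
    + (\<Sum>i\<in>UNIV. \<gamma> $ i * g i x (a [s]) s + lam [(s, a [s])] $ i * (g i x (a [s]) s - gbar i))
    + \<beta> * (\<Sum>s'\<in>UNIV. \<pi> s s' * Lag (shift_plan a s) (\<lambda>k. lam ((s, a [s]) # k))
          (\<gamma> + lam [(s, a [s])]) (\<zeta> x (a [s]) s) s')"
proof -
  let ?x = "\<zeta> x (a [s]) s" and ?a = "shift_plan a s" and ?l = "\<lambda>k. lam ((s, a [s]) # k)"
  let ?lz = "lam [(s, a [s])]"
  define R where "R s' = cnt ?x ?a r [s']" for s'
  define G where "G i s' = cnt ?x ?a (g i) [s']" for i s'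
  define P where "P s' = (\<Sum>t. \<beta> ^ t * pen ?a ?l ?x s' t)" for s'
  have L: "Lag ?a ?l (\<gamma> + ?lz) ?x s' = R s' + (\<Sum>i\<in>UNIV. (\<gamma> $ i + ?lz $ i) * G i s') + P s'" for s'
    unfolding R_def G_def P_def using assms plan_step by (subst Lag_eq) (auto intro: Mult_shift)
  have swap: "(\<Sum>i\<in>UNIV. c i * (\<beta> * (\<Sum>s'\<in>UNIV. \<pi> s s' * G i s')))
      = \<beta> * (\<Sum>s'\<in>UNIV. \<pi> s s' * (\<Sum>i\<in>UNIV. c i * G i s'))" for c
    unfolding sum_distrib_left by (subst sum.swap) (simp add: ac_simps)
  have "Lag a lam \<gamma> x s = (r x (a [s]) s + \<beta> * (\<Sum>s'\<in>UNIV. \<pi> s s' * R s'))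
      + (\<Sum>i\<in>UNIV. \<gamma> $ i * (g i x (a [s]) s + \<beta> * (\<Sum>s'\<in>UNIV. \<pi> s s' * G i s')))
      + ((\<Sum>i\<in>UNIV. ?lz $ i * (g i x (a [s]) s + \<beta> * (\<Sum>s'\<in>UNIV. \<pi> s s' * G i s') - gbar i))
      + \<beta> * (\<Sum>s'\<in>UNIV. \<pi> s s' * P s'))"
    unfolding Lag_eq[OF assms] pen_rec[OF assms] cont_single[OF bounded_r assms(2,3)]
      cont_single[OF bounded_g assms(2,3)] R_def G_def P_def ..
  also have "\<dots> = r x (a [s]) s + (\<Sum>i\<in>UNIV. \<gamma> $ i * g i x (a [s]) s + ?lz $ i * (g i x (a [s]) s - gbar i))
     + (\<beta> * (\<Sum>s'\<in>UNIV. \<pi> s s' * R s') + (\<Sum>i\<in>UNIV. (\<gamma> $ i + ?lz $ i) * (\<beta> * (\<Sum>s'\<in>UNIV. \<pi> s s' * G i s')))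
     + \<beta> * (\<Sum>s'\<in>UNIV. \<pi> s s' * P s'))"
    by (simp add: sum.distrib sum_subtractf algebra_simps)
  also have "\<dots> = r x (a [s]) s + (\<Sum>i\<in>UNIV. \<gamma> $ i * g i x (a [s]) s + ?lz $ i * (g i x (a [s]) s - gbar i))
     + \<beta> * (\<Sum>s'\<in>UNIV. \<pi> s s' * (R s' + (\<Sum>i\<in>UNIV. (\<gamma> $ i + ?lz $ i) * G i s') + P s'))"
    unfolding swap by (simp add: sum.distrib distrib_left)
  finally show ?thesis
    unfolding L .
qed

text \<open>The bound is the same for all plans; it makes suprema over plans finite and controls
  what is left after greedy play.\<close>

lemma Lag_bound:
  assumes "lam \<in> Mult" "x \<in> X" "a \<in> plans x" "\<gamma> \<in> nonneg"
  shows "\<bar>Lag a lam \<gamma> x s\<bar> \<le> (1 + (\<Sum>i\<in>UNIV. \<gamma> $ i)) * Lc + Cpen * (\<Sum>t. \<beta> ^ t * mass lam t s)"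
proof -
  have nn: "nonneg_mult A lam" and sm: "summable (\<lambda>t. \<beta> ^ t * mass lam t s)"
    using assms(1) unfolding Mult_iff by auto
  have le: "\<bar>\<beta> ^ t * pen a lam x s t\<bar> \<le> Cpen * (\<beta> ^ t * mass lam t s)" for t
    using mult_left_mono[OF pen_bound[OF nn assms(2,3), of s t], of "\<beta> ^ t"] beta
    by (simp add: abs_mult ac_simps)
  have s: "summable (\<lambda>t. \<bar>\<beta> ^ t * pen a lam x s t\<bar>)"
    by (rule summable_comparison_test'[OF summable_mult[OF sm, of Cpen], of 0]) (use le in auto)
  have "\<bar>\<Sum>t. \<beta> ^ t * pen a lam x s t\<bar> \<le> (\<Sum>t. \<bar>\<beta> ^ t * pen a lam x s t\<bar>)"
    by (rule summable_rabs[OF s])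
  also have "\<dots> \<le> (\<Sum>t. Cpen * (\<beta> ^ t * mass lam t s))"
    by (intro suminf_le le s summable_mult sm)
  also have "\<dots> = Cpen * (\<Sum>t. \<beta> ^ t * mass lam t s)"
    by (rule suminf_mult[OF sm])
  finally have P: "\<bar>\<Sum>t. \<beta> ^ t * pen a lam x s t\<bar> \<le> Cpen * (\<Sum>t. \<beta> ^ t * mass lam t s)" .
  have "\<bar>\<Sum>i\<in>UNIV. \<gamma> $ i * cnt x a (g i) [s]\<bar> \<le> (\<Sum>i\<in>UNIV. \<bar>\<gamma> $ i * cnt x a (g i) [s]\<bar>)"
    by (rule sum_abs)
  also have "\<dots> \<le> (\<Sum>i\<in>UNIV. \<gamma> $ i * Lc)"
  proof (rule sum_mono)
    fix i
    show "\<bar>\<gamma> $ i * cnt x a (g i) [s]\<bar> \<le> \<gamma> $ i * Lc"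
      using cont_g_le[OF assms(2,3), of "[s]" i] assms(4)
      by (simp add: abs_mult nonneg_def mult_left_mono)
  qed
  finally have "\<bar>\<Sum>i\<in>UNIV. \<gamma> $ i * cnt x a (g i) [s]\<bar> \<le> (\<Sum>i\<in>UNIV. \<gamma> $ i) * Lc"
    by (simp add: sum_distrib_right)
  moreover have "\<bar>cnt x a r [s]\<bar> \<le> Lc"
    using cont_r_le[OF assms(2,3)] by simp
  ultimately show ?thesis
    unfolding Lag_eq[OF assms(1-3)] using P by (simp add: distrib_right)
qed

end

section \<open>Regularity of the dual value\<close>

lemma nonneg_add: "(\<gamma>::real^'j::finite) \<in> nonneg \<Longrightarrow> \<gamma>' \<in> nonneg \<Longrightarrow> \<gamma> + \<gamma>' \<in> nonneg"
  by (simp add: nonneg_def)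

lemma nonneg_convex: "convex (nonneg :: (real^'j::finite) set)"
  unfolding convex_def nonneg_def by auto

lemma Bk_nonneg: "Bk k \<subseteq> nonneg"
  by (auto simp: Bk_def nonneg_def)

text \<open>\<open>Linf\<close> is infinite for functions that are not measurable, so a pointwise
  bound does not suffice; continuity on the closed set \<open>Bk k\<close> supplies
  measurability.\<close>

lemma Linf_le:
  fixes f :: "real^'j::finite \<Rightarrow> real"
  assumes "continuous_on (Bk k) f" "\<And>\<gamma>. \<gamma> \<in> Bk k \<Longrightarrow> \<bar>f \<gamma>\<bar> \<le> c"
  shows "Linf k f \<le> ereal c"
proof -
  have "closed (Bk k :: (real^'j) set)"
    unfolding Bk_def by (intro closed_Collect_all closed_Collect_conj closed_Collect_le continuous_intros)
  then have Bk: "(Bk k :: (real^'j) set) \<in> sets lebesgue"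
    using lebesgue_closedin[of UNIV "Bk k :: (real^'j) set"] by simp
  have "f \<in> borel_measurable (lebesgue_on (Bk k))"
    by (rule continuous_imp_measurable_on_sets_lebesgue[OF assms(1) Bk])
  then have "(\<lambda>\<gamma>. ereal \<bar>f \<gamma>\<bar>) \<in> borel_measurable (lebesgue_on (Bk k))"
    by measurable
  then show ?thesis
    unfolding Linf_def using Bk assms(2)
    by (intro esssup_I AE_I2) (auto simp: space_restrict_space)
qed

context lottery_model
begin

section \<open>Finiteness of the dual value\<close>

lemma zero_Mult: "(\<lambda>_. 0) \<in> Mult"
  unfolding Mult_iff by (simp add: nonneg_mult_def lam_mass_def)

text \<open>Along a feasible plan every slack is nonnegative, so nonnegative multipliers cannot push
  the Lagrangian below the payoff.\<close>

lemma cont_weighted_le_Lag: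
  assumes "lam \<in> Mult" "x \<in> X" "feasible A p \<zeta> \<pi> \<beta> g gbar x s a"
  shows "cnt x a r [s] + (\<Sum>i\<in>UNIV. \<gamma> $ i * cnt x a (g i) [s]) \<le> Lag a lam \<gamma> x s"
proof -
  have a: "a \<in> plans x" and fe: "\<And>h i. h \<noteq> [] \<Longrightarrow> hd h = s \<Longrightarrow> gbar i \<le> cnt x a (g i) h"
    using assms(3) by (auto simp: feasible_def Hist_def)
  have nn: "nonneg_mult A lam"
    using assms(1) unfolding Mult_iff by auto
  have "0 \<le> pen a lam x s t" for t
  proof -
    have "condE \<pi> [s] t (\<lambda>_. 0) \<le> pen a lam x s t"
      unfolding penalty_def
    proof (intro cE_mono sum_nonneg mult_nonneg_nonneg)
      fix e :: "'s list" and i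
      have "htil a ([s] @ e) \<in> alists A (length ([s] @ e))"
        by (rule htil_alists) (rule plan_in_A[OF a])
      moreover have "htil a ([s] @ e) \<noteq> []"
        by simp
      ultimately show "0 \<le> lam (htil a ([s] @ e)) $ i"
        using nn unfolding nonneg_mult_def alists_def by (metis (no_types, lifting) list.set_map mem_Collect_eq)
      show "0 \<le> cnt x a (g i) ([s] @ e) - gbar i"
        using fe[of "[s] @ e" i] by simp
    qed
    then show ?thesis
      by (simp add: cE_const)
  qed
  then have "0 \<le> (\<Sum>t. \<beta> ^ t * pen a lam x s t)"
    using beta by (intro suminf_nonneg pen_summable[OF assms(1,2) a]) auto
  then show ?thesis
    unfolding Lag_eq[OF assms(1,2) a] by simp
qed

lemma D_upper:
  assumes "x \<in> X" "\<gamma> \<in> nonneg"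
  shows "D \<gamma> x s \<le> ereal ((1 + (\<Sum>i\<in>UNIV. \<gamma> $ i)) * Lc)"
  unfolding Dtil_def
proof (rule INF_lower2[OF zero_Mult], rule SUP_least)
  fix a assume "a \<in> plans x"
  then show "ereal (Lag a (\<lambda>_. 0) \<gamma> x s) \<le> ereal ((1 + (\<Sum>i\<in>UNIV. \<gamma> $ i)) * Lc)"
    using Lag_bound[OF zero_Mult assms(1) _ assms(2), of a s] by (simp add: lam_mass_def)
qed

lemma D_lower:
  assumes "x \<in> X" "feasible A p \<zeta> \<pi> \<beta> g gbar x s a"
  shows "ereal (cnt x a r [s] + (\<Sum>i\<in>UNIV. \<gamma> $ i * cnt x a (g i) [s])) \<le> D \<gamma> x s"
  unfolding Dtil_def
proof (rule INF_greatest, rule SUP_upper2)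
  fix lam assume "lam \<in> Mult"
  then show "ereal (cnt x a r [s] + (\<Sum>i\<in>UNIV. \<gamma> $ i * cnt x a (g i) [s])) \<le> ereal (Lag a lam \<gamma> x s)"
    using cont_weighted_le_Lag[OF _ assms] by simp
qed (use assms in \<open>simp add: feasible_def\<close>)

text \<open>The value 0 off the domain keeps the series in \<open>inM\<close> finite when
  \<open>X\<close> is empty and its enumeration yields a point outside \<open>X\<close>.\<close>

definition Dval :: "real ^ 'i \<Rightarrow> 'x \<Rightarrow> 's \<Rightarrow> real" where
  "Dval \<gamma> x s = (if \<gamma> \<in> nonneg \<and> x \<in> X then real_of_ereal (D \<gamma> x s) else 0)"

lemma ereal_Dval:
  assumes "x \<in> X" "\<gamma> \<in> nonneg"
  shows "ereal (Dval \<gamma> x s) = D \<gamma> x s"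
proof -
  obtain a where "feasible A p \<zeta> \<pi> \<beta> g gbar x s a"
    using feas_ex[OF assms(1)] by blast
  then have "\<bar>D \<gamma> x s\<bar> \<noteq> \<infinity>"
    using D_upper[OF assms, of s] D_lower[OF assms(1), of s a \<gamma>] by auto
  then show ?thesis
    using assms by (simp add: Dval_def ereal_real')
qed

lemma Dval_le:
  assumes "x \<in> X" "\<gamma> \<in> nonneg" "lam \<in> Mult" "\<And>a. a \<in> plans x \<Longrightarrow> Lag a lam \<gamma> x s \<le> y"
  shows "Dval \<gamma> x s \<le> y"
proof -
  have "D \<gamma> x s \<le> ereal y"
    unfolding Dtil_def by (rule INF_lower2[OF assms(3)], rule SUP_least) (simp add: assms(4))
  then show ?thesis
    using ereal_Dval[OF assms(1,2), of s] by (metis ereal_less_eq(3))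
qed

lemma Dval_less_mult:
  assumes "x \<in> X" "\<gamma> \<in> nonneg" "Dval \<gamma> x s < y"
  obtains lam where "lam \<in> Mult" "\<And>a. a \<in> plans x \<Longrightarrow> Lag a lam \<gamma> x s < y"
proof -
  have "D \<gamma> x s < ereal y"
    using ereal_Dval[OF assms(1,2), of s] assms(3) by (metis ereal_less(2) less_ereal.simps(1))
  then obtain lam where lam: "lam \<in> Mult" "(SUP a\<in>plans x. ereal (Lag a lam \<gamma> x s)) < ereal y"
    unfolding Dtil_def INF_less_iff by blast
  have "Lag a lam \<gamma> x s < y" if "a \<in> plans x" for a
    using le_less_trans[OF SUP_upper[OF that] lam(2)] by simp
  with lam(1) that show thesis
    by blast
qed

lemma less_Dval_plan:
  assumes "x \<in> X" "\<gamma> \<in> nonneg" "y < Dval \<gamma> x s" "lam \<in> Mult"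
  obtains a where "a \<in> plans x" "y < Lag a lam \<gamma> x s"
proof (rule ccontr)
  assume "\<not> thesis"
  then have "Dval \<gamma> x s \<le> y"
    using that by (intro Dval_le[OF assms(1,2,4)]) force
  then show False
    using assms(3) by simp
qed

lemma Dval_ge:
  assumes "x \<in> X" "\<gamma> \<in> nonneg" "\<And>lam. lam \<in> Mult \<Longrightarrow> \<exists>a\<in>plans x. y \<le> Lag a lam \<gamma> x s"
  shows "y \<le> Dval \<gamma> x s"
proof (rule ccontr)
  assume "\<not> y \<le> Dval \<gamma> x s"
  then obtain lam where "lam \<in> Mult" "\<And>a. a \<in> plans x \<Longrightarrow> Lag a lam \<gamma> x s < y"
    using Dval_less_mult[OF assms(1,2)] by (metis not_le)
  with assms(3) show False
    by force
qed

section \<open>Convexity and Lipschitz continuity in the weight\<close>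

lemma mass_combine:
  "mass (\<lambda>k. (1 - u) *\<^sub>R lam1 k + u *\<^sub>R lam2 k) t s = (1 - u) * mass lam1 t s + u * mass lam2 t s"
  by (simp add: lam_mass_def sum.distrib sum_distrib_left distrib_right distrib_left mult.assoc)

lemma Mult_convex:
  assumes "lam1 \<in> Mult" "lam2 \<in> Mult" "0 \<le> u" "u \<le> 1"
  shows "(\<lambda>k. (1 - u) *\<^sub>R lam1 k + u *\<^sub>R lam2 k) \<in> Mult"
proof -
  have "summable (\<lambda>t. (1 - u) * (\<beta> ^ t * mass lam1 t s) + u * (\<beta> ^ t * mass lam2 t s))" for s
    using assms unfolding Mult_iff by (intro summable_add summable_mult) auto
  then show ?thesis
    using assms unfolding Mult_iff mass_combine
    by (auto simp: nonneg_mult_def distrib_left mult.left_commute)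
qed

lemma Lag_affine:
  assumes "lam1 \<in> Mult" "lam2 \<in> Mult" "0 \<le> u" "u \<le> 1" "x \<in> X" "a \<in> plans x"
  shows "Lag a (\<lambda>k. (1 - u) *\<^sub>R lam1 k + u *\<^sub>R lam2 k) ((1 - u) *\<^sub>R \<gamma>1 + u *\<^sub>R \<gamma>2) x s
    = (1 - u) * Lag a lam1 \<gamma>1 x s + u * Lag a lam2 \<gamma>2 x s"
proof -
  have "pen a (\<lambda>k. (1 - u) *\<^sub>R lam1 k + u *\<^sub>R lam2 k) x s t
      = (1 - u) * pen a lam1 x s t + u * pen a lam2 x s t" for t
    unfolding penalty_def condE_cmult[symmetric] condE_add[symmetric]
    by (simp add: sum.distrib sum_distrib_left distrib_right mult.assoc)
  then have "(\<Sum>t. \<beta> ^ t * pen a (\<lambda>k. (1 - u) *\<^sub>R lam1 k + u *\<^sub>R lam2 k) x s t)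
      = (\<Sum>t. (1 - u) * (\<beta> ^ t * pen a lam1 x s t) + u * (\<beta> ^ t * pen a lam2 x s t))"
    by (simp add: distrib_left mult.left_commute)
  also have "\<dots> = (1 - u) * (\<Sum>t. \<beta> ^ t * pen a lam1 x s t) + u * (\<Sum>t. \<beta> ^ t * pen a lam2 x s t)"
    using pen_summable assms by (simp add: suminf_add[symmetric] suminf_mult summable_mult)
  finally have *: "(\<Sum>t. \<beta> ^ t * pen a (\<lambda>k. (1 - u) *\<^sub>R lam1 k + u *\<^sub>R lam2 k) x s t)
    = (1 - u) * (\<Sum>t. \<beta> ^ t * pen a lam1 x s t) + u * (\<Sum>t. \<beta> ^ t * pen a lam2 x s t)" .
  show ?thesis
    unfolding Lag_eq[OF Mult_convex[OF assms(1-4)] assms(5,6)] Lag_eq[OF assms(1,5,6)]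
      Lag_eq[OF assms(2,5,6)] *
    by (simp add: algebra_simps sum.distrib sum_distrib_left sum_subtractf)
qed

text \<open>Partial minimisation: for each plan the Lagrangian is jointly affine in multiplier and
  weight, so the supremum over plans is jointly convex, and the infimum over the convex set
  \<open>Mult\<close> is convex in the weight.\<close>

lemma Dval_convex:
  assumes "x \<in> X"
  shows "convex_on nonneg (\<lambda>\<gamma>. Dval \<gamma> x s)"
proof (rule convex_onI[OF _ nonneg_convex])
  fix u :: real and \<gamma>1 \<gamma>2 :: "real^'i"
  assume u: "0 < u" "u < 1" and \<gamma>: "\<gamma>1 \<in> nonneg" "\<gamma>2 \<in> nonneg"
  have \<gamma>': "(1 - u) *\<^sub>R \<gamma>1 + u *\<^sub>R \<gamma>2 \<in> nonneg"
    using u \<gamma> by (simp add: nonneg_def)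
  show "Dval ((1 - u) *\<^sub>R \<gamma>1 + u *\<^sub>R \<gamma>2) x s \<le> (1 - u) * Dval \<gamma>1 x s + u * Dval \<gamma>2 x s"
  proof (rule field_le_epsilon)
    \<comment> \<open>The infima need not be attained, so multipliers that are optimal up to
      \<open>e\<close> are mixed.\<close>
    fix e :: real assume e: "0 < e"
    obtain lam1 where l1: "lam1 \<in> Mult" "\<And>a. a \<in> plans x \<Longrightarrow> Lag a lam1 \<gamma>1 x s < Dval \<gamma>1 x s + e"
      using Dval_less_mult[OF assms \<gamma>(1), of s "Dval \<gamma>1 x s + e"] e by auto
    obtain lam2 where l2: "lam2 \<in> Mult" "\<And>a. a \<in> plans x \<Longrightarrow> Lag a lam2 \<gamma>2 x s < Dval \<gamma>2 x s + e"
      using Dval_less_mult[OF assms \<gamma>(2), of s "Dval \<gamma>2 x s + e"] e by auto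
    show "Dval ((1 - u) *\<^sub>R \<gamma>1 + u *\<^sub>R \<gamma>2) x s \<le> (1 - u) * Dval \<gamma>1 x s + u * Dval \<gamma>2 x s + e"
    proof (rule Dval_le[OF assms \<gamma>' Mult_convex[OF l1(1) l2(1), of u]])
      fix a assume a: "a \<in> plans x"
      have "(1 - u) * Lag a lam1 \<gamma>1 x s + u * Lag a lam2 \<gamma>2 x s
          \<le> (1 - u) * (Dval \<gamma>1 x s + e) + u * (Dval \<gamma>2 x s + e)"
        using u l1(2)[OF a] l2(2)[OF a] by (intro add_mono mult_left_mono) auto
      also have "\<dots> = (1 - u) * Dval \<gamma>1 x s + u * Dval \<gamma>2 x s + e"
        by (simp add: algebra_simps)
      finally show "Lag a (\<lambda>k. (1 - u) *\<^sub>R lam1 k + u *\<^sub>R lam2 k) ((1 - u) *\<^sub>R \<gamma>1 + u *\<^sub>R \<gamma>2) x s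
          \<le> (1 - u) * Dval \<gamma>1 x s + u * Dval \<gamma>2 x s + e"
        using u by (subst Lag_affine[OF l1(1) l2(1) _ _ assms a]) auto
    qed (use u in auto)
  qed
qed

text \<open>The weight multiplies continuation payoffs only, and these are bounded by
  \<open>Lc\<close>. The estimate is uniform in plan and multiplier and hence survives supremum and
  infimum.\<close>

lemma Lag_lipschitz:
  assumes "lam \<in> Mult" "x \<in> X" "a \<in> plans x"
  shows "Lag a lam \<gamma>1 x s \<le> Lag a lam \<gamma>2 x s + Lc * (\<Sum>i\<in>UNIV. \<bar>\<gamma>1 $ i - \<gamma>2 $ i\<bar>)"
proof -
  have "(\<Sum>i\<in>UNIV. (\<gamma>1 $ i - \<gamma>2 $ i) * cnt x a (g i) [s]) \<le> (\<Sum>i\<in>UNIV. Lc * \<bar>\<gamma>1 $ i - \<gamma>2 $ i\<bar>)"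
  proof (rule sum_mono)
    fix i
    have "(\<gamma>1 $ i - \<gamma>2 $ i) * cnt x a (g i) [s] \<le> \<bar>\<gamma>1 $ i - \<gamma>2 $ i\<bar> * \<bar>cnt x a (g i) [s]\<bar>"
      by (metis abs_ge_self abs_mult)
    also have "\<dots> \<le> \<bar>\<gamma>1 $ i - \<gamma>2 $ i\<bar> * Lc"
      using cont_g_le[OF assms(2,3), of "[s]" i] by (intro mult_left_mono) auto
    finally show "(\<gamma>1 $ i - \<gamma>2 $ i) * cnt x a (g i) [s] \<le> Lc * \<bar>\<gamma>1 $ i - \<gamma>2 $ i\<bar>"
      by (simp add: mult.commute)
  qed
  then show ?thesis
    unfolding Lag_eq[OF assms] by (simp add: left_diff_distrib sum_subtractf sum_distrib_left)
qed

lemma Dval_lipschitz_upper: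
  assumes "x \<in> X" "\<gamma>1 \<in> nonneg" "\<gamma>2 \<in> nonneg"
  shows "Dval \<gamma>1 x s \<le> Dval \<gamma>2 x s + Lc * (\<Sum>i\<in>UNIV. \<bar>\<gamma>1 $ i - \<gamma>2 $ i\<bar>)"
proof (rule field_le_epsilon)
  fix e :: real assume e: "0 < e"
  obtain lam where l: "lam \<in> Mult" "\<And>a. a \<in> plans x \<Longrightarrow> Lag a lam \<gamma>2 x s < Dval \<gamma>2 x s + e"
    using Dval_less_mult[OF assms(1,3), of s "Dval \<gamma>2 x s + e"] e by auto
  show "Dval \<gamma>1 x s \<le> Dval \<gamma>2 x s + Lc * (\<Sum>i\<in>UNIV. \<bar>\<gamma>1 $ i - \<gamma>2 $ i\<bar>) + e"
  proof (rule Dval_le[OF assms(1,2) l(1)])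
    fix a assume a: "a \<in> plans x"
    show "Lag a lam \<gamma>1 x s \<le> Dval \<gamma>2 x s + Lc * (\<Sum>i\<in>UNIV. \<bar>\<gamma>1 $ i - \<gamma>2 $ i\<bar>) + e"
      using l(2)[OF a] Lag_lipschitz[OF l(1) assms(1) a, of \<gamma>1 s \<gamma>2] by simp
  qed
qed

lemma Dval_lipschitz:
  assumes "x \<in> X" "\<gamma>1 \<in> nonneg" "\<gamma>2 \<in> nonneg"
  shows "\<bar>Dval \<gamma>1 x s - Dval \<gamma>2 x s\<bar> \<le> Lc * (\<Sum>i\<in>UNIV. \<bar>\<gamma>1 $ i - \<gamma>2 $ i\<bar>)"
proof -
  have "(\<Sum>i\<in>UNIV. \<bar>\<gamma>1 $ i - \<gamma>2 $ i\<bar>) = (\<Sum>i\<in>UNIV. \<bar>\<gamma>2 $ i - \<gamma>1 $ i\<bar>)"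
    by (simp add: abs_minus_commute)
  then show ?thesis
    using Dval_lipschitz_upper[OF assms, of s] Dval_lipschitz_upper[OF assms(1,3,2), of s]
    by (simp add: abs_le_iff)
qed

lemma Dval_upper: "x \<in> X \<Longrightarrow> \<gamma> \<in> nonneg \<Longrightarrow> Dval \<gamma> x s \<le> (1 + (\<Sum>i\<in>UNIV. \<gamma> $ i)) * Lc"
  using D_upper[of x \<gamma> s] by (metis ereal_Dval ereal_less_eq(3))

lemma Dval_lower:
  "x \<in> X \<Longrightarrow> \<gamma> \<in> nonneg \<Longrightarrow> feasible A p \<zeta> \<pi> \<beta> g gbar x s a \<Longrightarrow>
    cnt x a r [s] + (\<Sum>i\<in>UNIV. \<gamma> $ i * cnt x a (g i) [s]) \<le> Dval \<gamma> x s"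
  using D_lower[of x s a \<gamma>] by (metis ereal_Dval ereal_less_eq(3))

lemma Dval_abs:
  assumes "x \<in> X" "\<gamma> \<in> nonneg"
  shows "\<bar>Dval \<gamma> x s\<bar> \<le> (1 + (\<Sum>i\<in>UNIV. \<gamma> $ i)) * Lc"
proof -
  obtain a where f: "feasible A p \<zeta> \<pi> \<beta> g gbar x s a"
    using feas_ex[OF assms(1)] by blast
  then have a: "a \<in> plans x"
    by (simp add: feasible_def)
  have "- ((1 + (\<Sum>i\<in>UNIV. \<gamma> $ i)) * Lc) \<le> Lag a (\<lambda>_. 0) \<gamma> x s"
    using Lag_bound[OF zero_Mult assms(1) a assms(2), of s] by (simp add: lam_mass_def abs_le_iff)
  also have "\<dots> = cnt x a r [s] + (\<Sum>i\<in>UNIV. \<gamma> $ i * cnt x a (g i) [s])"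
    unfolding Lag_eq[OF zero_Mult assms(1) a] by (simp add: penalty_def cE_const)
  also have "\<dots> \<le> Dval \<gamma> x s"
    by (rule Dval_lower[OF assms f])
  finally show ?thesis
    using Dval_upper[OF assms, of s] by (simp add: abs_le_iff)
qed

lemma Linf_Dval:
  fixes k :: real
  assumes "x \<in> X" "0 \<le> k"
  shows "Linf k (\<lambda>\<gamma>. Dval \<gamma> x s) \<le> ereal ((1 + CARD('i) * k) * Lc)"
proof (rule Linf_le)
  show "continuous_on (Bk k) (\<lambda>\<gamma>. Dval \<gamma> x s)"
  proof (rule continuous_on_subset[OF _ Bk_nonneg])
    have "(CARD('i) * Lc)-lipschitz_on nonneg (\<lambda>\<gamma>. Dval \<gamma> x s)"
    proof (rule lipschitz_onI)
      fix \<gamma>1 \<gamma>2 :: "real^'i" assume \<gamma>: "\<gamma>1 \<in> nonneg" "\<gamma>2 \<in> nonneg"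
      have "(\<Sum>i\<in>UNIV. \<bar>\<gamma>1 $ i - \<gamma>2 $ i\<bar>) \<le> (\<Sum>i\<in>(UNIV::'i set). dist \<gamma>1 \<gamma>2)"
        by (intro sum_mono) (metis component_le_norm_cart dist_norm vector_minus_component)
      then have "Lc * (\<Sum>i\<in>UNIV. \<bar>\<gamma>1 $ i - \<gamma>2 $ i\<bar>) \<le> Lc * (CARD('i) * dist \<gamma>1 \<gamma>2)"
        using supnorm_le_Lc(3)[OF assms(1)] by (intro mult_left_mono) auto
      then show "dist (Dval \<gamma>1 x s) (Dval \<gamma>2 x s) \<le> CARD('i) * Lc * dist \<gamma>1 \<gamma>2"
        using Dval_lipschitz[OF assms(1) \<gamma>, of s] by (simp add: dist_real_def ac_simps)
    qed (use supnorm_le_Lc(3)[OF assms(1)] in auto)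
    then show "continuous_on nonneg (\<lambda>\<gamma>. Dval \<gamma> x s)"
      by (rule lipschitz_on_continuous_on)
  qed
  fix \<gamma> :: "real^'i" assume \<gamma>: "\<gamma> \<in> Bk k"
  have "(\<Sum>i\<in>UNIV. \<gamma> $ i) \<le> (\<Sum>i\<in>(UNIV::'i set). k)"
    using \<gamma> by (intro sum_mono) (auto simp: Bk_def)
  then have "(1 + (\<Sum>i\<in>UNIV. \<gamma> $ i)) * Lc \<le> (1 + CARD('i) * k) * Lc"
    using supnorm_le_Lc(3)[OF assms(1)] by (intro mult_right_mono) auto
  then show "\<bar>Dval \<gamma> x s\<bar> \<le> (1 + CARD('i) * k) * Lc"
    using Dval_abs[OF assms(1), of \<gamma> s] \<gamma> Bk_nonneg by fastforce
qed

text \<open>The norm on \<open>Bk k\<close> grows at most linearly in \<open>k\<close>, uniformly in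
  state and shock, and the geometric weights absorb linear growth.\<close>

lemma Dval_inM: "inM X Dval"
  unfolding inM_def
proof (intro conjI ballI allI impI)
  fix x s and k :: nat assume "x \<in> X"
  then show "Linf (real k) (\<lambda>\<gamma>. Dval \<gamma> x s) < \<infinity>"
    using le_less_trans[OF Linf_Dval[of x "real k" s], of \<infinity>] by simp
next
  \<comment> \<open>Nonnegativity of \<open>Lc\<close> is known only when \<open>X\<close> has a
    point, hence the maximum with 0.\<close>
  define c where "c k = (1 + CARD('i) * real (Suc k)) * max 0 Lc" for k
  have c0: "0 \<le> c k" for k
    by (simp add: c_def)
  have Linf: "e2ennreal (Linf (real (Suc k)) (\<lambda>\<gamma>. Dval \<gamma> (from_nat_into X j) s)) \<le> ennreal (c k)" for j k s
  proof (cases "X = {}")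
    case True
    then have "Dval \<gamma> (from_nat_into X j) s = 0" for \<gamma>
      unfolding Dval_def by simp
    then have "Linf (real (Suc k)) (\<lambda>\<gamma>. Dval \<gamma> (from_nat_into X j) s) \<le> ereal 0"
      by (intro Linf_le) auto
    then have "e2ennreal (Linf (real (Suc k)) (\<lambda>\<gamma>. Dval \<gamma> (from_nat_into X j) s)) \<le> e2ennreal (ereal 0)"
      by (rule e2ennreal_mono)
    then show ?thesis
      by (simp add: e2ennreal_ereal)
  next
    case False
    have "Linf (real (Suc k)) (\<lambda>\<gamma>. Dval \<gamma> (from_nat_into X j) s)
        \<le> ereal ((1 + CARD('i) * real (Suc k)) * Lc)"
      by (rule Linf_Dval[OF from_nat_into[OF False]]) simp
    also have "\<dots> \<le> ereal (c k)"
      unfolding c_def by (simp del: of_nat_Suc) (intro mult_left_mono; simp)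
    finally have "e2ennreal (Linf (real (Suc k)) (\<lambda>\<gamma>. Dval \<gamma> (from_nat_into X j) s)) \<le> e2ennreal (ereal (c k))"
      by (rule e2ennreal_mono)
    then show ?thesis
      by (simp add: e2ennreal_ereal)
  qed
  have sk: "summable (\<lambda>k. (1/2) ^ Suc k * c k)"
  proof -
    have "summable (\<lambda>k. max 0 Lc * (1/2) * ((1/2::real) ^ k)
        + max 0 Lc * CARD('i) * (1/2) * (real (Suc k) * (1/2) ^ k))"
    proof (intro summable_add summable_mult)
      show "summable (\<lambda>k. (1/2::real) ^ k)"
        by (rule summable_geometric) simp
      show "summable (\<lambda>k. real (Suc k) * (1/2::real) ^ k)"
        using geometric_deriv_sums[of "1/2::real"] by (simp add: sums_iff)
    qed
    then show ?thesis
      by (simp add: c_def algebra_simps)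
  qed
  define K where "K = (\<Sum>k. (1/2) ^ Suc k * c k)"
  have K: "(\<Sum>k. ennreal ((1/2) ^ Suc k * c k)) = ennreal K"
    unfolding K_def by (rule suminf_ennreal2[OF _ sk]) (simp add: c0)
  have K0: "0 \<le> K"
    unfolding K_def by (rule suminf_nonneg[OF sk]) (simp add: c0)
  have "(\<Sum>k. ennreal ((1/2) ^ Suc j * (1/2) ^ Suc k)
         * e2ennreal (Linf (real (Suc k)) (\<lambda>\<gamma>. Dval \<gamma> (from_nat_into X j) s))) \<le> ennreal ((1/2) ^ Suc j * K)" for j s
  proof -
    have "(\<Sum>k. ennreal ((1/2) ^ Suc j * (1/2) ^ Suc k)
         * e2ennreal (Linf (real (Suc k)) (\<lambda>\<gamma>. Dval \<gamma> (from_nat_into X j) s)))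
       \<le> (\<Sum>k. ennreal ((1/2) ^ Suc j) * ennreal ((1/2) ^ Suc k * c k))"
      by (intro suminf_le summableI) (use Linf[of _ j s] c0 in
          \<open>auto simp: ennreal_mult mult.assoc simp del: power_Suc of_nat_Suc intro!: mult_left_mono\<close>)
    also have "\<dots> = ennreal ((1/2) ^ Suc j * K)"
      using K0 by (simp add: ennreal_suminf_cmult K ennreal_mult del: power_Suc)
    finally show ?thesis .
  qed
  then have "(\<Sum>s\<in>(UNIV::'s set). \<Sum>j. \<Sum>k. ennreal ((1/2) ^ Suc j * (1/2) ^ Suc k)
         * e2ennreal (Linf (real (Suc k)) (\<lambda>\<gamma>. Dval \<gamma> (from_nat_into X j) s)))
      \<le> (\<Sum>s\<in>(UNIV::'s set). \<Sum>j. ennreal ((1/2) ^ Suc j * K))"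
    by (intro sum_mono suminf_le summableI)
  also have "\<dots> = (\<Sum>s\<in>(UNIV::'s set). ennreal (\<Sum>j. (1/2) ^ Suc j * K))"
    using K0 by (intro sum.cong refl suminf_ennreal2)
      (auto intro!: summable_mult2 simp: summable_Suc_iff[of "\<lambda>j. (1/2::real) ^ j"] simp del: power_Suc)
  also have "\<dots> < \<top>"
    by (simp add: ennreal_mult_less_top of_nat_less_top)
  finally show "(\<Sum>s\<in>(UNIV::'s set). \<Sum>j. \<Sum>k. ennreal ((1/2) ^ Suc j * (1/2) ^ Suc k)
         * e2ennreal (Linf (real (Suc k)) (\<lambda>\<gamma>. Dval \<gamma> (from_nat_into X j) s))) < \<top>" .
qed

lemma Dval_inN: "inN X A p \<beta> \<pi> \<zeta> r g gbar Dval"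
  unfolding inN_def
  using Dval_inM Dval_convex Dval_lipschitz Dval_lower Dval_upper by blast

end

section \<open>The functional equation\<close>

lemma tail_suminf_tendsto_0:
  fixes w :: "nat \<Rightarrow> real"
  assumes "summable w"
  shows "(\<lambda>T. \<Sum>t. w (t + T)) \<longlonglongrightarrow> 0"
proof -
  have "(\<lambda>T. suminf w - (\<Sum>t<T. w t)) \<longlonglongrightarrow> suminf w - suminf w"
    by (intro tendsto_intros summable_LIMSEQ assms)
  then show ?thesis
    using suminf_minus_initial_segment[OF assms] by simp
qed

text \<open>Up to a shift this is the general term of the Cauchy product of the series of
  \<open>\<beta> ^ t * m t\<close> with the geometric series. The product is summable, so its terms
  tend to 0.\<close>

lemma discounted_partial_sums_tendsto_0:
  fixes m :: "nat \<Rightarrow> real"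
  assumes \<beta>: "0 < \<beta>" "\<beta> < 1" and sm: "summable (\<lambda>t. \<beta> ^ t * m t)" and nn: "\<And>t. 0 \<le> m t"
  shows "(\<lambda>T. \<beta> ^ T * (\<Sum>t<T. m t)) \<longlonglongrightarrow> 0"
proof -
  have "summable (\<lambda>T. \<Sum>t\<le>T. (\<beta> ^ t * m t) * \<beta> ^ (T - t))"
    by (rule summable_Cauchy_product) (use assms in \<open>auto simp: abs_mult summable_geometric\<close>)
  moreover have "(\<Sum>t\<le>T. (\<beta> ^ t * m t) * \<beta> ^ (T - t)) = \<beta> ^ T * (\<Sum>t<Suc T. m t)" for T
  proof -
    have "(\<beta> ^ t * m t) * \<beta> ^ (T - t) = \<beta> ^ T * m t" if "t \<le> T" for t
      using that by (simp add: power_add[symmetric] mult.commute mult.left_commute)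
    then show ?thesis
      unfolding sum_distrib_left lessThan_Suc_atMost by (intro sum.cong) auto
  qed
  ultimately have "(\<lambda>T. \<beta> ^ T * (\<Sum>t<Suc T. m t)) \<longlonglongrightarrow> 0"
    by (simp only: summable_LIMSEQ_zero)
  then have "(\<lambda>T. \<beta> * (\<beta> ^ T * (\<Sum>t<Suc T. m t))) \<longlonglongrightarrow> 0"
    by (rule tendsto_mult_right_zero)
  then have "(\<lambda>T. \<beta> ^ Suc T * (\<Sum>t<Suc T. m t)) \<longlonglongrightarrow> 0"
    by (simp add: mult.assoc del: sum.lessThan_Suc)
  then show ?thesis
    by (rule LIMSEQ_imp_Suc)
qed

text \<open>After next shock \<open>s\<close> only multipliers at histories starting with
  \<open>s\<close> matter, so the minimiser can choose them separately for every next shock.\<close>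

lemma Ltil_mult_agree:
  assumes "\<And>k. k \<noteq> [] \<Longrightarrow> fst (hd k) = s \<Longrightarrow> lam k = lam' k"
  shows "Ltil \<beta> \<pi> \<zeta> r g gbar a lam \<gamma> x s = Ltil \<beta> \<pi> \<zeta> r g gbar a lam' \<gamma> x s"
proof -
  have "lam (htil a ([s] @ e)) = lam' (htil a ([s] @ e))" for e
    by (rule assms) (auto simp: htil_Cons)
  then show ?thesis
    unfolding Ltil_def by (intro suminf_cong arg_cong2[where f = "(*)"] refl condE_cong) simp
qed

context lottery_model
begin

abbreviation bracket :: "(real ^ 'i \<Rightarrow> 'x \<Rightarrow> 's \<Rightarrow> real) \<Rightarrow> real ^ 'i \<Rightarrow> 'x \<Rightarrow> 's \<Rightarrow> 'a \<Rightarrow> real ^ 'i \<Rightarrow> real" where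
  "bracket F \<gamma> x s b lam \<equiv> r x b s + (\<Sum>i\<in>UNIV. \<gamma> $ i * g i x b s + lam $ i * (g i x b s - gbar i))
     + \<beta> * (\<Sum>s'\<in>UNIV. \<pi> s s' * F (\<gamma> + lam) (\<zeta> x b s) s')"

lemma adm_in_A: "b \<in> Atil A p x s \<Longrightarrow> b \<in> A"
  by (simp add: Atil_def)

lemma expect_add_const: "(\<Sum>s'\<in>UNIV. \<pi> s s' * (f s' + e)) = (\<Sum>s'\<in>UNIV. \<pi> s s' * f s') + e"
  using pi_sum[of s] by (simp add: distrib_left sum.distrib sum_distrib_right[symmetric])

text \<open>Plays \<open>b\<close> after \<open>s\<close> and then a continuation of its own for
  every next shock. A plan must also act after first shocks other than \<open>s\<close>; there an
  arbitrary plan \<open>a0\<close> is used.\<close>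

lemma combine_plan:
  assumes x: "x \<in> X" and b: "b \<in> Atil A p x s" and lam: "lam \<in> Mult"
    and c: "\<And>s'. c s' \<in> plans (\<zeta> x b s)"
  obtains a where "a \<in> plans x"
    "Lag a lam \<gamma> x s = r x b s + (\<Sum>i\<in>UNIV. \<gamma> $ i * g i x b s + lam [(s, b)] $ i * (g i x b s - gbar i))
       + \<beta> * (\<Sum>s'\<in>UNIV. \<pi> s s' * Lag (c s') (\<lambda>k. lam ((s, b) # k)) (\<gamma> + lam [(s, b)]) (\<zeta> x b s) s')"
proof -
  obtain a0 where a0: "a0 \<in> plans x"
    using plan_ex[OF x] by blast
  define B where "B s' = (if s' = s then b else a0 [s'])" for s'
  define C where "C s' = (if s' = s then splice_plan c else shift_plan a0 s')" for s'
  define a where "a = cons_plan B C"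
  have C: "C s' \<in> plans (\<zeta> x (B s') s')" for s'
    using splice_plan_Ainf[OF c] shift_plan_Ainf[OF a0] by (simp add: B_def C_def)
  have a: "a \<in> plans x"
    unfolding a_def by (rule cons_plan_Ainf[OF _ C]) (use b plan_head[OF a0] in \<open>simp add: B_def\<close>)
  have sh: "shift_plan a s = splice_plan c"
    unfolding a_def using shift_cons_plan[of C s B] by (simp add: C_def splice_plan_def)
  have as: "a [s] = b"
    by (simp add: a_def B_def)
  have "Lag (splice_plan c) (\<lambda>k. lam ((s, b) # k)) \<gamma>' x' s' = Lag (c s') (\<lambda>k. lam ((s, b) # k)) \<gamma>' x' s'" for \<gamma>' x' s'
    by (rule Ltil_agree) (simp add: splice_plan_def)
  then show thesis
    using that[OF a] Lag_rec[OF lam x a, of \<gamma> s] unfolding as sh by simp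
qed

text \<open>The minimiser moves after seeing the action: it answers \<open>b\<close> with
  \<open>mu b\<close>, and since later histories reveal the next shock it can use a separate
  near-optimal family for each \<open>s'\<close>. All of these are glued into one element of
  \<open>Mult\<close>, at a loss of at most \<open>e\<close>.\<close>

lemma Dval_le_step:
  assumes x: "x \<in> X" and \<gamma>: "\<gamma> \<in> nonneg"
    and y: "\<And>b. b \<in> Atil A p x s \<Longrightarrow> \<exists>lam\<in>nonneg. bracket Dval \<gamma> x s b lam \<le> y"
  shows "Dval \<gamma> x s \<le> y"
proof (rule field_le_epsilon)
  fix e :: real assume e: "0 < e"
  have "\<forall>b. \<exists>l. b \<in> Atil A p x s \<longrightarrow> l \<in> nonneg \<and> bracket Dval \<gamma> x s b l \<le> y"
    using y by blast
  from choice[OF this] obtain mu where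
    mu: "\<And>b. b \<in> Atil A p x s \<Longrightarrow> mu b \<in> nonneg \<and> bracket Dval \<gamma> x s b (mu b) \<le> y"
    by blast
  have "\<exists>lam\<in>Mult. \<forall>a\<in>plans (\<zeta> x b s). Lag a lam (\<gamma> + mu b) (\<zeta> x b s) s' < Dval (\<gamma> + mu b) (\<zeta> x b s) s' + e"
    if "b \<in> Atil A p x s" for b s'
  proof -
    have "\<zeta> x b s \<in> X" "\<gamma> + mu b \<in> nonneg"
      using zeta_X[OF x adm_in_A[OF that]] nonneg_add[OF \<gamma>] mu[OF that] by auto
    then obtain lam where "lam \<in> Mult" "\<And>a. a \<in> plans (\<zeta> x b s) \<Longrightarrow>
        Lag a lam (\<gamma> + mu b) (\<zeta> x b s) s' < Dval (\<gamma> + mu b) (\<zeta> x b s) s' + e"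
      using Dval_less_mult[of "\<zeta> x b s" "\<gamma> + mu b" s' "Dval (\<gamma> + mu b) (\<zeta> x b s) s' + e"] e by auto
    then show ?thesis
      by blast
  qed
  then obtain lb where lb: "\<And>b s'. b \<in> Atil A p x s \<Longrightarrow> lb b s' \<in> Mult"
    "\<And>b s' a. b \<in> Atil A p x s \<Longrightarrow> a \<in> plans (\<zeta> x b s) \<Longrightarrow>
       Lag a (lb b s') (\<gamma> + mu b) (\<zeta> x b s) s' < Dval (\<gamma> + mu b) (\<zeta> x b s) s' + e"
    by metis
  \<comment> \<open>The first shock is ignored, since only histories starting with \<open>s\<close>
    reach the Lagrangian at \<open>s\<close>. For an action outside \<open>Atil A p x s\<close>
    nothing is known of \<open>mu\<close> and \<open>lb\<close>, so the default 0 keeps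
    \<open>lam\<close> in \<open>Mult\<close>.\<close>
  define lam where "lam k = (case k of [] \<Rightarrow> 0 | (s0, b) # k' \<Rightarrow>
      if b \<notin> Atil A p x s then 0 else if k' = [] then mu b else lb b (fst (hd k')) k')" for k
  have nn: "nonneg_mult A lam"
    unfolding nonneg_mult_def
  proof (intro allI impI)
    fix k :: "('s \<times> 'a) list" and i assume "k \<noteq> []" "snd ` set k \<subseteq> A"
    then obtain s0 b k' where k: "k = (s0, b) # k'" "snd ` set k' \<subseteq> A"
      by (cases k) auto
    have "0 \<le> mu b $ i" if "b \<in> Atil A p x s"
      using mu[OF that] by (simp add: nonneg_def)
    moreover have "0 \<le> lb b s' k' $ i" if "b \<in> Atil A p x s" "k' \<noteq> []" for s'
      using lb(1)[OF that(1), of s'] that(2) k(2) unfolding Mult_iff nonneg_mult_def by auto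
    ultimately show "0 \<le> lam k $ i"
      by (simp add: lam_def k(1))
  qed
  have "mass (\<lambda>k. lam ((s0, b) # k)) t s' = (if b \<in> Atil A p x s then mass (lb b s') t s' else 0)" for s0 b t s'
    by (simp add: lam_mass_def lam_def)
  then have "mass lam (Suc t) s0
      = (\<Sum>b\<in>A. \<Sum>s'\<in>UNIV. \<pi> s0 s' * (if b \<in> Atil A p x s then mass (lb b s') t s' else 0))" for t s0
    unfolding mass_Suc by simp
  then have "\<beta> ^ Suc t * mass lam (Suc t) s0 = (\<Sum>b\<in>A. \<Sum>s'\<in>UNIV.
      (if b \<in> Atil A p x s then \<beta> * \<pi> s0 s' * (\<beta> ^ t * mass (lb b s') t s') else 0))" for t s0
    by (simp add: sum_distrib_left if_distrib ac_simps cong: if_cong)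
  moreover have "summable (\<lambda>t. \<Sum>b\<in>A. \<Sum>s'\<in>UNIV.
      (if b \<in> Atil A p x s then \<beta> * \<pi> s0 s' * (\<beta> ^ t * mass (lb b s') t s') else 0))" for s0
  proof (intro summable_sum)
    fix b s'
    show "summable (\<lambda>t. if b \<in> Atil A p x s then \<beta> * \<pi> s0 s' * (\<beta> ^ t * mass (lb b s') t s') else 0)"
      using lb(1)[of b s'] unfolding Mult_iff by (cases "b \<in> Atil A p x s") (auto intro!: summable_mult)
  qed
  ultimately have "summable (\<lambda>t. \<beta> ^ Suc t * mass lam (Suc t) s0)" for s0
    by simp
  then have lam: "lam \<in> Mult"
    unfolding Mult_iff using nn summable_Suc_iff[of "\<lambda>t. \<beta> ^ t * mass lam t _"] by blast
  show "Dval \<gamma> x s \<le> y + e"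
  proof (rule Dval_le[OF x \<gamma> lam])
    fix a assume a: "a \<in> plans x"
    let ?b = "a [s]"
    have b: "?b \<in> Atil A p x s"
      by (rule plan_head[OF a])
    have l0: "lam [(s, ?b)] = mu ?b"
      using b by (simp add: lam_def)
    have "Lag (shift_plan a s) (\<lambda>k. lam ((s, ?b) # k)) (\<gamma> + mu ?b) (\<zeta> x ?b s) s'
        \<le> Dval (\<gamma> + mu ?b) (\<zeta> x ?b s) s' + e" for s'
    proof -
      have "Lag (shift_plan a s) (\<lambda>k. lam ((s, ?b) # k)) (\<gamma> + mu ?b) (\<zeta> x ?b s) s'
          = Lag (shift_plan a s) (lb ?b s') (\<gamma> + mu ?b) (\<zeta> x ?b s) s'"
        by (rule Ltil_mult_agree) (use b in \<open>simp add: lam_def\<close>)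
      then show ?thesis
        using lb(2)[OF b shift_plan_Ainf[OF a], of s'] by simp
    qed
    then have "(\<Sum>s'\<in>UNIV. \<pi> s s' * Lag (shift_plan a s) (\<lambda>k. lam ((s, ?b) # k)) (\<gamma> + mu ?b) (\<zeta> x ?b s) s')
        \<le> (\<Sum>s'\<in>UNIV. \<pi> s s' * Dval (\<gamma> + mu ?b) (\<zeta> x ?b s) s') + e"
      unfolding expect_add_const[symmetric] using pi_pos by (intro sum_mono mult_left_mono) (auto simp: less_imp_le)
    then have "\<beta> * (\<Sum>s'\<in>UNIV. \<pi> s s' * Lag (shift_plan a s) (\<lambda>k. lam ((s, ?b) # k)) (\<gamma> + mu ?b) (\<zeta> x ?b s) s')
        \<le> \<beta> * ((\<Sum>s'\<in>UNIV. \<pi> s s' * Dval (\<gamma> + mu ?b) (\<zeta> x ?b s) s') + e)"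
      using beta by (intro mult_left_mono) auto
    then have "Lag a lam \<gamma> x s \<le> bracket Dval \<gamma> x s ?b (mu ?b) + \<beta> * e"
      unfolding Lag_rec[OF lam x a] l0 by (simp add: distrib_left)
    also have "\<dots> \<le> y + e"
      using mu[OF b] beta e by (intro add_mono) (auto simp: mult_le_cancel_right1)
    finally show "Lag a lam \<gamma> x s \<le> y + e" .
  qed
qed

text \<open>The maximiser commits to \<open>b\<close> and then faces an arbitrary
  \<open>lam\<close>. Near-optimal continuation plans, one for each next shock, are glued together,
  and \<open>lam [(s, b)]\<close> is one of the multipliers against which \<open>y\<close> is a
  lower bound.\<close>

lemma Dval_ge_step:
  assumes x: "x \<in> X" and \<gamma>: "\<gamma> \<in> nonneg" and b: "b \<in> Atil A p x s"
    and y: "\<And>lam. lam \<in> nonneg \<Longrightarrow> y \<le> bracket Dval \<gamma> x s b lam"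
  shows "y \<le> Dval \<gamma> x s"
proof (rule field_le_epsilon)
  fix e :: real assume e: "0 < e"
  have "y - e \<le> Dval \<gamma> x s"
  proof (rule Dval_ge[OF x \<gamma>])
    fix lam assume lam: "lam \<in> Mult"
    let ?l = "\<lambda>k. lam ((s, b) # k)" and ?x = "\<zeta> x b s" and ?mu = "lam [(s, b)]"
    have x': "?x \<in> X"
      using zeta_X[OF x adm_in_A[OF b]] .
    have mu: "?mu \<in> nonneg"
      using lam adm_in_A[OF b] unfolding Mult_iff nonneg_mult_def nonneg_def by auto
    have "\<exists>c\<in>plans ?x. Dval (\<gamma> + ?mu) ?x s' - e < Lag c ?l (\<gamma> + ?mu) ?x s'" for s'
      using less_Dval_plan[OF x' nonneg_add[OF \<gamma> mu], of "Dval (\<gamma> + ?mu) ?x s' - e" s' ?l]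
        Mult_shift[OF lam adm_in_A[OF b]] e by auto
    then obtain c where c: "\<And>s'. c s' \<in> plans ?x"
      "\<And>s'. Dval (\<gamma> + ?mu) ?x s' \<le> Lag (c s') ?l (\<gamma> + ?mu) ?x s' + e"
      by (metis diff_less_eq less_imp_le)
    obtain a where a: "a \<in> plans x" and La: "Lag a lam \<gamma> x s
        = r x b s + (\<Sum>i\<in>UNIV. \<gamma> $ i * g i x b s + ?mu $ i * (g i x b s - gbar i))
          + \<beta> * (\<Sum>s'\<in>UNIV. \<pi> s s' * Lag (c s') ?l (\<gamma> + ?mu) ?x s')"
      by (rule combine_plan[where c = c, OF x b lam c(1)])
    have "(\<Sum>s'\<in>UNIV. \<pi> s s' * Dval (\<gamma> + ?mu) ?x s') \<le> (\<Sum>s'\<in>UNIV. \<pi> s s' * Lag (c s') ?l (\<gamma> + ?mu) ?x s') + e"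
      unfolding expect_add_const[symmetric] using pi_pos c(2)
      by (intro sum_mono mult_left_mono) (auto simp: less_imp_le)
    then have "\<beta> * (\<Sum>s'\<in>UNIV. \<pi> s s' * Dval (\<gamma> + ?mu) ?x s')
        \<le> \<beta> * ((\<Sum>s'\<in>UNIV. \<pi> s s' * Lag (c s') ?l (\<gamma> + ?mu) ?x s') + e)"
      using beta by (intro mult_left_mono) auto
    then have "bracket Dval \<gamma> x s b ?mu \<le> Lag a lam \<gamma> x s + \<beta> * e"
      unfolding La by (simp add: distrib_left)
    moreover have "\<beta> * e \<le> e"
      using beta e by simp
    ultimately have "y - e \<le> Lag a lam \<gamma> x s"
      using y[OF mu] by linarith
    with a show "\<exists>a\<in>plans x. y - e \<le> Lag a lam \<gamma> x s"
      by blast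
  qed
  then show "y \<le> Dval \<gamma> x s + e"
    by simp
qed

text \<open>The inner infimum need not be attained and may be infinite, so both inequalities are
  tested against a real level strictly between the two sides.\<close>

lemma Dval_Bellman: "Bellman X A p \<beta> \<pi> \<zeta> r g gbar Dval"
  unfolding Bellman_def
proof (intro ballI allI antisym)
  fix \<gamma> :: "real^'i" and x s assume \<gamma>: "\<gamma> \<in> nonneg" and x: "x \<in> X"
  let ?T = "SUP b\<in>Atil A p x s. INF lam\<in>nonneg. ereal (bracket Dval \<gamma> x s b lam)"
  show "ereal (Dval \<gamma> x s) \<le> ?T"
  proof (rule ccontr)
    assume "\<not> ereal (Dval \<gamma> x s) \<le> ?T"
    then obtain y where y: "?T < ereal y" "ereal y < ereal (Dval \<gamma> x s)"
      using ereal_dense2[of ?T "ereal (Dval \<gamma> x s)"] by (auto simp: not_le)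
    have "\<exists>lam\<in>nonneg. bracket Dval \<gamma> x s b lam \<le> y" if "b \<in> Atil A p x s" for b
    proof -
      have "(INF lam\<in>nonneg. ereal (bracket Dval \<gamma> x s b lam)) < ereal y"
        using le_less_trans[OF SUP_upper[OF that] y(1)] .
      then show ?thesis
        unfolding INF_less_iff by (auto intro: less_imp_le)
    qed
    then have "Dval \<gamma> x s \<le> y"
      by (rule Dval_le_step[OF x \<gamma>])
    with y(2) show False
      by simp
  qed
  show "?T \<le> ereal (Dval \<gamma> x s)"
  proof (rule SUP_least, rule ccontr)
    fix b assume b: "b \<in> Atil A p x s"
    let ?I = "INF lam\<in>nonneg. ereal (bracket Dval \<gamma> x s b lam)"
    assume "\<not> ?I \<le> ereal (Dval \<gamma> x s)"
    then obtain y where y: "ereal (Dval \<gamma> x s) < ereal y" "ereal y < ?I"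
      using ereal_dense2[of "ereal (Dval \<gamma> x s)" ?I] by (auto simp: not_le)
    have "y \<le> bracket Dval \<gamma> x s b lam" if "lam \<in> nonneg" for lam
      using less_le_trans[OF y(2) INF_lower[OF that]] by simp
    then have "y \<le> Dval \<gamma> x s"
      by (rule Dval_ge_step[OF x \<gamma> b])
    with y(1) show False
      by simp
  qed
qed

text \<open>Finitely many actions, at least one of them admissible: the outer supremum is attained,
  and a single action is good against all multipliers at once.\<close>

lemma Bellman_action:
  assumes "Bellman X A p \<beta> \<pi> \<zeta> r g gbar G" "x \<in> X" "\<gamma> \<in> nonneg"
  obtains b where "b \<in> Atil A p x s" "\<And>lam. lam \<in> nonneg \<Longrightarrow> G \<gamma> x s \<le> bracket G \<gamma> x s b lam"
proof -
  let ?f = "\<lambda>b. INF lam\<in>nonneg. ereal (bracket G \<gamma> x s b lam)"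
  have fin: "finite (?f ` Atil A p x s)" "?f ` Atil A p x s \<noteq> {}"
    using A_fin adm_ex[OF assms(2), of s] by (auto simp: Atil_def)
  have "ereal (G \<gamma> x s) = Max (?f ` Atil A p x s)"
    using assms fin by (simp add: Bellman_def Max_Sup)
  then obtain b where b: "b \<in> Atil A p x s" "ereal (G \<gamma> x s) = ?f b"
    using Max_in[OF fin] by (metis (no_types, lifting) imageE)
  have "ereal (G \<gamma> x s) \<le> ereal (bracket G \<gamma> x s b lam)" if "lam \<in> nonneg" for lam
    unfolding b(2) by (rule INF_lower[OF that])
  then show thesis
    using that[OF b(1)] by simp
qed

text \<open>Bound on what is lost by playing greedily for \<open>T\<close> periods and arbitrarily afterwards.\<close>

definition err :: "nat \<Rightarrow> (('s \<times> 'a) list \<Rightarrow> real ^ 'i) \<Rightarrow> real ^ 'i \<Rightarrow> 's \<Rightarrow> real" where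
  "err T lam \<gamma> s = \<beta> ^ T * (2 * Lc * (1 + (\<Sum>i\<in>UNIV. \<gamma> $ i) + (\<Sum>t<T. mass lam t s)))
     + Cpen * (\<Sum>t. \<beta> ^ (t + T) * mass lam (t + T) s)"

text \<open>Summability of the discounted mass enters twice: the mass accumulated up to
  \<open>T\<close>, discounted to \<open>T\<close>, vanishes by the Cauchy product argument, and the
  mass still to come is the tail of a convergent series.\<close>

lemma err_tendsto_0:
  assumes "lam \<in> Mult"
  shows "(\<lambda>T. err T lam \<gamma> s) \<longlonglongrightarrow> 0"
proof -
  have nn: "nonneg_mult A lam" and sm: "summable (\<lambda>t. \<beta> ^ t * mass lam t s)"
    using assms unfolding Mult_iff by auto
  have "(\<lambda>T. (2 * Lc * (1 + (\<Sum>i\<in>UNIV. \<gamma> $ i))) * \<beta> ^ T + (2 * Lc) * (\<beta> ^ T * (\<Sum>t<T. mass lam t s))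
      + Cpen * (\<Sum>t. \<beta> ^ (t + T) * mass lam (t + T) s)) \<longlonglongrightarrow>
      (2 * Lc * (1 + (\<Sum>i\<in>UNIV. \<gamma> $ i))) * 0 + (2 * Lc) * 0 + Cpen * 0"
    using beta
    by (intro tendsto_add tendsto_mult tendsto_const LIMSEQ_power_zero
        discounted_partial_sums_tendsto_0[OF beta sm mass_nonneg[OF nn]]
        tail_suminf_tendsto_0[OF sm]) auto
  then show ?thesis
    unfolding err_def by (simp add: algebra_simps)
qed

text \<open>Moving on one period raises the weight by today's multiplier, whose total is at most the
  mass at date 0, and shifts expected masses by one date. The extra term in the accumulated mass of
  \<open>err (Suc T)\<close> absorbs the former.\<close>

lemma err_step:
  assumes "lam \<in> Mult" "b \<in> A" "x \<in> X"
  shows "\<beta> * (\<Sum>s'\<in>UNIV. \<pi> s s' * err T (\<lambda>k. lam ((s, b) # k)) (\<gamma> + lam [(s, b)]) s') \<le> err (Suc T) lam \<gamma> s"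
proof -
  let ?l = "\<lambda>k. lam ((s, b) # k)" and ?mu = "lam [(s, b)]"
  define N where "N t = (\<Sum>s'\<in>UNIV. \<pi> s s' * mass ?l t s')" for t
  have nn: "nonneg_mult A lam" and sm: "summable (\<lambda>t. \<beta> ^ t * mass lam t s)"
    using assms(1) unfolding Mult_iff by auto
  have sml: "summable (\<lambda>t. \<beta> ^ t * mass ?l t s')" for s'
    using Mult_shift[OF assms(1,2), of s] unfolding Mult_iff by auto
  have N: "N t \<le> mass lam (Suc t) s" for t
    unfolding N_def by (rule mass_shift_le[OF nn assms(2)])
  have mu: "(\<Sum>i\<in>UNIV. ?mu $ i) \<le> mass lam 0 s"
    unfolding mass_0 by (rule member_le_sum[where f = "\<lambda>b. \<Sum>i\<in>UNIV. lam [(s, b)] $ i"])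
      (use assms(2) nn A_fin in \<open>auto intro!: sum_nonneg simp: nonneg_mult_def\<close>)
  have tail: "summable (\<lambda>t. \<beta> ^ (t + T) * mass ?l (t + T) s')" for s'
    using summable_ignore_initial_segment[OF sml, of T] .
  have 1: "(\<Sum>s'\<in>UNIV. \<pi> s s' * (\<Sum>t. \<beta> ^ (t + T) * mass ?l (t + T) s')) = (\<Sum>t. \<beta> ^ (t + T) * N (t + T))"
  proof -
    have "(\<Sum>s'\<in>UNIV. \<pi> s s' * (\<Sum>t. \<beta> ^ (t + T) * mass ?l (t + T) s'))
        = (\<Sum>s'\<in>UNIV. \<Sum>t. \<pi> s s' * (\<beta> ^ (t + T) * mass ?l (t + T) s'))"
      by (intro sum.cong refl suminf_mult[symmetric] tail)
    also have "\<dots> = (\<Sum>t. \<Sum>s'\<in>UNIV. \<pi> s s' * (\<beta> ^ (t + T) * mass ?l (t + T) s'))"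
      by (rule suminf_sum[symmetric]) (intro summable_mult tail)
    also have "\<dots> = (\<Sum>t. \<beta> ^ (t + T) * N (t + T))"
      unfolding N_def sum_distrib_left by (simp add: ac_simps)
    finally show ?thesis .
  qed
  have Nsum: "summable (\<lambda>t. \<beta> ^ (t + T) * N (t + T))"
  proof -
    have "summable (\<lambda>t. \<Sum>s'\<in>UNIV. \<pi> s s' * (\<beta> ^ (t + T) * mass ?l (t + T) s'))"
      by (intro summable_sum summable_mult tail)
    then show ?thesis
      unfolding N_def sum_distrib_left by (simp add: ac_simps)
  qed
  have 2: "\<beta> * (\<Sum>t. \<beta> ^ (t + T) * N (t + T)) \<le> (\<Sum>t. \<beta> ^ (t + Suc T) * mass lam (t + Suc T) s)"
  proof -
    have "\<beta> * (\<Sum>t. \<beta> ^ (t + T) * N (t + T)) = (\<Sum>t. \<beta> * (\<beta> ^ (t + T) * N (t + T)))"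
      by (rule suminf_mult[symmetric, OF Nsum])
    also have "\<dots> \<le> (\<Sum>t. \<beta> ^ (t + Suc T) * mass lam (t + Suc T) s)"
    proof (rule suminf_le)
      fix t
      show "\<beta> * (\<beta> ^ (t + T) * N (t + T)) \<le> \<beta> ^ (t + Suc T) * mass lam (t + Suc T) s"
        using mult_left_mono[OF N[of "t + T"], of "\<beta> ^ Suc (t + T)"] beta by (simp add: mult.assoc)
    qed (use summable_mult[OF Nsum] summable_ignore_initial_segment[OF sm, of "Suc T"] in auto)
    finally show ?thesis .
  qed
  have 3: "(\<Sum>i\<in>UNIV. \<gamma> $ i + ?mu $ i) + (\<Sum>t<T. N t) \<le> (\<Sum>i\<in>UNIV. \<gamma> $ i) + (\<Sum>t<Suc T. mass lam t s)"
  proof -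
    have "(\<Sum>t<T. N t) \<le> (\<Sum>t<T. mass lam (Suc t) s)"
      by (intro sum_mono N)
    then show ?thesis
      using mu by (simp add: sum.distrib sum.lessThan_Suc_shift del: sum.lessThan_Suc)
  qed
  have "(\<Sum>s'\<in>UNIV. \<pi> s s' * err T ?l (\<gamma> + ?mu) s')
     = \<beta> ^ T * (2 * Lc * (1 + (\<Sum>i\<in>UNIV. \<gamma> $ i + ?mu $ i) + (\<Sum>t<T. N t)))
       + Cpen * (\<Sum>t. \<beta> ^ (t + T) * N (t + T))"
  proof -
    have sw: "(\<Sum>t<T. N t) = (\<Sum>s'\<in>UNIV. \<pi> s s' * (\<Sum>t<T. mass ?l t s'))"
      unfolding N_def sum_distrib_left by (rule sum.swap)
    have dist: "\<pi> s s' * err T ?l (\<gamma> + ?mu) s'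
      = \<pi> s s' * (\<beta> ^ T * (2 * Lc * (1 + (\<Sum>i\<in>UNIV. \<gamma> $ i + ?mu $ i))))
      + \<beta> ^ T * (2 * Lc) * (\<pi> s s' * (\<Sum>t<T. mass ?l t s'))
      + Cpen * (\<pi> s s' * (\<Sum>t. \<beta> ^ (t + T) * mass ?l (t + T) s'))" for s'
      unfolding err_def by (simp add: algebra_simps)
    show ?thesis
      unfolding dist sum.distrib sum_distrib_left[symmetric] sum_distrib_right[symmetric] pi_sum sw[symmetric] 1
      by (simp add: distrib_left)
  qed
  then have "\<beta> * (\<Sum>s'\<in>UNIV. \<pi> s s' * err T ?l (\<gamma> + ?mu) s')
     = \<beta> ^ Suc T * (2 * Lc * (1 + ((\<Sum>i\<in>UNIV. \<gamma> $ i + ?mu $ i) + (\<Sum>t<T. N t))))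
       + Cpen * (\<beta> * (\<Sum>t. \<beta> ^ (t + T) * N (t + T)))"
    by (simp add: distrib_left mult.assoc mult.left_commute add.assoc)
  also have "\<dots> \<le> \<beta> ^ Suc T * (2 * Lc * (1 + ((\<Sum>i\<in>UNIV. \<gamma> $ i) + (\<Sum>t<Suc T. mass lam t s))))
       + Cpen * (\<Sum>t. \<beta> ^ (t + Suc T) * mass lam (t + Suc T) s)"
    using beta supnorm_le_Lc(3)[OF assms(3)] Cpen_nonneg[OF assms(3)]
    by (intro add_mono mult_left_mono 2 3 order_refl) auto
  finally show ?thesis
    unfolding err_def by (simp add: add.assoc)
qed

text \<open>Induction on the number \<open>T\<close> of greedy periods. The greedy action is good
  against every current multiplier, so it does no harm that \<open>lam [(s, b)]\<close> depends on
  the action taken.\<close>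

lemma Bellman_le_Lag:
  assumes G: "Bellman X A p \<beta> \<pi> \<zeta> r g gbar G"
    and Gu: "\<And>\<gamma> x s. x \<in> X \<Longrightarrow> \<gamma> \<in> nonneg \<Longrightarrow> G \<gamma> x s \<le> (1 + (\<Sum>i\<in>UNIV. \<gamma> $ i)) * Lc"
    and "x \<in> X" "\<gamma> \<in> nonneg" "lam \<in> Mult"
  shows "\<exists>a\<in>plans x. G \<gamma> x s \<le> Lag a lam \<gamma> x s + err T lam \<gamma> s"
  using assms(3-)
proof (induction T arbitrary: x \<gamma> lam s)
  case 0
  \<comment> \<open>With no greedy period left any plan will do. Up to the penalty, its Lagrangian
    is at least the negative of the upper bound on \<open>G\<close>, whence the factor 2 in
    \<open>err\<close>.\<close>
  obtain a where a: "a \<in> plans x"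
    using plan_ex[OF 0(1)] by blast
  have "G \<gamma> x s \<le> Lag a lam \<gamma> x s + err 0 lam \<gamma> s"
    using Gu[OF 0(1,2), of s] Lag_bound[OF 0(3,1) a 0(2), of s] by (simp add: err_def algebra_simps)
  with a show ?case
    by blast
next
  case (Suc T)
  obtain b where b: "b \<in> Atil A p x s" and Gb: "\<And>lam. lam \<in> nonneg \<Longrightarrow> G \<gamma> x s \<le> bracket G \<gamma> x s b lam"
    using Bellman_action[OF G Suc.prems(1,2)] by blast
  let ?l = "\<lambda>k. lam ((s, b) # k)" and ?x = "\<zeta> x b s" and ?mu = "lam [(s, b)]"
  have bA: "b \<in> A"
    by (rule adm_in_A[OF b])
  have mu: "?mu \<in> nonneg"
    using Suc.prems(3) bA unfolding Mult_iff nonneg_mult_def nonneg_def by auto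
  have "\<exists>c\<in>plans ?x. G (\<gamma> + ?mu) ?x s' \<le> Lag c ?l (\<gamma> + ?mu) ?x s' + err T ?l (\<gamma> + ?mu) s'" for s'
    by (rule Suc.IH[OF zeta_X[OF Suc.prems(1) bA] nonneg_add[OF Suc.prems(2) mu] Mult_shift[OF Suc.prems(3) bA]])
  then obtain c where c: "\<And>s'. c s' \<in> plans ?x"
    "\<And>s'. G (\<gamma> + ?mu) ?x s' \<le> Lag (c s') ?l (\<gamma> + ?mu) ?x s' + err T ?l (\<gamma> + ?mu) s'"
    by metis
  obtain a where a: "a \<in> plans x" and La: "Lag a lam \<gamma> x s
      = r x b s + (\<Sum>i\<in>UNIV. \<gamma> $ i * g i x b s + ?mu $ i * (g i x b s - gbar i))
        + \<beta> * (\<Sum>s'\<in>UNIV. \<pi> s s' * Lag (c s') ?l (\<gamma> + ?mu) ?x s')"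
    by (rule combine_plan[where c = c, OF Suc.prems(1) b Suc.prems(3) c(1)])
  have "(\<Sum>s'\<in>UNIV. \<pi> s s' * G (\<gamma> + ?mu) ?x s')
      \<le> (\<Sum>s'\<in>UNIV. \<pi> s s' * (Lag (c s') ?l (\<gamma> + ?mu) ?x s' + err T ?l (\<gamma> + ?mu) s'))"
    using pi_pos c(2) by (intro sum_mono mult_left_mono) (auto simp: less_imp_le)
  then have "\<beta> * (\<Sum>s'\<in>UNIV. \<pi> s s' * G (\<gamma> + ?mu) ?x s')
      \<le> \<beta> * (\<Sum>s'\<in>UNIV. \<pi> s s' * (Lag (c s') ?l (\<gamma> + ?mu) ?x s' + err T ?l (\<gamma> + ?mu) s'))"
    using beta by (intro mult_left_mono) auto
  also have "\<dots> = \<beta> * (\<Sum>s'\<in>UNIV. \<pi> s s' * Lag (c s') ?l (\<gamma> + ?mu) ?x s')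
      + \<beta> * (\<Sum>s'\<in>UNIV. \<pi> s s' * err T ?l (\<gamma> + ?mu) s')"
    by (simp add: distrib_left sum.distrib)
  finally have "G \<gamma> x s \<le> Lag a lam \<gamma> x s + \<beta> * (\<Sum>s'\<in>UNIV. \<pi> s s' * err T ?l (\<gamma> + ?mu) s')"
    using Gb[OF mu] unfolding La by linarith
  also have "\<dots> \<le> Lag a lam \<gamma> x s + err (Suc T) lam \<gamma> s"
    using err_step[OF Suc.prems(3) bA Suc.prems(1)] by simp
  finally show ?case
    using a by blast
qed

lemma Bellman_le_Dval:
  assumes "inN X A p \<beta> \<pi> \<zeta> r g gbar G" "Bellman X A p \<beta> \<pi> \<zeta> r g gbar G" "x \<in> X" "\<gamma> \<in> nonneg"
  shows "G \<gamma> x s \<le> Dval \<gamma> x s"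
proof (rule field_le_epsilon)
  fix e :: real assume e: "0 < e"
  have "G \<gamma> x s - e \<le> Dval \<gamma> x s"
  proof (rule Dval_ge[OF assms(3,4)])
    fix lam assume lam: "lam \<in> Mult"
    obtain T where T: "err T lam \<gamma> s < e"
      using order_tendstoD(2)[OF err_tendsto_0[OF lam] e] unfolding eventually_sequentially by blast
    have "\<exists>a\<in>plans x. G \<gamma> x s \<le> Lag a lam \<gamma> x s + err T lam \<gamma> s"
      by (rule Bellman_le_Lag[OF assms(2) _ assms(3,4) lam]) (use assms(1) in \<open>auto simp: inN_def\<close>)
    with T show "\<exists>a\<in>plans x. G \<gamma> x s - e \<le> Lag a lam \<gamma> x s"
      by force
  qed
  then show "G \<gamma> x s \<le> Dval \<gamma> x s + e"
    by simp
qed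

end

section \<open>Lagrange duality on compact convex sets\<close>

text \<open>Convexity and affinity are written pointwise for families of reals; compactness and
  continuity below refer to pointwise convergence.\<close>

definition mix :: "real \<Rightarrow> ('k \<Rightarrow> real) \<Rightarrow> ('k \<Rightarrow> real) \<Rightarrow> 'k \<Rightarrow> real" where
  "mix u m m' = (\<lambda>k. (1 - u) * m k + u * m' k)"

definition mix_closed :: "('k \<Rightarrow> real) set \<Rightarrow> bool" where
  "mix_closed C \<longleftrightarrow> (\<forall>m\<in>C. \<forall>m'\<in>C. \<forall>u. 0 \<le> u \<longrightarrow> u \<le> 1 \<longrightarrow> mix u m m' \<in> C)"

definition mix_affine :: "('k \<Rightarrow> real) set \<Rightarrow> (('k \<Rightarrow> real) \<Rightarrow> real) \<Rightarrow> bool" where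
  "mix_affine C f \<longleftrightarrow>
     (\<forall>m\<in>C. \<forall>m'\<in>C. \<forall>u. 0 \<le> u \<longrightarrow> u \<le> 1 \<longrightarrow> f (mix u m m') = (1 - u) * f m + u * f m')"

lemma mix_affine_add_scaled:
  "mix_affine C f \<Longrightarrow> mix_affine C c \<Longrightarrow> mix_affine C (\<lambda>m. f m + l * c m)"
  unfolding mix_affine_def by (intro ballI allI impI) (simp, simp add: algebra_simps)

lemma mix_affine_subset: "mix_affine C f \<Longrightarrow> C' \<subseteq> C \<Longrightarrow> mix_affine C' f"
  by (auto simp: mix_affine_def)

text \<open>The convex compact image of \<open>C\<close> in the plane misses the closed quadrant of
  points with objective at least \<open>d\<close> and nonnegative constraint. A strictly separating
  line that is not horizontal in the constraint direction has slope data \<open>a2 / a1\<close>, the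
  multiplier.\<close>

lemma lagrange_single:
  fixes C :: "('k \<Rightarrow> real) set"
  assumes C: "compact C" "mix_closed C"
    and f: "continuous_on C f" "mix_affine C f" and c: "continuous_on C c" "mix_affine C c"
    and feas: "\<exists>m\<in>C. 0 \<le> c m" and less: "\<And>m. m \<in> C \<Longrightarrow> 0 \<le> c m \<Longrightarrow> f m < d"
  shows "\<exists>l\<ge>0. \<forall>m\<in>C. f m + l * c m < d"
proof -
  let ?S = "(\<lambda>m. (f m, c m)) ` C" and ?T = "{d..} \<times> {0::real..}"
  have "compact ?S"
    by (intro compact_continuous_image continuous_on_Pair f c C)
  moreover have "convex ?S"
    unfolding convex_alt
  proof safe
    fix m m' and u :: real assume m: "m \<in> C" "m' \<in> C" and u: "0 \<le> u" "u \<le> 1"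
    have "mix u m m' \<in> C" "(1 - u) *\<^sub>R (f m, c m) + u *\<^sub>R (f m', c m') = (f (mix u m m'), c (mix u m m'))"
      using C(2) f(2) c(2) m u by (auto simp: mix_closed_def mix_affine_def)
    then show "(1 - u) *\<^sub>R (f m, c m) + u *\<^sub>R (f m', c m') \<in> ?S"
      by auto
  qed
  moreover have "convex ?T" "closed ?T"
    by (auto intro!: convex_Times closed_Times)
  moreover have "?S \<inter> ?T = {}"
    using less by force
  ultimately obtain a b where ab: "\<And>z. z \<in> ?S \<Longrightarrow> inner a z < b" "\<And>z. z \<in> ?T \<Longrightarrow> b < inner a z"
    using separating_hyperplane_compact_closed[of ?S ?T] feas by blast
  obtain a1 a2 where a: "a = (a1, a2)"
    by (cases a)
  have T: "b < a1 * (d + n) + a2 * n'" if "0 \<le> n" "0 \<le> n'" for n n'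
    using ab(2)[of "(d + n, n')"] that by (simp add: a)
  have S: "a1 * f m + a2 * c m < b" if "m \<in> C" for m
    using ab(1)[of "(f m, c m)"] that by (simp add: a)
  \<comment> \<open>If \<open>a1\<close> were negative, moving through the quadrant in the first
    coordinate would lower the functional to exactly \<open>b\<close>, against strict separation.
    The second coordinate is treated alike.\<close>
  have a1: "0 \<le> a1"
  proof (rule ccontr)
    assume "\<not> 0 \<le> a1"
    then have "0 \<le> (b - a1 * d) / a1" "a1 * (d + (b - a1 * d) / a1) = b"
      using T[of 0 0] by (auto simp: field_simps)
    then show False
      using T[of "(b - a1 * d) / a1" 0] by simp
  qed
  have a2: "0 \<le> a2"
  proof (rule ccontr)
    assume "\<not> 0 \<le> a2"
    then have "0 \<le> (b - a1 * d) / a2" "a2 * ((b - a1 * d) / a2) = b - a1 * d"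
      using T[of 0 0] by (auto simp: field_simps)
    then show False
      using T[of 0 "(b - a1 * d) / a2"] by simp
  qed
  \<comment> \<open>Otherwise the objective would be ignored. Feasibility rules this out:
    \<open>a2 * c m\<close> is nonnegative at a feasible point, yet below the negative number
    \<open>b\<close>.\<close>
  have "a1 \<noteq> 0"
  proof
    assume "a1 = 0"
    then have "b < 0"
      using T[of 0 0] by simp
    obtain m where "m \<in> C" "0 \<le> c m"
      using feas by blast
    then have "0 \<le> a2 * c m" "a2 * c m < b"
      using S[of m] a2 \<open>a1 = 0\<close> by auto
    with \<open>b < 0\<close> show False
      by simp
  qed
  then have pos: "0 < a1"
    using a1 by simp
  have "f m + a2 / a1 * c m < d" if "m \<in> C" for m
  proof -
    have "a1 * (f m + a2 / a1 * c m) < a1 * d"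
      using S[OF that] T[of 0 0] pos by (simp add: distrib_left)
    then show ?thesis
      using pos by simp
  qed
  then show ?thesis
    using a2 pos by (intro exI[of _ "a2 / a1"]) auto
qed

text \<open>Adding the constraints one at a time keeps the separation argument in the plane.\<close>

lemma lagrange_finite:
  fixes C :: "('k \<Rightarrow> real) set"
  assumes C: "compact C" "closed C" "mix_closed C" and "finite J"
    and c: "\<And>j. j \<in> J \<Longrightarrow> continuous_on C (c j)" "\<And>j. j \<in> J \<Longrightarrow> mix_affine C (c j)"
    and feas: "\<exists>m\<in>C. \<forall>j\<in>J. 0 \<le> c j m"
    and f: "continuous_on C f" "mix_affine C f"
    and less: "\<And>m. m \<in> C \<Longrightarrow> \<forall>j\<in>J. 0 \<le> c j m \<Longrightarrow> f m < d"
  shows "\<exists>l. (\<forall>j\<in>J. 0 \<le> l j) \<and> (\<forall>m\<in>C. f m + (\<Sum>j\<in>J. l j * c j m) < d)"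
  using \<open>finite J\<close> c feas f less
proof (induction J arbitrary: f rule: finite_induct)
  case (insert j J)
  \<comment> \<open>The constraints in \<open>J\<close> are first kept as hard restrictions, so that
    \<open>j\<close> alone is dualised, on \<open>C'\<close>. The induction hypothesis is then
    applied on all of \<open>C\<close> to the objective with \<open>lj * c j\<close> added.\<close>
  define C' where "C' = {m \<in> C. \<forall>i\<in>J. 0 \<le> c i m}"
  have C'_eq: "C' = C \<inter> (\<Inter>i\<in>J. C \<inter> c i -` {0..})"
    by (auto simp: C'_def)
  have "closed (C \<inter> c i -` {0..})" if "i \<in> J" for i
    using insert.prems(1)[of i] that by (intro continuous_closed_preimage C) auto
  then have "compact C'"
    unfolding C'_eq by (intro compact_Int_closed C closed_INT) auto
  moreover have "mix_closed C'"
    using C(3) insert.prems(2) unfolding C'_def mix_closed_def mix_affine_def by auto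
  moreover have sub: "C' \<subseteq> C"
    unfolding C'_def by auto
  ultimately have "\<exists>l\<ge>0. \<forall>m\<in>C'. f m + l * c j m < d"
  proof (rule_tac lagrange_single)
    show "\<exists>m\<in>C'. 0 \<le> c j m"
      using insert.prems(3) unfolding C'_def by auto
    fix m assume "m \<in> C'" "0 \<le> c j m"
    then show "f m < d"
      using insert.prems(6)[of m] unfolding C'_def by auto
  qed (use insert.prems sub in \<open>auto intro: continuous_on_subset mix_affine_subset\<close>)
  then obtain lj where lj: "0 \<le> lj" "\<And>m. m \<in> C' \<Longrightarrow> f m + lj * c j m < d"
    by blast
  have "\<exists>l. (\<forall>i\<in>J. 0 \<le> l i) \<and> (\<forall>m\<in>C. (f m + lj * c j m) + (\<Sum>i\<in>J. l i * c i m) < d)"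
  proof (rule insert.IH)
    show "\<exists>m\<in>C. \<forall>j\<in>J. 0 \<le> c j m"
      using insert.prems(3) by auto
    fix m assume "m \<in> C" "\<forall>i\<in>J. 0 \<le> c i m"
    then show "f m + lj * c j m < d"
      by (intro lj(2)) (auto simp: C'_def)
  qed (use insert.prems in \<open>auto intro!: mix_affine_add_scaled continuous_intros\<close>)
  then obtain l where l: "\<forall>i\<in>J. 0 \<le> l i" "\<forall>m\<in>C. (f m + lj * c j m) + (\<Sum>i\<in>J. l i * c i m) < d"
    by blast
  have "(\<Sum>i\<in>J. (l(j := lj)) i * c i m) = (\<Sum>i\<in>J. l i * c i m)" for m
    using insert.hyps by (intro sum.cong) auto
  then show ?case
    using l lj(1) insert.hyps by (intro exI[of _ "l(j := lj)"]) (auto simp: add.assoc)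
qed auto

text \<open>If finitely many constraints could not be met at a level \<open>y < d\<close>, their
  multipliers would contradict \<open>sup\<close>. Superlevel sets of \<open>f\<close> and
  constraint sets are closed in \<open>C\<close>, so the finite intersection property yields one
  point for all levels and all constraints.\<close>

lemma lagrange_duality:
  fixes C :: "('k \<Rightarrow> real) set" and c :: "'j \<Rightarrow> ('k \<Rightarrow> real) \<Rightarrow> real"
  assumes C: "compact C" "closed C" "mix_closed C"
    and c: "\<And>j. j \<in> J \<Longrightarrow> continuous_on C (c j)" "\<And>j. j \<in> J \<Longrightarrow> mix_affine C (c j)"
    and feas: "\<exists>m\<in>C. \<forall>j\<in>J. 0 \<le> c j m"
    and f: "continuous_on C f" "mix_affine C f"
    and sup: "\<And>J0 l y. finite J0 \<Longrightarrow> J0 \<subseteq> J \<Longrightarrow> (\<And>j. j \<in> J0 \<Longrightarrow> 0 \<le> l j) \<Longrightarrow> y < d \<Longrightarrow>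
      \<exists>m\<in>C. y \<le> f m + (\<Sum>j\<in>J0. l j * c j m)"
  shows "\<exists>m\<in>C. d \<le> f m \<and> (\<forall>j\<in>J. 0 \<le> c j m)"
proof -
  define I :: "(real + 'j) set" where "I = Inl ` {..<d} \<union> Inr ` J"
  define S where "S z = (case z of Inl y \<Rightarrow> C \<inter> f -` {y..} | Inr j \<Rightarrow> C \<inter> c j -` {0..})" for z
  have "C \<inter> (\<Inter>z\<in>I. S z) \<noteq> {}"
  proof (rule compact_imp_fip_image[OF C(1)])
    fix z assume "z \<in> I"
    then show "closed (S z)"
      unfolding S_def I_def using C f c by (auto intro!: continuous_closed_preimage)
  next
    fix I' assume I': "finite I'" "I' \<subseteq> I"
    define J0 where "J0 = Inr -` I'"
    define Y where "Y = Inl -` I'"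
    have J0: "finite J0" "J0 \<subseteq> J"
      using I' finite_vimageI[of I' Inr] unfolding J0_def I_def by auto
    have Y: "finite Y" "Y \<subseteq> {..<d}"
      using I' finite_vimageI[of I' Inl] unfolding Y_def I_def by auto
    \<comment> \<open>Finitely many levels reduce to the largest; \<open>d - 1\<close> serves when
      there is none.\<close>
    define y where "y = Max (insert (d - 1) Y)"
    have y: "y < d" "\<And>y'. y' \<in> Y \<Longrightarrow> y' \<le> y"
      using Y unfolding y_def by auto
    have "\<exists>m\<in>C. (\<forall>j\<in>J0. 0 \<le> c j m) \<and> y \<le> f m"
    proof (rule ccontr)
      assume neg: "\<not> ?thesis"
      have "\<exists>l. (\<forall>j\<in>J0. 0 \<le> l j) \<and> (\<forall>m\<in>C. f m + (\<Sum>j\<in>J0. l j * c j m) < y)"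
      proof (rule lagrange_finite[OF C J0(1)])
        show "\<exists>m\<in>C. \<forall>j\<in>J0. 0 \<le> c j m"
          using feas J0 by blast
        fix m assume "m \<in> C" "\<forall>j\<in>J0. 0 \<le> c j m"
        then show "f m < y"
          using neg by force
      qed (use J0 c f in auto)
      then obtain l where l: "\<forall>j\<in>J0. 0 \<le> l j" "\<forall>m\<in>C. f m + (\<Sum>j\<in>J0. l j * c j m) < y"
        by blast
      then show False
        using sup[OF J0, of l y] y(1) by force
    qed
    then obtain m where m: "m \<in> C" "\<forall>j\<in>J0. 0 \<le> c j m" "y \<le> f m"
      by blast
    have "m \<in> S z" if "z \<in> I'" for z
    proof (cases z)
      case (Inl y')
      then have "y' \<le> y"
        using that y(2) by (simp add: Y_def)
      then show ?thesis
        using m Inl by (simp add: S_def)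
    next
      case (Inr j)
      then show ?thesis
        using m that by (simp add: S_def J0_def)
    qed
    with m(1) show "C \<inter> (\<Inter>z\<in>I'. S z) \<noteq> {}"
      by blast
  qed
  then obtain m where m: "m \<in> C" "\<And>z. z \<in> I \<Longrightarrow> m \<in> S z"
    by blast
  have "y \<le> f m" if "y < d" for y
    using m(2)[of "Inl y"] that by (simp add: S_def I_def)
  then have "d \<le> f m"
    by (rule dense_le)
  moreover have "0 \<le> c j m" if "j \<in> J" for j
    using m(2)[of "Inr j"] that by (simp add: S_def I_def)
  ultimately show ?thesis
    using m(1) by blast
qed

lemma continuous_on_coord: "continuous_on S (\<lambda>m :: 'k \<Rightarrow> real. m k)"
  by (rule continuous_on_subset[OF continuous_on_product_coordinates]) simp

section \<open>Play probabilities of lotteries\<close>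

context lottery_model
begin

text \<open>Families of probabilities \<open>m k\<close> that the actions along the shocks of \<open>k\<close> are those of \<open>k\<close>.\<close>

definition weights :: "'x \<Rightarrow> (('s \<times> 'a) list \<Rightarrow> real) set" where
  "weights x = {m. (\<forall>k. 0 \<le> m k) \<and> m [] = 1 \<and> (\<forall>k s. (\<Sum>b\<in>A. m (k @ [(s, b)])) = m k) \<and>
     (\<forall>k. \<not> admh A p \<zeta> x k \<longrightarrow> m k = 0)}"

lemma weights_nonneg: "m \<in> weights x \<Longrightarrow> 0 \<le> m k"
  by (simp add: weights_def)

lemma weights_le_1:
  assumes "m \<in> weights x"
  shows "m k \<le> 1"
proof (induction k rule: rev_induct)
  case Nil
  then show ?case
    using assms by (simp add: weights_def)
next
  case (snoc sb k)
  obtain s b where sb: "sb = (s, b)"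
    by (cases sb)
  show ?case
  proof (cases "b \<in> A")
    case True
    have "m (k @ [(s, b)]) \<le> (\<Sum>b\<in>A. m (k @ [(s, b)]))"
      by (rule member_le_sum[where f = "\<lambda>b. m (k @ [(s, b)])"]) (use True A_fin weights_nonneg[OF assms] in auto)
    also have "\<dots> = m k"
      using assms by (simp add: weights_def)
    finally show ?thesis
      using snoc sb by simp
  next
    case False
    then have "\<not> admh A p \<zeta> x (k @ [(s, b)])"
      by (simp add: admh_snoc Atil_def)
    then show ?thesis
      using assms sb by (simp add: weights_def)
  qed
qed

lemma closed_weights: "closed (weights x)"
proof -
  have "weights x = {m. \<forall>k. 0 \<le> m k} \<inter> {m. m [] = 1} \<inter> {m. \<forall>k s. (\<Sum>b\<in>A. m (k @ [(s, b)])) = m k}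
      \<inter> {m. \<forall>k. \<not> admh A p \<zeta> x k \<longrightarrow> m k = 0}"
    by (auto simp: weights_def)
  moreover have "closed {m :: ('s \<times> 'a) list \<Rightarrow> real. \<not> admh A p \<zeta> x k \<longrightarrow> m k = 0}" for k
    by (cases "admh A p \<zeta> x k") (auto intro!: closed_Collect_eq continuous_intros)
  ultimately show ?thesis
    by (auto intro!: closed_Int closed_Collect_all closed_Collect_le closed_Collect_eq continuous_intros)
qed

text \<open>A closed subset of a product of unit intervals, which is compact by Tychonoff's
  theorem.\<close>

lemma compact_weights: "compact (weights x)"
proof -
  have "compactin (product_topology (\<lambda>_. euclidean) UNIV) (PiE UNIV (\<lambda>_::('s \<times> 'a) list. {0..1::real}))"
    unfolding compactin_PiE by auto
  then have "compact (PiE UNIV (\<lambda>_::('s \<times> 'a) list. {0..1::real}))"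
    by (simp add: euclidean_product_topology)
  moreover have "weights x \<subseteq> PiE UNIV (\<lambda>_::('s \<times> 'a) list. {0..1::real})"
    using weights_le_1[of _ x] weights_nonneg[of _ x] by (auto simp: PiE_def Pi_def)
  ultimately show ?thesis
    using compact_Int_closed[OF _ closed_weights[of x]] by (metis inf.absorb_iff2)
qed

lemma mix_closed_weights: "mix_closed (weights x)"
  unfolding mix_closed_def
proof (intro ballI allI impI)
  fix m m' and u :: real assume *: "m \<in> weights x" "m' \<in> weights x" "0 \<le> u" "u \<le> 1"
  then show "mix u m m' \<in> weights x"
    unfolding weights_def mix_def by (auto simp: sum.distrib simp flip: sum_distrib_left)
qed

lemma admh_htil: "a \<in> plans x \<Longrightarrow> admh A p \<zeta> x (htil a h)"
proof (induction h arbitrary: a x)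
  case (Cons s h)
  then show ?case
    using plan_head[OF Cons.prems, of s] shift_plan_Ainf[OF Cons.prems, of s] by (simp add: htil_Cons)
qed simp

lemma follows_weights:
  assumes "a \<in> plans x"
  shows "follows a \<in> weights x"
  unfolding weights_def mem_Collect_eq
proof (intro conjI allI impI)
  fix k :: "('s \<times> 'a) list" and s
  have "a (map fst k @ [s]) \<in> A"
    using plan_in_A[OF assms] by simp
  then show "(\<Sum>b\<in>A. follows a (k @ [(s, b)])) = follows a k"
    using A_fin by (simp add: follows_snoc of_bool_def sum_distrib_right[symmetric] sum.delta')
next
  fix k :: "('s \<times> 'a) list" assume "\<not> admh A p \<zeta> x k"
  then have "htil a (map fst k) \<noteq> k"
    using admh_htil[OF assms] by metis
  then show "follows a k = 0"
    by (simp add: follows_def)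
qed (simp_all add: follows_nonneg)

text \<open>The payoff \<open>n\<close> periods after \<open>k\<close>, expected over later shocks
  and over the lottery's actions on the event that it plays along \<open>k\<close>. The probability
  of that event is not divided out, which keeps the expression linear in \<open>m\<close>.\<close>

definition wterm :: "'x \<Rightarrow> ('x \<Rightarrow> 'a \<Rightarrow> 's \<Rightarrow> real) \<Rightarrow> (('s \<times> 'a) list \<Rightarrow> real) \<Rightarrow> ('s \<times> 'a) list \<Rightarrow> nat \<Rightarrow> real" where
  "wterm x f m k n = (\<Sum>e\<in>alists A n. pathprob \<pi> (map fst (k @ e)) / pathprob \<pi> (map fst k) *
      (m (k @ e) * gval \<zeta> f x (k @ e)))"

definition wval :: "'x \<Rightarrow> ('x \<Rightarrow> 'a \<Rightarrow> 's \<Rightarrow> real) \<Rightarrow> (('s \<times> 'a) list \<Rightarrow> real) \<Rightarrow> ('s \<times> 'a) list \<Rightarrow> real" where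
  "wval x f m k = (\<Sum>n. \<beta> ^ n * wterm x f m k n)"

text \<open>Summing out actions by consistency of \<open>m\<close>, and shocks by the transition
  law, leaves the mass at \<open>k\<close>. This is why \<open>wterm\<close> is bounded in
  proportion to \<open>m k\<close>.\<close>

lemma weights_path_sum:
  assumes "m \<in> weights x" "k \<noteq> []"
  shows "(\<Sum>e\<in>alists A n. pathprob \<pi> (map fst (k @ e)) / pathprob \<pi> (map fst k) * m (k @ e)) = m k"
  using assms(2)
proof (induction n arbitrary: k)
  case 0
  then show ?case
    using path_pos[of "map fst k"] by simp
next
  case (Suc n)
  let ?q = "\<pi> (last (map fst k))"
  have "(\<Sum>e\<in>alists A n. pathprob \<pi> (map fst (k @ (s, b) # e)) / pathprob \<pi> (map fst k) * m (k @ (s, b) # e))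
      = ?q s * m (k @ [(s, b)])" for s b
  proof -
    have "pathprob \<pi> (map fst (k @ [(s, b)])) = pathprob \<pi> (map fst k) * ?q s"
      using pathprob_snoc[where h = "map fst k" and s = s] Suc.prems by simp
    then have "pathprob \<pi> (map fst (k @ (s, b) # e)) / pathprob \<pi> (map fst k) * m (k @ (s, b) # e)
       = ?q s * (pathprob \<pi> (map fst ((k @ [(s, b)]) @ e)) / pathprob \<pi> (map fst (k @ [(s, b)])) * m ((k @ [(s, b)]) @ e))" for e
      using path_pos[of "map fst k"] pi_pos[of "last (map fst k)" s] by simp
    then show ?thesis
      using Suc.IH[of "k @ [(s, b)]"] by (simp only: sum_distrib_left[symmetric]) simp
  qed
  then have "(\<Sum>e\<in>alists A (Suc n). pathprob \<pi> (map fst (k @ e)) / pathprob \<pi> (map fst k) * m (k @ e))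
      = (\<Sum>s\<in>UNIV. ?q s * (\<Sum>b\<in>A. m (k @ [(s, b)])))"
    unfolding sum_alists_Suc[OF A_fin] sum_distrib_left by simp
  also have "\<dots> = m k"
    using assms(1) pi_sum by (simp add: weights_def flip: sum_distrib_right)
  finally show ?case .
qed

lemma wterm_bound:
  assumes "bounded_by X A f B" "x \<in> X" "m \<in> weights x" "k \<noteq> []" "k \<in> alists A j"
  shows "\<bar>wterm x f m k n\<bar> \<le> B * m k"
proof -
  have "\<bar>wterm x f m k n\<bar> \<le> (\<Sum>e\<in>alists A n. \<bar>pathprob \<pi> (map fst (k @ e)) / pathprob \<pi> (map fst k) *
      (m (k @ e) * gval \<zeta> f x (k @ e))\<bar>)"
    unfolding wterm_def by (rule sum_abs)
  also have "\<dots> \<le> (\<Sum>e\<in>alists A n. B * (pathprob \<pi> (map fst (k @ e)) / pathprob \<pi> (map fst k) * m (k @ e)))"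
  proof (rule sum_mono)
    fix e assume "e \<in> (alists A n :: ('s \<times> 'a) list set)"
    then have "\<bar>gval \<zeta> f x (k @ e)\<bar> \<le> B"
      using gval_bound[OF assms(1,2) alists_append[OF assms(5)]] assms(4) by auto
    then show "\<bar>pathprob \<pi> (map fst (k @ e)) / pathprob \<pi> (map fst k) * (m (k @ e) * gval \<zeta> f x (k @ e))\<bar>
        \<le> B * (pathprob \<pi> (map fst (k @ e)) / pathprob \<pi> (map fst k) * m (k @ e))"
      using mult_left_mono[of "\<bar>gval \<zeta> f x (k @ e)\<bar>" B "pathprob \<pi> (map fst (k @ e)) / pathprob \<pi> (map fst k) * m (k @ e)"]
        path_pos weights_nonneg[OF assms(3)]
      by (simp add: abs_mult less_imp_le ac_simps)
  qed
  also have "\<dots> = B * m k"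
    unfolding sum_distrib_left[symmetric] weights_path_sum[OF assms(3,4)] ..
  finally show ?thesis .
qed

lemma wterm_bound':
  assumes "bounded_by X A f B" "x \<in> X" "m \<in> weights x" "k \<noteq> []" "k \<in> alists A j"
  shows "\<bar>wterm x f m k n\<bar> \<le> \<bar>B\<bar>"
proof -
  have "B * m k \<le> \<bar>B\<bar> * 1"
    using weights_nonneg[OF assms(3)] weights_le_1[OF assms(3)] by (intro mult_mono) auto
  then show ?thesis
    using wterm_bound[OF assms, of n] by simp
qed

lemma wval_summable:
  assumes "bounded_by X A f B" "x \<in> X" "m \<in> weights x" "k \<noteq> []" "k \<in> alists A j"
  shows "summable (\<lambda>n. \<beta> ^ n * wterm x f m k n)"
  by (rule geometric_bound(1)[OF wterm_bound'[OF assms]])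

lemma mix_affine_wval:
  assumes "bounded_by X A f B" "x \<in> X" "k \<noteq> []" "k \<in> alists A j"
  shows "mix_affine (weights x) (\<lambda>m. wval x f m k)"
  unfolding mix_affine_def
proof (intro ballI allI impI)
  fix m m' and u :: real assume m: "m \<in> weights x" "m' \<in> weights x" and u: "0 \<le> u" "u \<le> 1"
  have "wterm x f (mix u m m') k n = (1 - u) * wterm x f m k n + u * wterm x f m' k n" for n
  proof -
    have "q * (((1 - u) * v + u * v') * w) = (1 - u) * (q * (v * w)) + u * (q * (v' * w))" for q v v' w :: real
      by (simp add: algebra_simps)
    then show ?thesis
      unfolding wterm_def mix_def sum_distrib_left sum.distrib[symmetric] by (intro sum.cong refl)
  qed
  then have "wval x f (mix u m m') k
      = (\<Sum>n. (1 - u) * (\<beta> ^ n * wterm x f m k n) + u * (\<beta> ^ n * wterm x f m' k n))"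
    unfolding wval_def by (simp add: distrib_left mult.left_commute)
  also have "\<dots> = (1 - u) * wval x f m k + u * wval x f m' k"
    unfolding wval_def using wval_summable[OF assms(1,2) m(1) assms(3,4)] wval_summable[OF assms(1,2) m(2) assms(3,4)]
    by (simp add: suminf_add[symmetric] suminf_mult summable_mult)
  finally show "wval x f (mix u m m') k = (1 - u) * wval x f m k + u * wval x f m' k" .
qed

text \<open>Each \<open>wterm\<close> involves finitely many coordinates, and the geometric bound
  makes the series converge uniformly on \<open>weights x\<close>.\<close>

lemma continuous_on_wval:
  assumes "bounded_by X A f B" "x \<in> X" "k \<noteq> []" "k \<in> alists A j"
  shows "continuous_on (weights x) (\<lambda>m. wval x f m k)"
proof -
  have "uniform_limit (weights x) (\<lambda>N m. \<Sum>n<N. \<beta> ^ n * wterm x f m k n) (\<lambda>m. wval x f m k) sequentially"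
    unfolding wval_def
  proof (rule Weierstrass_m_test)
    fix n m assume "m \<in> weights x"
    then show "norm (\<beta> ^ n * wterm x f m k n) \<le> \<beta> ^ n * \<bar>B\<bar>"
      using wterm_bound'[OF assms(1,2) _ assms(3,4)] beta by (simp add: abs_mult mult_left_mono)
  next
    show "summable (\<lambda>n. \<beta> ^ n * \<bar>B\<bar>)"
      using beta by (intro summable_mult2 summable_geometric) auto
  qed
  moreover have "continuous_on (weights x) (\<lambda>m. \<Sum>n<N. \<beta> ^ n * wterm x f m k n)" for N
    unfolding wterm_def by (intro continuous_intros continuous_on_coord)
  ultimately show ?thesis
    by (intro uniform_limit_theorem[where F = sequentially]) (auto intro: always_eventually)
qed

section \<open>Deterministic plans as families of play probabilities\<close>

lemma wterm_follows:
  assumes "a \<in> plans x" "k \<noteq> []"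
  shows "wterm x f (follows a) k n = follows a k * condE \<pi> (map fst k) n (flow f \<zeta> x a)"
proof -
  let ?\<psi> = "\<lambda>l. pathprob \<pi> (map fst l) / pathprob \<pi> (map fst k) * gval \<zeta> f x l"
  have "wterm x f (follows a) k n = (\<Sum>e\<in>alists A n. follows a (k @ e) * ?\<psi> (k @ e))"
    unfolding wterm_def by (intro sum.cong refl) simp
  also have "\<dots> = follows a k * (\<Sum>e | length e = n. ?\<psi> (htil a (map fst k @ e)))"
    by (rule sum_follows_append[OF A_fin]) (rule plan_in_A[OF assms(1)])
  also have "(\<Sum>e | length e = n. ?\<psi> (htil a (map fst k @ e))) = condE \<pi> (map fst k) n (flow f \<zeta> x a)"
    unfolding condE_def using assms(2) by (intro sum.cong refl) (simp add: flow_eq_gval)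
  finally show ?thesis .
qed

lemma wval_follows:
  assumes "bounded_by X A f B" "x \<in> X" "a \<in> plans x" "k \<noteq> []"
  shows "wval x f (follows a) k = follows a k * cnt x a f (map fst k)"
proof -
  have "summable (\<lambda>n. \<beta> ^ n * condE \<pi> (map fst k) n (flow f \<zeta> x a))"
    by (rule cont_summable[OF assms(1-3)]) (use assms(4) in simp)
  then show ?thesis
    unfolding wval_def cont_def wterm_follows[OF assms(3,4)] mult.left_commute[of _ "follows a k"]
    by (rule suminf_mult)
qed

lemma pen_follows:
  assumes "a \<in> plans x"
  shows "pen a lam x s t = (\<Sum>b\<in>A. \<Sum>k\<in>alists A t. \<Sum>i\<in>UNIV. pathprob \<pi> (s # map fst k) * lam ((s, b) # k) $ i *
     (follows a ((s, b) # k) * (cnt x a (g i) (s # map fst k) - gbar i)))"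
proof -
  let ?\<psi> = "\<lambda>l. pathprob \<pi> (map fst l) * (\<Sum>i\<in>UNIV. lam l $ i * (cnt x a (g i) (map fst l) - gbar i))"
  have "pen a lam x s t = (\<Sum>e | length e = t. ?\<psi> (htil a (s # e)))"
    unfolding penalty_def condE_def by (intro sum.cong refl) simp
  also have "\<dots> = (\<Sum>b\<in>A. \<Sum>k\<in>alists A t. follows a ((s, b) # k) * ?\<psi> ((s, b) # k))"
    by (rule sum_follows_Cons[OF A_fin, symmetric]) (rule plan_in_A[OF assms])
  finally show ?thesis
    by (simp add: sum_distrib_left ac_simps)
qed

section \<open>Objective and constraints as functionals of play probabilities\<close>

abbreviation wreward :: "real ^ 'i \<Rightarrow> 'x \<Rightarrow> 'a \<Rightarrow> 's \<Rightarrow> real" where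
  "wreward \<gamma> \<equiv> (\<lambda>x b s. r x b s + (\<Sum>i\<in>UNIV. \<gamma> $ i * g i x b s))"

lemma bounded_wreward: "\<exists>B. bounded_by X A (wreward \<gamma>) B"
proof (intro exI)
  show "bounded_by X A (wreward \<gamma>) (supnorm X A r + (\<Sum>i\<in>UNIV. \<bar>\<gamma> $ i\<bar> * supnorm X A (g i)))"
    unfolding bounded_by_def
  proof (intro ballI allI)
    fix x b s assume *: "x \<in> X" "b \<in> A"
    have "\<bar>\<Sum>i\<in>UNIV. \<gamma> $ i * g i x b s\<bar> \<le> (\<Sum>i\<in>UNIV. \<bar>\<gamma> $ i * g i x b s\<bar>)"
      by (rule sum_abs)
    also have "\<dots> \<le> (\<Sum>i\<in>UNIV. \<bar>\<gamma> $ i\<bar> * supnorm X A (g i))"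
      using bounded_g * unfolding bounded_by_def abs_mult by (intro sum_mono mult_left_mono) auto
    finally show "\<bar>wreward \<gamma> x b s\<bar> \<le> supnorm X A r + (\<Sum>i\<in>UNIV. \<bar>\<gamma> $ i\<bar> * supnorm X A (g i))"
      using bounded_r * unfolding bounded_by_def by (smt (verit, best))
  qed
qed

text \<open>\<open>wval\<close> starts from a history that already contains an action, hence the sum
  over the first action.\<close>

definition wobj :: "'x \<Rightarrow> real ^ 'i \<Rightarrow> 's \<Rightarrow> (('s \<times> 'a) list \<Rightarrow> real) \<Rightarrow> real" where
  "wobj x \<gamma> s m = (\<Sum>b\<in>A. wval x (wreward \<gamma>) m [(s, b)])"

text \<open>The bound \<open>gbar i\<close> sits inside the indicator of following \<open>k\<close>
  and is therefore weighted by \<open>m k\<close>; for \<open>m\<close> in \<open>weights x\<close>,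
  a history that is never played imposes nothing.\<close>

definition wcon :: "'x \<Rightarrow> 'i \<Rightarrow> ('s \<times> 'a) list \<Rightarrow> (('s \<times> 'a) list \<Rightarrow> real) \<Rightarrow> real" where
  "wcon x i k m = wval x (g i) m k + (- gbar i) * m k"

lemma wobj_props:
  assumes "x \<in> X"
  shows "continuous_on (weights x) (wobj x \<gamma> s)" "mix_affine (weights x) (wobj x \<gamma> s)"
proof -
  obtain B where B: "bounded_by X A (wreward \<gamma>) B"
    using bounded_wreward by blast
  show "continuous_on (weights x) (wobj x \<gamma> s)"
    unfolding wobj_def
    by (intro continuous_on_sum continuous_on_wval[OF B assms _ single_alists]) auto
  show "mix_affine (weights x) (wobj x \<gamma> s)"
    using mix_affine_wval[OF B assms _ single_alists]
    by (simp add: mix_affine_def wobj_def sum.distrib sum_distrib_left)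
qed

lemma wcon_props:
  assumes "x \<in> X" "k \<noteq> []" "k \<in> alists A j"
  shows "continuous_on (weights x) (wcon x i k)" "mix_affine (weights x) (wcon x i k)"
proof -
  show "continuous_on (weights x) (wcon x i k)"
    unfolding wcon_def
    by (intro continuous_intros continuous_on_wval[OF bounded_g assms] continuous_on_coord)
  show "mix_affine (weights x) (wcon x i k)"
    unfolding wcon_def
    by (intro mix_affine_add_scaled mix_affine_wval[OF bounded_g assms]) (simp add: mix_affine_def mix_def)
qed

lemma wobj_follows:
  assumes "x \<in> X" "a \<in> plans x"
  shows "wobj x \<gamma> s (follows a) = cnt x a (wreward \<gamma>) [s]"
proof -
  obtain B where B: "bounded_by X A (wreward \<gamma>) B"
    using bounded_wreward by blast
  have "a [s] \<in> A"
    using plan_in_A[OF assms(2)] by simp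
  then show ?thesis
    unfolding wobj_def using A_fin wval_follows[OF B assms]
    by (simp add: follows_Cons of_bool_def sum.delta' sum_distrib_right[symmetric])
qed

lemma wcon_follows:
  assumes "x \<in> X" "a \<in> plans x" "k \<noteq> []"
  shows "wcon x i k (follows a) = follows a k * (cnt x a (g i) (map fst k) - gbar i)"
  unfolding wcon_def using wval_follows[OF bounded_g assms] by (simp add: algebra_simps)

definition constraint_set :: "(('s \<times> 'a) list \<times> 'i) set" where
  "constraint_set = {(k, i). k \<noteq> [] \<and> set (map snd k) \<subseteq> A}"

text \<open>The Lagrangian scales a multiplier by discount factor and path probability. Dividing by
  both lets the constraint \<open>(k, i)\<close> enter with coefficient exactly
  \<open>l (k, i)\<close>; the date of \<open>k\<close> is \<open>length k - 1\<close>.\<close>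

definition finite_mult :: "(('s \<times> 'a) list \<times> 'i) set \<Rightarrow> (('s \<times> 'a) list \<times> 'i \<Rightarrow> real) \<Rightarrow> ('s \<times> 'a) list \<Rightarrow> real ^ 'i" where
  "finite_mult J l k = (\<chi> i. if (k, i) \<in> J then l (k, i) / (\<beta> ^ (length k - 1) * pathprob \<pi> (map fst k)) else 0)"

lemma finite_mult_Mult:
  assumes "finite J" "\<And>j. j \<in> J \<Longrightarrow> 0 \<le> l j"
  shows "finite_mult J l \<in> Mult"
  unfolding Mult_iff
proof (intro conjI allI)
  show "nonneg_mult A (finite_mult J l)"
    unfolding nonneg_mult_def finite_mult_def using assms(2) beta path_pos by (auto simp: less_imp_le)
  define N where "N = Max (insert 0 ((\<lambda>(k, i). length k) ` J))"
  have "length k \<le> N" if "(k, i) \<in> J" for k i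
    unfolding N_def using that assms(1) by (intro Max_ge) force+
  then have "finite_mult J l ((s, b) # k) = 0" if "k \<in> alists A t" "N \<le> t" for s b k t
    using that unfolding finite_mult_def alists_def by (force simp: vec_eq_iff)
  then have "mass (finite_mult J l) t s = 0" if "t \<notin> {..<N}" for t s
    using that unfolding lam_mass_def by (intro sum.neutral ballI) simp
  then show "summable (\<lambda>t. \<beta> ^ t * mass (finite_mult J l) t s)" for s
    by (intro summable_finite[of "{..<N}"]) auto
qed

text \<open>The Lagrangian is conditioned on the initial shock, so of the constraints in
  \<open>J\<close> only those at histories starting with \<open>s\<close> appear.\<close>

lemma pen_finite_mult:
  assumes "finite J" "J \<subseteq> constraint_set" "x \<in> X" "a \<in> plans x"
  shows "(\<Sum>t. \<beta> ^ t * pen a (finite_mult J l) x s t)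
     = (\<Sum>j | j \<in> J \<and> fst (hd (fst j)) = s. l j * wcon x (snd j) (fst j) (follows a))"
proof -
  define F where "F j = l j * wcon x (snd j) (fst j) (follows a)" for j
  define J' where "J' = {j \<in> J. fst (hd (fst j)) = s}"
  define \<phi> where "\<phi> z = ((s, fst z) # fst (snd z), snd (snd z))" for z :: "'a \<times> ('s \<times> 'a) list \<times> 'i"
  have J': "finite J'"
    unfolding J'_def by (rule finite_subset[OF _ assms(1)]) auto
  have step: "\<beta> ^ t * pen a (finite_mult J l) x s t = (\<Sum>j | j \<in> J' \<and> length (fst j) - 1 = t. F j)" for t
  proof -
    have eq: "\<beta> ^ t * (pathprob \<pi> (s # map fst k) * finite_mult J l ((s, b) # k) $ i *
        (follows a ((s, b) # k) * (cnt x a (g i) (s # map fst k) - gbar i)))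
        = (if ((s, b) # k, i) \<in> J then F ((s, b) # k, i) else 0)"
      if "k \<in> alists A t" for b k i
      using that beta path_pos[of "s # map fst k"] wcon_follows[OF assms(3,4), of "(s, b) # k" i]
      by (simp add: finite_mult_def F_def alists_def)
    have "\<beta> ^ t * pen a (finite_mult J l) x s t
        = (\<Sum>b\<in>A. \<Sum>k\<in>alists A t. \<Sum>i\<in>UNIV. if ((s, b) # k, i) \<in> J then F ((s, b) # k, i) else 0)"
      unfolding pen_follows[OF assms(4)] sum_distrib_left by (intro sum.cong refl eq)
    also have "\<dots> = (\<Sum>z\<in>A \<times> alists A t \<times> UNIV. if \<phi> z \<in> J then F (\<phi> z) else 0)"
      unfolding \<phi>_def by (simp add: sum.cartesian_product case_prod_beta)
    also have "\<dots> = (\<Sum>z | z \<in> A \<times> alists A t \<times> UNIV \<and> \<phi> z \<in> J. F (\<phi> z))"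
      using A_fin by (intro sum.inter_filter[symmetric]) simp
    also have "\<dots> = (\<Sum>j | j \<in> J' \<and> length (fst j) - 1 = t. F j)"
    \<comment> \<open>\<open>\<phi>\<close> puts the initial shock \<open>s\<close> in front of an
      action and a remaining history; its inverse splits the first action off again.\<close>
    proof (rule sum.reindex_bij_witness[where i = "\<lambda>(k, i). (snd (hd k), tl k, i)" and j = \<phi>])
      fix j assume "j \<in> {j \<in> J'. length (fst j) - 1 = t}"
      then obtain k i where j: "j = (k, i)" "(k, i) \<in> J" "fst (hd k) = s" "length k - 1 = t"
        by (cases j) (auto simp: J'_def)
      then have "k \<noteq> []" "set (map snd k) \<subseteq> A"
        using assms(2) by (auto simp: constraint_set_def)
      then obtain b k' where k: "k = (s, b) # k'" "b \<in> A" "k' \<in> alists A t"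
        using j(3,4) by (cases k) (auto simp: alists_def)
      then show "(case j of (k, i) \<Rightarrow> (snd (hd k), tl k, i))
          \<in> {z \<in> A \<times> alists A t \<times> UNIV. \<phi> z \<in> J}"
        and "\<phi> (case j of (k, i) \<Rightarrow> (snd (hd k), tl k, i)) = j"
        using j by (auto simp: \<phi>_def)
    qed (auto simp: J'_def alists_def \<phi>_def)
    finally show ?thesis .
  qed
  define N where "N = Max (insert 0 ((\<lambda>j. length (fst j)) ` J'))"
  have N: "length (fst j) - 1 \<le> N" if "j \<in> J'" for j
  proof -
    have "length (fst j) \<le> N"
      unfolding N_def using that J' by (intro Max_ge) auto
    then show ?thesis
      by simp
  qed
  have "(\<Sum>t. \<beta> ^ t * pen a (finite_mult J l) x s t) = (\<Sum>t\<le>N. \<Sum>j | j \<in> J' \<and> length (fst j) - 1 = t. F j)"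
    unfolding step
  proof (rule suminf_finite)
    fix t assume "t \<notin> {..N}"
    then have "{j \<in> J'. length (fst j) - 1 = t} = {}"
      using N by fastforce
    then show "(\<Sum>j | j \<in> J' \<and> length (fst j) - 1 = t. F j) = 0"
      by (simp only: sum.empty)
  qed simp
  also have "\<dots> = (\<Sum>j\<in>J'. F j)"
    by (rule sum.group[OF J']) (use N in auto)
  finally show ?thesis
    unfolding J'_def F_def .
qed

lemma everywhere_feasible_plans:
  assumes "x \<in> X"
  obtains c where "\<And>s. c s \<in> plans x" "\<And>h i. h \<noteq> [] \<Longrightarrow> gbar i \<le> cnt x (c (hd h)) (g i) h"
proof -
  have "\<exists>a. feasible A p \<zeta> \<pi> \<beta> g gbar x s a" for s
    by (rule feas_ex[OF assms])
  then obtain c where "\<And>s. feasible A p \<zeta> \<pi> \<beta> g gbar x s (c s)"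
    by metis
  then show thesis
    by (intro that[of c]) (auto simp: feasible_def Hist_def)
qed

text \<open>Plans already supply, as points \<open>follows a'\<close> of \<open>weights x\<close>, a
  Lagrangian value above every \<open>y < Dval \<gamma> x s\<close> for each finite multiplier. This
  is the hypothesis \<open>sup\<close> of \<open>lagrange_duality\<close>.\<close>

lemma strong_duality_weights:
  assumes x: "x \<in> X" and \<gamma>: "\<gamma> \<in> nonneg"
  shows "\<exists>m\<in>weights x. Dval \<gamma> x s \<le> wobj x \<gamma> s m \<and> (\<forall>(k, i)\<in>constraint_set. 0 \<le> wcon x i k m)"
proof -
  obtain c where c: "\<And>s. c s \<in> plans x" "\<And>h i. h \<noteq> [] \<Longrightarrow> gbar i \<le> cnt x (c (hd h)) (g i) h"
    by (rule everywhere_feasible_plans[OF x]) blast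
  \<comment> \<open>A spliced plan that is feasible after the first shock of \<open>k\<close>
    satisfies the constraints at \<open>k\<close>, whatever it does after other initial
    shocks.\<close>
  have nn: "0 \<le> wcon x i k (follows (splice_plan c'))"
    if "\<And>s. c' s \<in> plans x" "k \<noteq> []" "c' (fst (hd k)) = c (fst (hd k))" for c' k i
  proof -
    have hd: "hd (map fst k) = fst (hd k)"
      using that(2) by (simp add: hd_map)
    have "cnt x (splice_plan c') (g i) (map fst k) = cnt x (c (hd (map fst k))) (g i) (map fst k)"
      by (rule cont_agree[where s = "fst (hd k)"]) (use that hd in \<open>auto simp: splice_plan_def\<close>)
    then show ?thesis
      using wcon_follows[OF x splice_plan_Ainf[of c', OF that(1)] that(2), of i] c(2)[of "map fst k" i] that(2)
        follows_nonneg[of "splice_plan c'" k] by simp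
  qed
  define cc where "cc j = wcon x (snd j) (fst j)" for j
  have "\<exists>m\<in>weights x. Dval \<gamma> x s \<le> wobj x \<gamma> s m \<and> (\<forall>j\<in>constraint_set. 0 \<le> cc j m)"
  proof (rule lagrange_duality[OF compact_weights closed_weights mix_closed_weights])
    fix j assume "j \<in> constraint_set"
    then obtain k i where "j = (k, i)" "k \<noteq> []" "k \<in> alists A (length k)"
      by (auto simp: constraint_set_def alists_def)
    then show "continuous_on (weights x) (cc j)" "mix_affine (weights x) (cc j)"
      using wcon_props[OF x] by (auto simp: cc_def)
  next
    show "\<exists>m\<in>weights x. \<forall>j\<in>constraint_set. 0 \<le> cc j m"
      by (rule bexI[OF _ follows_weights[OF splice_plan_Ainf[of c, OF c(1)]]])
        (use nn[of c, OF c(1)] in \<open>auto simp: cc_def constraint_set_def\<close>)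
  next
    fix J and l :: "('s \<times> 'a) list \<times> 'i \<Rightarrow> real" and y assume J: "finite J" "J \<subseteq> constraint_set" and l: "\<And>j. j \<in> J \<Longrightarrow> 0 \<le> l j"
      and y: "y < Dval \<gamma> x s"
    have fm: "finite_mult J l \<in> Mult"
      by (rule finite_mult_Mult[OF J(1)]) (rule l)
    obtain a where a: "a \<in> plans x" "y < Lag a (finite_mult J l) \<gamma> x s"
      using less_Dval_plan[OF x \<gamma> y fm] by blast
    \<comment> \<open>The Lagrangian at \<open>s\<close> ignores what happens after other initial
      shocks; feasible plans there make the terms of the remaining constraints in \<open>J\<close>
      nonnegative.\<close>
    define c' where "c' = c(s := a)"
    have c': "c' s' \<in> plans x" for s'
      using a(1) c(1) by (simp add: c'_def)
    define a' where "a' = splice_plan c'"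
    have a': "a' \<in> plans x"
      unfolding a'_def by (rule splice_plan_Ainf[OF c'])
    have "Lag a (finite_mult J l) \<gamma> x s = Lag a' (finite_mult J l) \<gamma> x s"
      by (rule Ltil_agree) (simp add: a'_def c'_def splice_plan_def)
    also have "\<dots> = wobj x \<gamma> s (follows a')
        + (\<Sum>j | j \<in> J \<and> fst (hd (fst j)) = s. l j * cc j (follows a'))"
      unfolding Lag_eq[OF fm x a'] pen_finite_mult[OF J x a']
        wobj_follows[OF x a'] cc_def using cont_weighted[OF x a', of "[s]" \<gamma>] by simp
    also have "\<dots> \<le> wobj x \<gamma> s (follows a') + (\<Sum>j\<in>J. l j * cc j (follows a'))"
    proof -
      have "0 \<le> l j * cc j (follows a')" if jJ: "j \<in> J - {j \<in> J. fst (hd (fst j)) = s}" for j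
      proof -
        obtain k i where j: "j = (k, i)" "k \<noteq> []" "fst (hd k) \<noteq> s"
          using jJ J(2) by (cases j) (auto simp: constraint_set_def)
        then have "0 \<le> wcon x i k (follows a')"
          unfolding a'_def by (intro nn[OF c']) (auto simp: c'_def)
        then show ?thesis
          using l[of j] jJ j(1) by (simp add: cc_def)
      qed
      then have "(\<Sum>j | j \<in> J \<and> fst (hd (fst j)) = s. l j * cc j (follows a'))
          \<le> (\<Sum>j\<in>J. l j * cc j (follows a'))"
        by (intro sum_mono2 J(1)) auto
      then show ?thesis
        by simp
    qed
    finally have "y \<le> wobj x \<gamma> s (follows a') + (\<Sum>j\<in>J. l j * cc j (follows a'))"
      using a(2) by simp
    then show "\<exists>m\<in>weights x. y \<le> wobj x \<gamma> s m + (\<Sum>j\<in>J. l j * cc j m)"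
      using follows_weights[OF a'] by blast
  qed (use wobj_props[OF x] in auto)
  then show ?thesis
    by (simp add: cc_def case_prod_beta)
qed

end

section \<open>Lotteries over plans\<close>

lemma (in prob_space) integral_suminf_bounded:
  fixes f :: "nat \<Rightarrow> 'a \<Rightarrow> real"
  assumes [measurable]: "\<And>n. f n \<in> borel_measurable M"
    and b: "\<And>n x. x \<in> space M \<Longrightarrow> \<bar>f n x\<bar> \<le> b n" "summable b"
  shows "integrable M (\<lambda>x. \<Sum>n. f n x)" "(\<integral>x. (\<Sum>n. f n x) \<partial>M) = (\<Sum>n. \<integral>x. f n x \<partial>M)"
proof -
  have int: "integrable M (f n)" for n
    by (rule integrable_const_bound[of _ "b n"]) (use b in auto)
  have AE: "AE x in M. summable (\<lambda>n. norm (f n x))"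
    by (rule AE_I2) (rule summable_comparison_test'[OF b(2), of 0], use b(1) in auto)
  have "summable (\<lambda>n. \<integral>x. norm (f n x) \<partial>M)"
  proof (rule summable_comparison_test'[OF b(2), of 0])
    fix n
    have "(\<integral>x. norm (f n x) \<partial>M) \<le> b n"
      by (rule integral_le_const) (use b int in auto)
    then show "norm (\<integral>x. norm (f n x) \<partial>M) \<le> b n"
      by simp
  qed
  then show "integrable M (\<lambda>x. \<Sum>n. f n x)" "(\<integral>x. (\<Sum>n. f n x) \<partial>M) = (\<Sum>n. \<integral>x. f n x \<partial>M)"
    using integrable_suminf[OF int AE] integral_suminf[OF int AE] by auto
qed

context lottery_model
begin

abbreviation plan_space :: "'x \<Rightarrow> ('s list \<Rightarrow> 'a) measure" where
  "plan_space x \<equiv> restrict_space (PlanM A) (plans x)"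

lemma space_plan_space: "space (plan_space x) = plans x"
  by (auto simp: space_restrict_space PlanM_def space_PiM Ainf_def)

lemma follows_measurable: "(\<lambda>a. follows a k) \<in> borel_measurable (plan_space x)"
proof (induction k rule: rev_induct)
  case (snoc sb k)
  obtain s b where sb: "sb = (s, b)"
    by (cases sb)
  have "(\<lambda>a. a (map fst k @ [s])) \<in> measurable (plan_space x) (count_space A)"
    unfolding PlanM_def
    by (intro measurable_restrict_space1 measurable_component_singleton) (simp add: Hist_def)
  then have "(\<lambda>a. of_bool (a (map fst k @ [s]) = b) :: real) \<in> borel_measurable (plan_space x)"
    by (rule measurable_compose) simp
  with snoc show ?case
    by (simp add: sb follows_snoc)
qed simp

section \<open>Expected payoffs under a lottery\<close>

definition induced :: "('s list \<Rightarrow> 'a) measure \<Rightarrow> ('s \<times> 'a) list \<Rightarrow> real" where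
  "induced P k = (\<integral>a. follows a k \<partial>P)"

text \<open>\<open>wval x f\<close> is a uniformly dominated series of finite linear combinations of
  coordinates, so integrating \<open>wval x f (follows a)\<close> amounts to evaluating at the mean
  \<open>induced P\<close>.\<close>

lemma lottery_integral_wval:
  assumes P: "prob_space P" "sets P = sets (plan_space x)"
    and f: "bounded_by X A f B" and x: "x \<in> X" and k: "k \<noteq> []" "k \<in> alists A j"
  shows "integrable P (\<lambda>a. follows a k * cnt x a f (map fst k))"
    "(\<integral>a. follows a k * cnt x a f (map fst k) \<partial>P) = wval x f (induced P) k"
proof -
  interpret prob_space P
    by (rule P(1))
  have sp: "space P = plans x"
    using sets_eq_imp_space_eq[OF P(2)] by (simp add: space_plan_space)
  have [measurable]: "(\<lambda>a. follows a k) \<in> borel_measurable P" for k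
    using follows_measurable measurable_cong_sets[OF P(2) refl] by blast
  have int: "integrable P (\<lambda>a. follows a k)" for k
    by (rule integrable_const_bound[of _ 1]) (auto simp: follows_nonneg follows_le_1)
  have fm: "(\<lambda>a. \<beta> ^ n * wterm x f (follows a) k n) \<in> borel_measurable P" for n
    unfolding wterm_def by measurable
  have b: "\<bar>\<beta> ^ n * wterm x f (follows a) k n\<bar> \<le> \<beta> ^ n * \<bar>B\<bar>" if "a \<in> space P" for a n
    using wterm_bound'[OF f x _ k] follows_weights that beta unfolding sp by (simp add: abs_mult mult_left_mono)
  have sm: "summable (\<lambda>n. \<beta> ^ n * \<bar>B\<bar>)"
    using beta by (intro summable_mult2 summable_geometric) auto
  have eq: "follows a k * cnt x a f (map fst k) = wval x f (follows a) k" if "a \<in> space P" for a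
    using wval_follows[OF f x _ k(1)] that unfolding sp by simp
  have "integrable P (\<lambda>a. wval x f (follows a) k)"
    unfolding wval_def by (rule integral_suminf_bounded(1)[OF fm b sm])
  then show "integrable P (\<lambda>a. follows a k * cnt x a f (map fst k))"
    by (subst Bochner_Integration.integrable_cong[OF refl eq])
  have "(\<integral>a. follows a k * cnt x a f (map fst k) \<partial>P) = (\<integral>a. wval x f (follows a) k \<partial>P)"
    by (rule Bochner_Integration.integral_cong[OF refl eq])
  also have "\<dots> = (\<Sum>n. \<integral>a. \<beta> ^ n * wterm x f (follows a) k n \<partial>P)"
    unfolding wval_def by (rule integral_suminf_bounded(2)[OF fm b sm])
  also have "\<dots> = wval x f (induced P) k"
  proof -
    have "(\<integral>a. \<beta> ^ n * wterm x f (follows a) k n \<partial>P) = \<beta> ^ n * wterm x f (induced P) k n" for n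
      unfolding wterm_def induced_def
      by (simp add: Bochner_Integration.integral_sum int)
    then show ?thesis
      by (simp only: wval_def)
  qed
  finally show "(\<integral>a. follows a k * cnt x a f (map fst k) \<partial>P) = wval x f (induced P) k" .
qed

lemma lottery_constraint_integral:
  assumes P: "prob_space P" "sets P = sets (plan_space x)"
    and x: "x \<in> X" and k: "k \<noteq> []" "k \<in> alists A j"
  shows "integrable P (\<lambda>a. follows a k * (cnt x a (g i) (map fst k) - gbar i))"
    "(\<integral>a. follows a k * (cnt x a (g i) (map fst k) - gbar i) \<partial>P) = wcon x i k (induced P)"
proof -
  interpret prob_space P
    by (rule P(1))
  have "(\<lambda>a. follows a k) \<in> borel_measurable P"
    using follows_measurable measurable_cong_sets[OF P(2) refl] by blast
  then have int: "integrable P (\<lambda>a. follows a k * gbar i)"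
    by (intro integrable_mult_left integrable_const_bound[of _ 1]) (auto simp: follows_nonneg follows_le_1)
  note w = lottery_integral_wval[OF P bounded_g[of i] x k]
  show "integrable P (\<lambda>a. follows a k * (cnt x a (g i) (map fst k) - gbar i))"
    unfolding right_diff_distrib by (intro Bochner_Integration.integrable_diff w int)
  show "(\<integral>a. follows a k * (cnt x a (g i) (map fst k) - gbar i) \<partial>P) = wcon x i k (induced P)"
    unfolding right_diff_distrib Bochner_Integration.integral_diff[OF w(1) int] w(2) wcon_def induced_def
    by simp
qed

lemma lottery_objective:
  assumes P: "prob_space P" "sets P = sets (plan_space x)" and x: "x \<in> X"
  shows "integrable P (\<lambda>a. cnt x a (wreward \<gamma>) [s])"
    "LotObj \<beta> \<pi> \<zeta> r g \<gamma> x s P = wobj x \<gamma> s (induced P)"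
proof -
  obtain B where B: "bounded_by X A (wreward \<gamma>) B"
    using bounded_wreward by blast
  have sp: "space P = plans x"
    using sets_eq_imp_space_eq[OF P(2)] by (simp add: space_plan_space)
  have eq: "cnt x a (wreward \<gamma>) [s] = (\<Sum>b\<in>A. follows a [(s, b)] * cnt x a (wreward \<gamma>) (map fst [(s, b)]))"
    if "a \<in> space P" for a
  proof -
    have "a [s] \<in> A"
      using plan_in_A[of a A p \<zeta> x "[s]"] that sp by simp
    then show ?thesis
      using A_fin by (simp add: follows_Cons of_bool_def sum.delta' sum_distrib_right[symmetric])
  qed
  note w = lottery_integral_wval[OF P B x _ single_alists]
  show "integrable P (\<lambda>a. cnt x a (wreward \<gamma>) [s])"
    by (rule iffD2[OF Bochner_Integration.integrable_cong[OF refl eq]])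
      (use w(1) in \<open>auto intro!: Bochner_Integration.integrable_sum\<close>)
  have "LotObj \<beta> \<pi> \<zeta> r g \<gamma> x s P
      = (\<integral>a. (\<Sum>b\<in>A. follows a [(s, b)] * cnt x a (wreward \<gamma>) (map fst [(s, b)])) \<partial>P)"
    unfolding LotObj_def by (rule Bochner_Integration.integral_cong[OF refl eq])
  also have "\<dots> = wobj x \<gamma> s (induced P)"
    unfolding wobj_def using w by (subst Bochner_Integration.integral_sum) auto
  finally show "LotObj \<beta> \<pi> \<zeta> r g \<gamma> x s P = wobj x \<gamma> s (induced P)" .
qed

text \<open>Given the measurability requirements, feasibility depends on the lottery only through
  \<open>induced P\<close>, as does the objective. The problem thus becomes one over
  \<open>weights x\<close>.\<close>

lemma LotFeas_iff:
  assumes x: "x \<in> X"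
  shows "LotFeas A p \<beta> \<pi> \<zeta> g gbar x P \<longleftrightarrow> prob_space P \<and> sets P = sets (plan_space x) \<and>
    (\<forall>(k, i)\<in>constraint_set. 0 \<le> wcon x i k (induced P))"
proof (cases "prob_space P \<and> sets P = sets (plan_space x)")
  case True
  then have P: "prob_space P" "sets P = sets (plan_space x)"
    by auto
  have "(\<integral>a. (if map (\<lambda>k. a (take (Suc k) (map fst ht))) [0..<Suc t] = map snd ht
        then cnt x a (g i) (map fst ht) - gbar i else 0) \<partial>P) = wcon x i ht (induced P)"
    if ht: "ht \<in> Htil A t" for t ht i
  proof -
    have "length ht = Suc t" "ht \<noteq> []"
      using ht by (auto simp: Htil_def)
    then have "(if map (\<lambda>k. a (take (Suc k) (map fst ht))) [0..<Suc t] = map snd ht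
        then cnt x a (g i) (map fst ht) - gbar i else 0)
        = follows a ht * (cnt x a (g i) (map fst ht) - gbar i)" for a
      unfolding follows_def follows_plan_eq by (simp del: upt_Suc)
    then show ?thesis
      using lottery_constraint_integral(2)[OF P x \<open>ht \<noteq> []\<close>] ht unfolding Htil_alists by simp
  qed
  then have "LotFeas A p \<beta> \<pi> \<zeta> g gbar x P \<longleftrightarrow> (\<forall>t. \<forall>ht\<in>Htil A t. \<forall>i. 0 \<le> wcon x i ht (induced P))"
    unfolding LotFeas_def using True by simp
  also have "\<dots> \<longleftrightarrow> (\<forall>(k, i)\<in>constraint_set. 0 \<le> wcon x i k (induced P))"
  proof safe
    fix k i assume *: "\<forall>t. \<forall>ht\<in>Htil A t. \<forall>i. 0 \<le> wcon x i ht (induced P)" "(k, i) \<in> constraint_set"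
    then show "0 \<le> wcon x i k (induced P)"
      using *(1)[rule_format, of k "length k - 1"] by (auto simp: constraint_set_def Htil_def)
  next
    fix t and ht :: "('s \<times> 'a) list" and i
    assume "\<forall>(k, i)\<in>constraint_set. 0 \<le> wcon x i k (induced P)" "ht \<in> Htil A t"
    then show "0 \<le> wcon x i ht (induced P)"
      by (cases ht) (auto simp: constraint_set_def Htil_def)
  qed
  finally show ?thesis
    using True by blast
next
  case False
  then show ?thesis
    unfolding LotFeas_def by blast
qed

text \<open>The integrated penalties are nonnegative combinations of the lottery constraints, so the
  mean of the Lagrangian over \<open>Q\<close> is at least the objective; and a mean over plans is
  at most \<open>y\<close>.\<close>

lemma weak_duality_mult:
  assumes Q: "LotFeas A p \<beta> \<pi> \<zeta> g gbar x Q" and x: "x \<in> X" and lam: "lam \<in> Mult"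
    and y: "\<And>a. a \<in> plans x \<Longrightarrow> Lag a lam \<gamma> x s \<le> y"
  shows "LotObj \<beta> \<pi> \<zeta> r g \<gamma> x s Q \<le> y"
proof -
  have P: "prob_space Q" "sets Q = sets (plan_space x)"
    and con: "\<And>k i. k \<noteq> [] \<Longrightarrow> set (map snd k) \<subseteq> A \<Longrightarrow> 0 \<le> wcon x i k (induced Q)"
    using Q unfolding LotFeas_iff[OF x] by (auto simp: constraint_set_def)
  interpret prob_space Q
    by (rule P(1))
  have sp: "space Q = plans x"
    using sets_eq_imp_space_eq[OF P(2)] by (simp add: space_plan_space)
  have nn: "nonneg_mult A lam" and sm: "summable (\<lambda>t. \<beta> ^ t * mass lam t s)"
    using lam unfolding Mult_iff by auto
  \<comment> \<open>The penalty as a finite combination of the integrands of the lottery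
    constraints, to be integrated term by term; it agrees with \<open>pen\<close> on
    \<open>plans x\<close>.\<close>
  define \<rho> where "\<rho> a t = (\<Sum>b\<in>A. \<Sum>k\<in>alists A t. \<Sum>i\<in>UNIV. pathprob \<pi> (s # map fst k) * lam ((s, b) # k) $ i *
     (follows a ((s, b) # k) * (cnt x a (g i) (map fst ((s, b) # k)) - gbar i)))" for a t
  have pen: "pen a lam x s t = \<rho> a t" if "a \<in> space Q" for a t
    using pen_follows[of a x lam s t] that unfolding sp \<rho>_def by simp
  have al: "(s, b) # k \<in> alists A (Suc t)" if "b \<in> A" "k \<in> alists A t" for b k t
    using that by (simp add: alists_def)
  note w = lottery_constraint_integral[OF P x _ al]
  have rint: "integrable Q (\<lambda>a. \<rho> a t)" for t
    unfolding \<rho>_def by (intro Bochner_Integration.integrable_sum integrable_mult_right w) auto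
  have rnn: "0 \<le> (\<integral>a. \<rho> a t \<partial>Q)" for t
  proof -
    have "(\<integral>a. \<rho> a t \<partial>Q) = (\<Sum>b\<in>A. \<Sum>k\<in>alists A t. \<Sum>i\<in>UNIV.
        pathprob \<pi> (s # map fst k) * lam ((s, b) # k) $ i * wcon x i ((s, b) # k) (induced Q))"
      unfolding \<rho>_def
      by (subst Bochner_Integration.integral_sum, (intro Bochner_Integration.integrable_sum integrable_mult_right w; simp),
          intro sum.cong refl)+ (simp add: w(2)[simplified])
    also have "0 \<le> \<dots>"
    proof (intro sum_nonneg mult_nonneg_nonneg)
      fix b k i assume "b \<in> A" "k \<in> (alists A t :: ('s \<times> 'a) list set)"
      then show "0 \<le> lam ((s, b) # k) $ i" "0 \<le> wcon x i ((s, b) # k) (induced Q)"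
        using nn con by (auto simp: nonneg_mult_def alists_def)
    qed (use path_pos in \<open>auto simp: less_imp_le\<close>)
    finally show ?thesis .
  qed
  have b: "\<bar>\<beta> ^ t * \<rho> a t\<bar> \<le> Cpen * (\<beta> ^ t * mass lam t s)" if "a \<in> space Q" for a t
    using mult_left_mono[OF pen_bound[OF nn x, of a s t], of "\<beta> ^ t"] that pen beta unfolding sp
    by (simp add: abs_mult ac_simps)
  have rm: "(\<lambda>a. \<beta> ^ t * \<rho> a t) \<in> borel_measurable Q" for t
    using rint[of t] by auto
  note sums = integral_suminf_bounded[OF rm b summable_mult[OF sm]]
  note obj = lottery_objective[OF P x, of \<gamma> s]
  have "LotObj \<beta> \<pi> \<zeta> r g \<gamma> x s Q \<le> LotObj \<beta> \<pi> \<zeta> r g \<gamma> x s Q + (\<Sum>t. \<integral>a. \<beta> ^ t * \<rho> a t \<partial>Q)"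
  proof -
    have "summable (\<lambda>t. \<integral>a. \<beta> ^ t * \<rho> a t \<partial>Q)"
    proof (rule summable_comparison_test'[OF summable_mult[OF sm, of Cpen], of 0])
      fix t
      have "norm (\<integral>a. \<beta> ^ t * \<rho> a t \<partial>Q) \<le> (\<integral>a. \<bar>\<beta> ^ t * \<rho> a t\<bar> \<partial>Q)"
        using integral_norm_bound[of Q "\<lambda>a. \<beta> ^ t * \<rho> a t"] by simp
      also have "\<dots> \<le> Cpen * (\<beta> ^ t * mass lam t s)"
        by (rule integral_le_const) (use b rint[of t] in auto)
      finally show "norm (\<integral>a. \<beta> ^ t * \<rho> a t \<partial>Q) \<le> Cpen * (\<beta> ^ t * mass lam t s)" .
    qed
    then have "0 \<le> (\<Sum>t. \<integral>a. \<beta> ^ t * \<rho> a t \<partial>Q)"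
      using rnn beta by (intro suminf_nonneg) auto
    then show ?thesis
      by simp
  qed
  also have "\<dots> = (\<integral>a. cnt x a (wreward \<gamma>) [s] + (\<Sum>t. \<beta> ^ t * \<rho> a t) \<partial>Q)"
    using Bochner_Integration.integral_add[OF obj(1) sums(1)] sums(2) unfolding LotObj_def by simp
  also have "\<dots> = (\<integral>a. Lag a lam \<gamma> x s \<partial>Q)"
    by (intro Bochner_Integration.integral_cong refl)
      (use Lag_eq[OF lam x] pen cont_weighted[OF x] sp in simp)
  also have "\<dots> \<le> y"
  proof (rule integral_le_const)
    have "integrable Q (\<lambda>a. cnt x a (wreward \<gamma>) [s] + (\<Sum>t. \<beta> ^ t * \<rho> a t))"
      using obj(1) sums(1) by simp
    then show "integrable Q (\<lambda>a. Lag a lam \<gamma> x s)"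
      by (subst Bochner_Integration.integrable_cong[OF refl]) (use Lag_eq[OF lam x] pen cont_weighted[OF x] sp in simp_all)
  qed (use y sp in auto)
  finally show ?thesis .
qed

lemma weak_duality:
  assumes "LotFeas A p \<beta> \<pi> \<zeta> g gbar x Q" "x \<in> X" "\<gamma> \<in> nonneg"
  shows "LotObj \<beta> \<pi> \<zeta> r g \<gamma> x s Q \<le> Dval \<gamma> x s"
proof (rule dense_ge)
  fix y assume "Dval \<gamma> x s < y"
  then obtain lam where "lam \<in> Mult" "\<And>a. a \<in> plans x \<Longrightarrow> Lag a lam \<gamma> x s < y"
    using Dval_less_mult[OF assms(2,3)] by blast
  then show "LotObj \<beta> \<pi> \<zeta> r g \<gamma> x s Q \<le> y"
    using weak_duality_mult[OF assms(1,2)] by (meson less_imp_le)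
qed

text \<open>Conditional probabilities of the next action. At a node that is reached with probability
  0 all extensions have weight 0 as well, so any distribution fits there.\<close>

lemma weights_behavioural:
  assumes m: "m \<in> weights x"
  shows "\<exists>q :: ('s \<times> 'a) list \<times> 's \<Rightarrow> 'a pmf. \<forall>k s b. m (k @ [(s, b)]) = m k * pmf (q (k, s)) b"
proof -
  have nn: "0 \<le> m k" for k
    by (rule weights_nonneg[OF m])
  have sum: "(\<Sum>b\<in>A. m (k @ [(s, b)])) = m k" for k s
    using m by (simp add: weights_def)
  have out: "m (k @ [(s, b)]) = 0" if "b \<notin> A" for k s b
    using m that by (simp add: weights_def admh_snoc Atil_def)
  have "\<exists>q. \<forall>b. m (k @ [(s, b)]) = m k * pmf q b" for k s
  proof (cases "m k = 0")
    case True
    have "m (k @ [(s, b)]) = 0" for b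
      using sum_nonneg_eq_0_iff[OF A_fin, of "\<lambda>b. m (k @ [(s, b)])"] nn sum[of k s] True out[of b k s] by auto
    then show ?thesis
      using True by simp
  next
    case False
    let ?h = "\<lambda>b. m (k @ [(s, b)]) / m k"
    have "(\<integral>\<^sup>+b. ennreal (?h b) \<partial>count_space UNIV) = (\<Sum>b\<in>A. ennreal (?h b))"
      using A_fin out by (intro nn_integral_count_space') auto
    also have "\<dots> = ennreal (\<Sum>b\<in>A. ?h b)"
      using nn by (intro sum_ennreal) auto
    also have "\<dots> = 1"
      using sum[of k s] False by (simp flip: sum_divide_distrib)
    finally have "pmf (embed_pmf ?h) b = ?h b" for b
      using nn by (intro pmf_embed_pmf) auto
    then show ?thesis
      using False by (intro exI[of _ "embed_pmf ?h"]) simp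
  qed
  then have "\<forall>z. \<exists>q. \<forall>b. m (fst z @ [(snd z, b)]) = m (fst z) * pmf q b"
    by simp
  from choice[OF this] show ?thesis
    by (metis fst_conv snd_conv)
qed

lemma xafter_X:
  assumes "x \<in> X" "k \<in> alists A n"
  shows "xafter \<zeta> x k \<in> X"
  using assms
proof (induction k arbitrary: x n)
  case (Cons sb k)
  obtain s b where sb: "sb = (s, b)"
    by (cases sb)
  have "b \<in> A" "k \<in> alists A (length k)"
    using Cons.prems(2) by (auto simp: alists_def sb)
  then show ?case
    using Cons.IH[OF zeta_X[OF Cons.prems(1)]] by (simp add: sb)
qed simp

text \<open>Draws outside the support of the behavioural probabilities may be inadmissible; replacing
  them, on a null event, makes every draw define a plan.\<close>

definition clamp :: "'x \<Rightarrow> ('s \<times> 'a) list \<Rightarrow> 's \<Rightarrow> 'a \<Rightarrow> 'a" where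
  "clamp x k s b = (if b \<in> Atil A p (xafter \<zeta> x k) s then b else (SOME b. b \<in> Atil A p (xafter \<zeta> x k) s))"

lemma clamp_adm:
  assumes "x \<in> X" "k \<in> alists A n"
  shows "clamp x k s b \<in> Atil A p (xafter \<zeta> x k) s"
  unfolding clamp_def using someI_ex[OF adm_ex[OF xafter_X[OF assms], of s]] by simp

text \<open>\<open>\<omega>\<close> is a table with one action for each node, a node being a
  post-action history together with the next shock. Each lookup depends on the play so far, hence
  the fold.\<close>

definition play :: "'x \<Rightarrow> (('s \<times> 'a) list \<times> 's \<Rightarrow> 'a) \<Rightarrow> 's list \<Rightarrow> ('s \<times> 'a) list" where
  "play x \<omega> h = foldl (\<lambda>k s. k @ [(s, clamp x k s (\<omega> (k, s)))]) [] h"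

lemma play_Nil [simp]: "play x \<omega> [] = []"
  by (simp add: play_def)

lemma play_snoc: "play x \<omega> (h @ [s]) = play x \<omega> h @ [(s, clamp x (play x \<omega> h) s (\<omega> (play x \<omega> h, s)))]"
  by (simp add: play_def)

lemma play_alists:
  assumes "x \<in> X"
  shows "play x \<omega> h \<in> alists A (length h)"
proof (induction h rule: rev_induct)
  case (snoc s h)
  then show ?case
    using snoc_alists[OF snoc] adm_in_A[OF clamp_adm[OF assms snoc]] by (simp add: play_snoc)
qed simp

definition strategy_plan :: "'x \<Rightarrow> (('s \<times> 'a) list \<times> 's \<Rightarrow> 'a) \<Rightarrow> 's list \<Rightarrow> 'a" where
  "strategy_plan x \<omega> h = (if h = [] then undefined else snd (last (play x \<omega> h)))"

lemma strategy_plan_snoc: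
  "strategy_plan x \<omega> (h @ [s]) = clamp x (play x \<omega> h) s (\<omega> (play x \<omega> h, s))"
  by (simp add: strategy_plan_def play_snoc)

lemma htil_strategy_plan: "htil (strategy_plan x \<omega>) h = play x \<omega> h"
  by (induction h rule: rev_induct) (simp_all add: htil_snoc strategy_plan_snoc play_snoc)

lemma strategy_plan_plans:
  assumes "x \<in> X"
  shows "strategy_plan x \<omega> \<in> plans x"
  unfolding Ainf_iff
proof (intro conjI allI impI)
  fix h :: "'s list" assume "h \<noteq> []"
  then obtain h' s where h: "h = h' @ [s]"
    by (cases h rule: rev_cases) auto
  show "strategy_plan x \<omega> h \<in> Atil A p (xpath \<zeta> x (strategy_plan x \<omega>) h) (last h)"
    unfolding h xpath_snoc htil_strategy_plan strategy_plan_snoc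
    using clamp_adm[OF assms play_alists[OF assms]] by simp
qed (simp add: strategy_plan_def)

text \<open>Kuhn's theorem: drawing an action independently at every node of the history tree
  realises given behavioural probabilities by a lottery over plans.\<close>

lemma realize_weights:
  assumes x: "x \<in> X" and m: "m \<in> weights x"
  shows "\<exists>P. prob_space P \<and> sets P = sets (plan_space x) \<and> induced P = m"
proof -
  obtain q :: "('s \<times> 'a) list \<times> 's \<Rightarrow> 'a pmf" where q: "\<And>k s b. m (k @ [(s, b)]) = m k * pmf (q (k, s)) b"
    using weights_behavioural[OF m] by blast
  define \<Omega> where "\<Omega> = PiM UNIV (\<lambda>z. measure_pmf (q z))"
  interpret product_prob_space "\<lambda>z. measure_pmf (q z)" UNIV
    by (rule product_prob_spaceI) (rule prob_space_measure_pmf)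
  have prob: "prob_space \<Omega>"
    unfolding \<Omega>_def by (rule prob_space_PiM) (rule prob_space_measure_pmf)
  have sp\<Omega>: "space \<Omega> = UNIV"
    by (simp add: \<Omega>_def space_PiM)
  \<comment> \<open>Following \<open>k\<close> restricts \<open>\<omega>\<close> only at the nodes
    along \<open>k\<close>. These are distinct, so independence multiplies the conditional
    probabilities to \<open>m k\<close>; the length bound shows that the next node is new.\<close>
  have cylinder: "\<exists>J E. finite J \<and> (\<forall>z\<in>J. length (fst z) < length k) \<and>
      (\<forall>\<omega>. play x \<omega> (map fst k) = k \<longleftrightarrow> (\<forall>z\<in>J. \<omega> z \<in> E z)) \<and>
      (\<Prod>z\<in>J. measure (measure_pmf (q z)) (E z)) = m k" for k
  proof (induction k rule: rev_induct)
    case Nil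
    then show ?case
      using m by (intro exI[of _ "{}"]) (simp add: weights_def)
  next
    case (snoc sb k)
    obtain s b where sb: "sb = (s, b)"
      by (cases sb)
    obtain J E where J: "finite J" "\<And>z. z \<in> J \<Longrightarrow> length (fst z) < length k"
      and E: "\<And>\<omega>. play x \<omega> (map fst k) = k \<longleftrightarrow> (\<forall>z\<in>J. \<omega> z \<in> E z)"
      and prod: "(\<Prod>z\<in>J. measure (measure_pmf (q z)) (E z)) = m k"
      using snoc.IH by blast
    have new: "(k, s) \<notin> J"
      using J(2) by force
    define E' where "E' = E((k, s) := {b'. clamp x k s b' = b})"
    have EE': "E' z = E z" if "z \<in> J" for z
      using that new by (auto simp: E'_def)
    have "play x \<omega> (map fst (k @ [sb])) = k @ [sb] \<longleftrightarrow>
        play x \<omega> (map fst k) = k \<and> clamp x k s (\<omega> (k, s)) = b" for \<omega>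
      by (auto simp: sb play_snoc)
    then have ev: "play x \<omega> (map fst (k @ [sb])) = k @ [sb] \<longleftrightarrow> (\<forall>z\<in>insert (k, s) J. \<omega> z \<in> E' z)" for \<omega>
      using E EE' by (auto simp: E'_def)
    \<comment> \<open>Where \<open>m k\<close> is 0 both sides vanish. Otherwise every action in the
      support is admissible at this node, so clamping changes nothing almost surely.\<close>
    have "measure (measure_pmf (q (k, s))) (E' (k, s)) * m k = m (k @ [sb])"
    proof (cases "m k = 0")
      case True
      then show ?thesis
        using q[of k s b] by (simp add: sb)
    next
      case False
      have adm: "b' \<in> Atil A p (xafter \<zeta> x k) s" if "b' \<in> set_pmf (q (k, s))" for b'
      proof -
        have "m (k @ [(s, b')]) \<noteq> 0"
          using that False by (simp add: q set_pmf_iff)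
        then have "admh A p \<zeta> x (k @ [(s, b')])"
          using m by (auto simp: weights_def)
        then show ?thesis
          by (simp add: admh_snoc)
      qed
      have "E' (k, s) \<inter> set_pmf (q (k, s)) = {b} \<inter> set_pmf (q (k, s))"
        using adm by (auto simp: E'_def clamp_def)
      then have "measure (measure_pmf (q (k, s))) (E' (k, s)) = measure (measure_pmf (q (k, s))) {b}"
        by (metis measure_Int_set_pmf)
      then show ?thesis
        by (simp add: measure_pmf_single q sb)
    qed
    moreover have "(\<Prod>z\<in>insert (k, s) J. measure (measure_pmf (q z)) (E' z))
        = measure (measure_pmf (q (k, s))) (E' (k, s)) * m k"
      unfolding prod[symmetric] using J(1) new EE' by (simp cong: prod.cong)
    ultimately show ?case
      using J ev by (intro exI[of _ "insert (k, s) J"] exI[of _ E']) (auto simp: less_Suc_eq)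
  qed
  have play_prob: "measure \<Omega> {\<omega>. play x \<omega> (map fst k) = k} = m k" for k
  proof -
    obtain J E where J: "finite J" "\<And>\<omega>. play x \<omega> (map fst k) = k \<longleftrightarrow> (\<forall>z\<in>J. \<omega> z \<in> E z)"
      "(\<Prod>z\<in>J. measure (measure_pmf (q z)) (E z)) = m k"
      using cylinder[of k] by blast
    have "emeasure \<Omega> {\<omega> \<in> space \<Omega>. \<forall>z\<in>J. \<omega> z \<in> E z} = (\<Prod>z\<in>J. emeasure (measure_pmf (q z)) (E z))"
      unfolding \<Omega>_def by (rule emeasure_PiM_Collect) (use J(1) in auto)
    also have "\<dots> = ennreal (m k)"
      unfolding J(3)[symmetric] measure_pmf.emeasure_eq_measure by (rule prod_ennreal) simp
    finally show ?thesis
      using weights_nonneg[OF m] by (simp add: J(2) sp\<Omega> measure_def)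
  qed
  have comp: "(\<lambda>\<omega>. F (\<omega> z)) \<in> measurable \<Omega> (count_space B)" if "\<And>b. F b \<in> B" for F :: "'a \<Rightarrow> 'c" and B z
  proof (rule measurable_compose[of "\<lambda>\<omega>. \<omega> z"])
    show "(\<lambda>\<omega>. \<omega> z) \<in> measurable \<Omega> (measure_pmf (q z))"
      unfolding \<Omega>_def by (rule measurable_component_singleton) simp
    show "F \<in> measurable (measure_pmf (q z)) (count_space B)"
      using that by (simp add: measurable_def)
  qed
  \<comment> \<open>Which node is consulted depends on earlier play, but that play takes finitely
    many values; measurability follows by splitting on its value.\<close>
  have play_meas: "(\<lambda>\<omega>. play x \<omega> h) \<in> measurable \<Omega> (count_space (alists A (length h)))" for h
  proof (induction h rule: rev_induct)
    case (snoc s h)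
    show ?case
      unfolding play_snoc
    proof (rule measurable_compose_countable'[where I = "alists A (length h)" and g = "\<lambda>\<omega>. play x \<omega> h"
          and f = "\<lambda>k \<omega>. k @ [(s, clamp x k s (\<omega> (k, s)))]"])
      fix k assume k: "k \<in> (alists A (length h) :: ('s \<times> 'a) list set)"
      show "(\<lambda>\<omega>. k @ [(s, clamp x k s (\<omega> (k, s)))]) \<in> measurable \<Omega> (count_space (alists A (length (h @ [s]))))"
        by (rule comp) (use snoc_alists[OF k] adm_in_A[OF clamp_adm[OF x k]] in simp)
    qed (use snoc A_fin in \<open>auto intro: countable_finite\<close>)
  qed simp
  have plan_meas: "(\<lambda>\<omega>. strategy_plan x \<omega> h) \<in> measurable \<Omega> (count_space A)" if hist: "h \<in> Hist" for h
  proof -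
    obtain h' s where h: "h = h' @ [s]"
      using hist by (cases h rule: rev_cases) (auto simp: Hist_def)
    show ?thesis
      unfolding h strategy_plan_snoc
    proof (rule measurable_compose_countable'[where I = "alists A (length h')" and g = "\<lambda>\<omega>. play x \<omega> h'"
          and f = "\<lambda>k \<omega>. clamp x k s (\<omega> (k, s))"])
      fix k assume k: "k \<in> (alists A (length h') :: ('s \<times> 'a) list set)"
      show "(\<lambda>\<omega>. clamp x k s (\<omega> (k, s))) \<in> measurable \<Omega> (count_space A)"
        by (rule comp) (rule adm_in_A[OF clamp_adm[OF x k]])
    qed (use play_meas A_fin in \<open>auto intro: countable_finite\<close>)
  qed
  have meas: "strategy_plan x \<in> measurable \<Omega> (plan_space x)"
  proof (rule measurable_restrict_space2)
    show "strategy_plan x \<in> space \<Omega> \<rightarrow> plans x"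
      using strategy_plan_plans[OF x] by auto
    have "(\<lambda>\<omega> h. strategy_plan x \<omega> h) \<in> measurable \<Omega> (PlanM A)"
      unfolding PlanM_def
      by (rule measurable_PiM_single'[OF plan_meas])
        (use strategy_plan_plans[OF x] in \<open>auto simp: Ainf_def\<close>)
    then show "strategy_plan x \<in> measurable \<Omega> (PlanM A)"
      by simp
  qed
  define P where "P = distr \<Omega> (plan_space x) (strategy_plan x)"
  have "prob_space P"
    unfolding P_def by (rule prob_space.prob_space_distr[OF prob meas])
  moreover have "sets P = sets (plan_space x)"
    by (simp add: P_def)
  moreover have "induced P k = m k" for k
  proof -
    have "induced P k = (\<integral>\<omega>. follows (strategy_plan x \<omega>) k \<partial>\<Omega>)"
      unfolding induced_def P_def by (rule integral_distr[OF meas follows_measurable])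
    also have "\<dots> = (\<integral>\<omega>. indicator {\<omega>. play x \<omega> (map fst k) = k} \<omega> \<partial>\<Omega>)"
      by (intro Bochner_Integration.integral_cong refl)
        (simp add: follows_def htil_strategy_plan indicator_def)
    also have "\<dots> = m k"
      using play_prob[of k] by (simp add: sp\<Omega>)
    finally show ?thesis .
  qed
  ultimately show ?thesis
    by blast
qed

text \<open>Some family in \<open>weights x\<close> reaches at least the dual value, and weak
  duality caps every feasible lottery at it; so the lottery realising this family is optimal and
  there is no gap.\<close>

lemma strong_duality:
  assumes "x \<in> X" "\<gamma> \<in> nonneg"
  shows "\<exists>P. LotFeas A p \<beta> \<pi> \<zeta> g gbar x P \<and>
    (\<forall>Q. LotFeas A p \<beta> \<pi> \<zeta> g gbar x Q \<longrightarrow> LotObj \<beta> \<pi> \<zeta> r g \<gamma> x s Q \<le> LotObj \<beta> \<pi> \<zeta> r g \<gamma> x s P) \<and>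
    ereal (LotObj \<beta> \<pi> \<zeta> r g \<gamma> x s P) = D \<gamma> x s"
proof -
  obtain m where m: "m \<in> weights x" "Dval \<gamma> x s \<le> wobj x \<gamma> s m"
    "\<forall>(k, i)\<in>constraint_set. 0 \<le> wcon x i k m"
    using strong_duality_weights[OF assms] by blast
  obtain P where P: "prob_space P" "sets P = sets (plan_space x)" "induced P = m"
    using realize_weights[OF assms(1) m(1)] by blast
  have feas: "LotFeas A p \<beta> \<pi> \<zeta> g gbar x P"
    unfolding LotFeas_iff[OF assms(1)] using P m(3) by simp
  have "LotObj \<beta> \<pi> \<zeta> r g \<gamma> x s P = Dval \<gamma> x s"
    using weak_duality[OF feas assms] m(2) lottery_objective(2)[OF P(1,2) assms(1)] P(3)
    by (simp add: antisym)
  then show ?thesis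
    using feas weak_duality[OF _ assms] ereal_Dval[OF assms] by metis
qed

end

theorem theorem4p7:
  fixes \<pi> :: "'s::finite \<Rightarrow> 's \<Rightarrow> real"
    and A :: "(real ^ 'n) set"
    and X :: "(real ^ 'm) set"
    and \<zeta> :: "real ^ 'm \<Rightarrow> real ^ 'n \<Rightarrow> 's \<Rightarrow> real ^ 'm"
    and p r :: "real ^ 'm \<Rightarrow> real ^ 'n \<Rightarrow> 's \<Rightarrow> real"
    and g :: "'i::finite \<Rightarrow> real ^ 'm \<Rightarrow> real ^ 'n \<Rightarrow> 's \<Rightarrow> real"
    and gbar :: "'i \<Rightarrow> real"
    and \<beta> :: real
  assumes pi_pos: "\<And>s s'. \<pi> s s' > 0"
    and pi_sum: "\<And>s. (\<Sum>s'\<in>UNIV. \<pi> s s') = 1"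
    and A_fin: "finite A"
    and X_cnt: "countable X"
    and zeta_X: "\<And>x a s. x \<in> X \<Longrightarrow> a \<in> A \<Longrightarrow> \<zeta> x a s \<in> X"
    and r_bdd: "\<exists>B. \<forall>x\<in>X. \<forall>a\<in>A. \<forall>s. \<bar>r x a s\<bar> \<le> B"
    and g_bdd: "\<And>i. \<exists>B. \<forall>x\<in>X. \<forall>a\<in>A. \<forall>s. \<bar>g i x a s\<bar> \<le> B"
    and beta: "0 < \<beta>" "\<beta> < 1"
    and feas_ex: "\<And>x0 s0. x0 \<in> X \<Longrightarrow> \<exists>a. feasible A p \<zeta> \<pi> \<beta> g gbar x0 s0 a"
  shows "(\<forall>\<gamma>\<in>nonneg. \<forall>x0\<in>X. \<forall>s0.
            \<exists>P. LotFeas A p \<beta> \<pi> \<zeta> g gbar x0 P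
              \<and> (\<forall>Q. LotFeas A p \<beta> \<pi> \<zeta> g gbar x0 Q \<longrightarrow> LotObj \<beta> \<pi> \<zeta> r g \<gamma> x0 s0 Q \<le> LotObj \<beta> \<pi> \<zeta> r g \<gamma> x0 s0 P)
              \<and> ereal (LotObj \<beta> \<pi> \<zeta> r g \<gamma> x0 s0 P) = Dtil A p \<beta> \<pi> \<zeta> r g gbar \<gamma> x0 s0)
       \<and> (\<exists>F. inN X A p \<beta> \<pi> \<zeta> r g gbar F \<and> Bellman X A p \<beta> \<pi> \<zeta> r g gbar F
              \<and> (\<forall>\<gamma>\<in>nonneg. \<forall>x\<in>X. \<forall>s. ereal (F \<gamma> x s) = Dtil A p \<beta> \<pi> \<zeta> r g gbar \<gamma> x s)
              \<and> (\<forall>G. inN X A p \<beta> \<pi> \<zeta> r g gbar G \<and> Bellman X A p \<beta> \<pi> \<zeta> r g gbar G \<longrightarrow>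
                   (\<forall>\<gamma>\<in>nonneg. \<forall>x\<in>X. \<forall>s. G \<gamma> x s \<le> F \<gamma> x s)))"
proof -
  interpret lottery_model \<pi> A X \<zeta> p r g gbar \<beta>
    by unfold_locales (fact assms)+
  show ?thesis
  proof (intro conjI exI[of _ Dval])
    show "\<forall>\<gamma>\<in>nonneg. \<forall>x0\<in>X. \<forall>s0.
            \<exists>P. LotFeas A p \<beta> \<pi> \<zeta> g gbar x0 P
              \<and> (\<forall>Q. LotFeas A p \<beta> \<pi> \<zeta> g gbar x0 Q \<longrightarrow> LotObj \<beta> \<pi> \<zeta> r g \<gamma> x0 s0 Q \<le> LotObj \<beta> \<pi> \<zeta> r g \<gamma> x0 s0 P)
              \<and> ereal (LotObj \<beta> \<pi> \<zeta> r g \<gamma> x0 s0 P) = D \<gamma> x0 s0"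
      using strong_duality by blast
  qed (use Dval_inN Dval_Bellman ereal_Dval Bellman_le_Dval in auto)
qed

end
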